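(* Let $V$ be a vertex algebra, $g$ an automorphism of $V$ with $g^T=1$ for some integer $T\ge1$, $m\in\frac1T\mathbb N$, and $U$ an $\tilde A_{g,m}(V)$-module. Then $M_g^{(m)}(U)=\bigoplus_{n\in\frac1T\mathbb N}\tilde A_{g,n,m}(V)\otimes_{\tilde A_{g,m}(V)}U$, with $Y_{M_g^{(m)}(U)}(u,z)=\sum_{p\in\frac1T\mathbb Z}u_pz^{-p-1}$, is a $\frac1T\mathbb N$-graded $g$-twisted $\phi$-coordinated $V$-module with $M_g^{(m)}(U)(n)=\tilde A_{g,n,m}(V)\otimes_{\tilde A_{g,m}(V)}U$.
   Context: All vector spaces are over $\mathbb C$; $\mathbb N=\{0,1,2,\dots\}$. For a vertex algebra $(V,Y,\mathbf 1)$ write $Y(v,x)=\sum_{n\in\mathbb Z}v_nx^{-n-1}$ and $\mathcal D v=v_{-2}\mathbf 1$. $V^r=\{v\in V: gv=e^{2\pi\sqrt{-1}r/T}v\}$, $0\le r\le T-1$. A $g$-twisted $\phi$-coordinated $V$-module is a vector space $W$ with a linear map $Y_W(\cdot,x):V\to \mathrm{Hom}(W,W((x^{1/T})))$, $Y_W(v,x)=\sum_{n\in\frac1T\mathbb Z}v_nx^{-n-1}$, such that: (1) $Y_W(\mathbf 1,x)=\mathrm{id}_W$; (2) $Y_W(u,x)w\in x^{-r/T}W((x))$ for $u\in V^r$, $w\in W$; (3) for all $u,v\in V$ there is $k\in\mathbb N$ with $(x_1-x_2)^kY_W(u,x_1)Y_W(v,x_2)\in \mathrm{Hom}(W,W((x_1^{1/T},x_2^{1/T})))$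 and $x_2^k(e^{x_0}-1)^kY_W(Y(u,x_0)v,x_2)=\big((x_1-x_2)^kY_W(u,x_1)Y_W(v,x_2)\big)|_{x_1^{1/T}=(x_2e^{x_0})^{1/T}}$. It is $\frac1T\mathbb N$-graded if equipped with a grading $W=\bigoplus_{n\in\frac1T\mathbb N}W(n)$ with $v_mW(n)\subseteq W(n-m-1)$ for all $v\in V$, $m\in\frac1T\mathbb Z$ ($W(i)=0$ for $i<0$). For $k,l\in\{0,\dots,T-1\}$ let $\delta_k(l)=1$ if $k\ge l$, $0$ if $k<l$, and $\delta_k(T)=0$. Write $n\in\frac1T\mathbb Z$ as $n=\lfloor n\rfloor+\bar n/T$ with $\bar n\in\{0,\dots,T-1\}$. For $u\in V^r$, $v\in V$, $m,n,p\in\frac1T\mathbb N$ with $\bar p-\bar n\equiv r \pmod T$ set $$u\bullet_{g,m,p}^{n}v=\sum_{i=0}^{\lfloor p\rfloor}(-1)^i\binom{\lfloor m\rfloor+\lfloor n\rfloor-\lfloor p\rfloor-1+\delta_{\bar m}(r)+\delta_{\bar n}(T-r)+i}{i}\mathrm{Res}_y\frac{(1+y)^{-1+\lfloor m\rfloor+\delta_{\bar m}(r)+r/T}}{y^{\lfloor m\rfloor+\lfloor n\rfloor-\lfloor p\rfloor+\delta_{\bar m}(r)+\delta_{\bar n}(T-r)+i}}Y(u,\log(1+y))v,$$ and $u\bullet_{g,m,p}^nv=0$ if $\bar p-\bar n\not\equiv r$; extend bilinearly. For $u\in V^r$, $v\in V$ put $$u\diamond_{g,m}^nv=\mathrm{Res}_y\frac{(1+y)^{-1+\delta_{\bar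 m}(r)+\lfloor m\rfloor+r/T}}{y^{\lfloor m\rfloor+\lfloor n\rfloor+\delta_{\bar m}(r)+\delta_{\bar n}(T-r)+1}}Y(u,\log(1+y))v.$$ For $n,m\in\frac1T\mathbb N$ let $\tilde O'_{g,n,m}(V)=\mathrm{span}\{u\diamond_{g,m}^nv\}+\mathrm{span}\{(\mathcal D+m-n)u\}$ ($u,v\in V$); $\tilde O''_{g,n,m}(V)$ the span of all $u\bullet_{g,m,p_3}^n\big((a\bullet_{g,p_1,p_2}^{p_3}b)\bullet_{g,m,p_1}^{p_3}c-a\bullet_{g,m,p_2}^{p_3}(b\bullet_{g,m,p_1}^{p_2}c)\big)$ with $a,b,c,u\in V$, $p_1,p_2,p_3\in\frac1T\mathbb N$; $\tilde O'''_{g,n,m}(V)=\sum_{p_1,p_2\in\frac1T\mathbb N}(V\bullet_{g,p_1,p_2}^n\tilde O'_{g,p_2,p_1}(V))\bullet_{g,m,p_1}^nV$; $\tilde O_{g,n,m}(V)=\tilde O'_{g,n,m}(V)+\tilde O''_{g,n,m}(V)+\tilde O'''_{g,n,m}(V)$ and $\tilde A_{g,n,m}(V)=V/\tilde O_{g,n,m}(V)$. $\tilde A_{g,m}(V)=V/\tilde O'_{g,m,m}(V)$ is an associative algebra under $\bullet_{g,m,m}^m$ with identity the class of $\mathbf 1$; $\tilde A_{g,n,m}(V)$ is an $\tilde A_{g,n}(V)$-$\tilde A_{g,m}(V)$-bimodule with left action $\bullet_{g,m,n}^n$ and right action $\bullet_{g,m,m}^n$. For $u,v\in V$, $w\in U$,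 $p\in\frac1T\mathbb Z$, the operator $u_p$ on $M_g^{(m)}(U)$ is $u_p\big((v+\tilde O_{g,n,m}(V))\otimes w\big)=\big(u\bullet_{g,m,n}^{n-p-1}v+\tilde O_{g,n-p-1,m}(V)\big)\otimes w$ if $n-p-1\ge0$, and $0$ otherwise.
   Formalization: The right action of Ã_{g,m}(V) on Ã_{g,n,m}(V) is taken to be •_{g,m,m}^n instead of the printed •_{g,m,m}^m, under which the class of 1 does not act as the identity when n≠m. *)

theory Defs
  imports
    "HOL-Computational_Algebra.Formal_Laurent_Series"
    "HOL-Library.Poly_Mapping"
    "HOL-Library.Set_Algebras"
    "HOL-Algebra.Algebraic_Closure_Type"
begin

text \<open>
  The vertex algebra is a whole type with a scalar multiplication. The spaces that are constructed
  from it (quotients, tensor products, direct sums) and the modules over it are carrier-based, as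
  records \<open>(complex, _) module\<close> of HOL-Algebra over the ring \<open>ring_of_type_algebra\<close> of complex numbers.
  The locale \<open>Module.module\<close> ignores the record fields \<open>mult\<close> and \<open>one\<close>, so they are left
  undefined unless the space is an algebra.
\<close>

section \<open>Linear algebra\<close>

definition quotient_space ::
    "(complex \<Rightarrow> 'a \<Rightarrow> 'a) \<Rightarrow> 'a set \<Rightarrow> 'a set \<Rightarrow> (complex, 'a::ab_group_add set) module" where
  "quotient_space scale S N =
     \<lparr>carrier = (\<lambda>x. x +o N) ` S, monoid.mult = undefined, one = undefined, zero = N, add = (+),
      module.smult = (\<lambda>c B. scale c ` B + N)\<rparr>"

text \<open>External direct sum: extensional families of finite support, as in \<open>sum_group\<close> of HOL-Algebra.\<close>

definition direct_sum ::
    "'i set \<Rightarrow> ('i \<Rightarrow> (complex, 'x) module) \<Rightarrow> (complex, 'i \<Rightarrow> 'x) module" where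
  "direct_sum I B =
     \<lparr>carrier = {f \<in> \<Pi>\<^sub>E i\<in>I. carrier (B i). finite {i \<in> I. f i \<noteq> \<zero>\<^bsub>B i\<^esub>}},
      monoid.mult = undefined, one = undefined,
      zero = (\<lambda>i\<in>I. \<zero>\<^bsub>B i\<^esub>),
      add = (\<lambda>f h. \<lambda>i\<in>I. f i \<oplus>\<^bsub>B i\<^esub> h i),
      module.smult = (\<lambda>c f. \<lambda>i\<in>I. c \<odot>\<^bsub>B i\<^esub> f i)\<rparr>"

definition direct_sum_inj ::
    "'i set \<Rightarrow> ('i \<Rightarrow> (complex, 'x) module) \<Rightarrow> 'i \<Rightarrow> 'x \<Rightarrow> 'i \<Rightarrow> 'x" where
  "direct_sum_inj I B i x = (\<lambda>j\<in>I. if j = i then x else \<zero>\<^bsub>B j\<^esub>)"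

text \<open>Unital left modules over a (noncommutative) complex algebra \<open>A\<close>.\<close>

locale algebra_left_module =
  Module.module "ring_of_type_algebra :: complex ring" U
  for A :: "(complex, 'a) module" and U :: "(complex, 'u) module" and act :: "'a \<Rightarrow> 'u \<Rightarrow> 'u" +
  assumes act_closed: "\<lbrakk>a \<in> carrier A; u \<in> carrier U\<rbrakk> \<Longrightarrow> act a u \<in> carrier U"
    and act_add_left: "\<lbrakk>a \<in> carrier A; b \<in> carrier A; u \<in> carrier U\<rbrakk>
          \<Longrightarrow> act (a \<oplus>\<^bsub>A\<^esub> b) u = act a u \<oplus>\<^bsub>U\<^esub> act b u"
    and act_add_right: "\<lbrakk>a \<in> carrier A; u \<in> carrier U; w \<in> carrier U\<rbrakk>
          \<Longrightarrow> act a (u \<oplus>\<^bsub>U\<^esub> w) = act a u \<oplus>\<^bsub>U\<^esub> act a w"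
    and act_smult_left: "\<lbrakk>a \<in> carrier A; u \<in> carrier U\<rbrakk>
          \<Longrightarrow> act (c \<odot>\<^bsub>A\<^esub> a) u = c \<odot>\<^bsub>U\<^esub> act a u"
    and act_smult_right: "\<lbrakk>a \<in> carrier A; u \<in> carrier U\<rbrakk>
          \<Longrightarrow> act a (c \<odot>\<^bsub>U\<^esub> u) = c \<odot>\<^bsub>U\<^esub> act a u"
    and act_mult: "\<lbrakk>a \<in> carrier A; b \<in> carrier A; u \<in> carrier U\<rbrakk>
          \<Longrightarrow> act (a \<otimes>\<^bsub>A\<^esub> b) u = act a (act b u)"
    and act_one: "u \<in> carrier U \<Longrightarrow> act \<one>\<^bsub>A\<^esub> u = u"

subsection \<open>Tensor products over a noncommutative algebra\<close>

definition free_scale :: "complex \<Rightarrow> ('b \<Rightarrow>\<^sub>0 complex) \<Rightarrow> ('b \<Rightarrow>\<^sub>0 complex)" where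
  "free_scale c f = Poly_Mapping.map ((*) c) f"

lemma lookup_free_scale [simp]:
  "Poly_Mapping.lookup (free_scale c f) b = c * Poly_Mapping.lookup f b"
  unfolding free_scale_def by (simp add: Poly_Mapping.map.rep_eq when_def)

interpretation free_space: vector_space free_scale
  by standard (auto intro!: poly_mapping_eqI simp: lookup_add algebra_simps)

abbreviation free_gen :: "'b \<Rightarrow> ('b \<Rightarrow>\<^sub>0 complex)" where
  "free_gen b \<equiv> Poly_Mapping.single b 1"

definition tensor_relations ::
    "(complex, 'a) module \<Rightarrow> (complex, 'x) module \<Rightarrow> ('x \<Rightarrow> 'a \<Rightarrow> 'x) \<Rightarrow>
     (complex, 'u) module \<Rightarrow> ('a \<Rightarrow> 'u \<Rightarrow> 'u) \<Rightarrow> (('x \<times> 'u) \<Rightarrow>\<^sub>0 complex) set" where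
  "tensor_relations A B ract U lact = free_space.span (
     {free_gen (x \<oplus>\<^bsub>B\<^esub> y, u) - free_gen (x, u) - free_gen (y, u) |x y u.
        x \<in> carrier B \<and> y \<in> carrier B \<and> u \<in> carrier U} \<union>
     {free_gen (x, u \<oplus>\<^bsub>U\<^esub> w) - free_gen (x, u) - free_gen (x, w) |x u w.
        x \<in> carrier B \<and> u \<in> carrier U \<and> w \<in> carrier U} \<union>
     {free_gen (c \<odot>\<^bsub>B\<^esub> x, u) - free_scale c (free_gen (x, u)) |c x u.
        x \<in> carrier B \<and> u \<in> carrier U} \<union>
     {free_gen (x, c \<odot>\<^bsub>U\<^esub> u) - free_scale c (free_gen (x, u)) |c x u.
        x \<in> carrier B \<and> u \<in> carrier U} \<union>
     {free_gen (ract x a, u) - free_gen (x, lact a u) |x a u.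
        x \<in> carrier B \<and> a \<in> carrier A \<and> u \<in> carrier U})"

definition tensor_product ::
    "(complex, 'a) module \<Rightarrow> (complex, 'x) module \<Rightarrow> ('x \<Rightarrow> 'a \<Rightarrow> 'x) \<Rightarrow>
     (complex, 'u) module \<Rightarrow> ('a \<Rightarrow> 'u \<Rightarrow> 'u) \<Rightarrow>
     (complex, (('x \<times> 'u) \<Rightarrow>\<^sub>0 complex) set) module" where
  "tensor_product A B ract U lact =
     quotient_space free_scale {f. Poly_Mapping.keys f \<subseteq> carrier B \<times> carrier U}
       (tensor_relations A B ract U lact)"

definition pure_tensor ::
    "(complex, 'a) module \<Rightarrow> (complex, 'x) module \<Rightarrow> ('x \<Rightarrow> 'a \<Rightarrow> 'x) \<Rightarrow>
     (complex, 'u) module \<Rightarrow> ('a \<Rightarrow> 'u \<Rightarrow> 'u) \<Rightarrow> 'x \<Rightarrow> 'u \<Rightarrow> (('x \<times> 'u) \<Rightarrow>\<^sub>0 complex) set" where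
  "pure_tensor A B ract U lact x u = free_gen (x, u) +o tensor_relations A B ract U lact"

section \<open>Vertex algebras and automorphisms of finite order\<close>

text \<open>
  \<open>mode u n v\<close> is \<open>u\<^sub>n v\<close>. The axiom \<open>jacobi\<close> is the Jacobi identity read off coefficient by
  coefficient; by \<open>truncation\<close> all its sums have finite support.
\<close>

locale vertex_algebra = vector_space scale
  for scale :: "complex \<Rightarrow> 'v::ab_group_add \<Rightarrow> 'v" (infixr \<open>*s\<close> 75) +
  fixes mode :: "'v \<Rightarrow> int \<Rightarrow> 'v \<Rightarrow> 'v" and vac :: 'v
  assumes mode_linear_right: "Vector_Spaces.linear scale scale (mode u n)"
    and mode_linear_left: "Vector_Spaces.linear scale scale (\<lambda>u. mode u n v)"
    and truncation: "\<exists>N. \<forall>n\<ge>N. mode u n v = 0"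
    and vacuum: "mode vac n v = (if n = -1 then v else 0)"
    and creation: "n \<ge> 0 \<Longrightarrow> mode v n vac = 0" "mode v (-1) vac = v"
    and jacobi:
      "Sum_any (\<lambda>i::nat. (of_int m gchoose i) *s mode (mode u (l + int i) v) (m + n - int i) w) =
       Sum_any (\<lambda>i::nat. ((-1) ^ i * (of_int l gchoose i)) *s
         (mode u (m + l - int i) (mode v (n + int i) w)
          - ((-1) powi l) *s mode v (l + n - int i) (mode u (m + int i) w)))"
begin

definition D :: "'v \<Rightarrow> 'v" where
  "D v = mode v (-2) vac"

text \<open>The coefficient of \<open>y\<^sup>j\<close> in \<open>h(y) Y(u, f(y)) v\<close>, where \<open>f\<close> has positive order in \<open>y\<close>.\<close>

definition Y_subst_coeff :: "complex fls \<Rightarrow> complex fls \<Rightarrow> 'v \<Rightarrow> 'v \<Rightarrow> int \<Rightarrow> 'v" where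
  "Y_subst_coeff h f u v j = Sum_any (\<lambda>n::int. fls_nth (h * f powi (- n - 1)) j *s mode u n v)"

text \<open>\<open>res_Y a b u v\<close> is the residue of \<open>(1+y)\<^sup>a y\<^sup>-\<^sup>b Y(u, log(1+y)) v\<close>.\<close>

definition res_Y :: "complex \<Rightarrow> int \<Rightarrow> 'v \<Rightarrow> 'v \<Rightarrow> 'v" where
  "res_Y a b u v =
     Y_subst_coeff (fps_to_fls (fps_binomial a) * fls_X powi (- b)) (fps_to_fls (fps_ln 1)) u v (-1)"

end

definition frac_ints :: "nat \<Rightarrow> rat set" where
  "frac_ints T = range (\<lambda>k::int. of_int k / of_nat T)"

definition frac_nats :: "nat \<Rightarrow> rat set" where
  "frac_nats T = range (\<lambda>k::nat. of_nat k / of_nat T)"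

text \<open>For \<open>n\<close> in \<open>frac_ints T\<close>: \<open>n = \<lfloor>n\<rfloor> + bar T n / T\<close>.\<close>

definition bar :: "nat \<Rightarrow> rat \<Rightarrow> nat" where
  "bar T n = nat \<lfloor>of_nat T * frac n\<rfloor>"

text \<open>The convention \<open>\<delta>\<^sub>k(T) = 0\<close> is automatic since \<open>k < T\<close>.\<close>

definition step_delta :: "nat \<Rightarrow> nat \<Rightarrow> int" where
  "step_delta k l = (if l \<le> k then 1 else 0)"

locale vertex_algebra_aut = vertex_algebra scale mode vac
  for scale :: "complex \<Rightarrow> 'v::ab_group_add \<Rightarrow> 'v" (infixr \<open>*s\<close> 75) and mode vac +
  fixes g :: "'v \<Rightarrow> 'v" and T :: nat
  assumes g_linear: "Vector_Spaces.linear scale scale g"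
    and g_bij: "bij g"
    and g_vac: "g vac = vac"
    and g_mode: "g (mode u n v) = mode (g u) n (g v)"
    and T_pos: "T \<ge> 1"
    and g_power: "g ^^ T = id"
begin

definition eigenspace :: "nat \<Rightarrow> 'v set" where
  "eigenspace r = {v. g v = exp (2 * of_real pi * \<i> * of_nat r / of_nat T) *s v}"

text \<open>The component of \<open>v\<close> in \<open>eigenspace r\<close>, by averaging over the cyclic group generated by \<open>g\<close>;
  see \<open>sum_component\<close> and \<open>component_in_eigenspace\<close> below.\<close>

definition component :: "nat \<Rightarrow> 'v \<Rightarrow> 'v" where
  "component r v = (1 / of_nat T) *s
     (\<Sum>j<T. exp (- (2 * of_real pi * \<i> * of_nat r * of_nat j / of_nat T)) *s (g ^^ j) v)"

lemma exp_minus_two_pi_nat: "exp (- (2 * of_real pi * \<i> * of_nat n)) = (1::complex)"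
proof -
  have "exp (of_nat n * (2 * of_real pi * \<i>)) = (1::complex)"
    unfolding exp_of_nat_mult by simp
  then show ?thesis by (simp add: exp_minus mult_ac)
qed

lemma component_in_eigenspace: "component r v \<in> eigenspace r"
proof -
  define \<omega> where "\<omega> = exp (2 * of_real pi * \<i> * of_nat r / of_nat T :: complex)"
  define h where "h j = exp (- (2 * of_real pi * \<i> * of_nat r * of_nat j / of_nat T :: complex)) *s (g ^^ j) v" for j
  interpret g: Vector_Spaces.linear scale scale g by (rule g_linear)
  have T0: "(of_nat T :: complex) \<noteq> 0" using T_pos by simp
  have step: "g (h j) = \<omega> *s h (Suc j)" for j
  proof -
    have "\<omega> * exp (- (2 * of_real pi * \<i> * of_nat r * of_nat (Suc j) / of_nat T)) =
          exp (- (2 * of_real pi * \<i> * of_nat r * of_nat j / of_nat T))"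
      unfolding \<omega>_def exp_add [symmetric] using T0 by (simp add: field_simps)
    then show ?thesis by (simp add: h_def g.scale)
  qed
  have "h T = h 0"
    using T0 g_power by (simp add: h_def exp_minus_two_pi_nat)
  then have "(\<Sum>j<T. h (Suc j)) = (\<Sum>j<T. h j)"
    using sum.lessThan_Suc_shift [of h T] by simp
  then have "g (\<Sum>j<T. h j) = \<omega> *s (\<Sum>j<T. h j)"
    by (simp add: g.sum step scale_sum_right [symmetric])
  then have "g (component r v) = \<omega> *s component r v"
    unfolding component_def h_def [symmetric] by (simp add: g.scale)
  then show ?thesis
    by (simp add: eigenspace_def \<omega>_def)
qed

lemma sum_component: "(\<Sum>r<T. component r v) = v"
proof -
  have T0: "(of_nat T :: complex) \<noteq> 0" using T_pos by simp
  have char_sum: "(\<Sum>r<T. exp (- (2 * of_real pi * \<i> * of_nat r * of_nat j / of_nat T))) =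
      (if j = 0 then of_nat T else (0::complex))" if "j < T" for j
  proof (cases "j = 0")
    case False
    define z where "z = exp (- (2 * of_real pi * \<i> * of_nat j / of_nat T :: complex))"
    have pow: "exp (- (2 * of_real pi * \<i> * of_nat r * of_nat j / of_nat T)) = z ^ r" for r
      unfolding z_def exp_of_nat_mult [symmetric] by (simp add: mult_ac)
    have "z ^ T = exp (- (2 * of_real pi * \<i> * of_nat j))"
      unfolding z_def exp_of_nat_mult [symmetric] using T0 by simp
    also have "\<dots> = 1"
      by (rule exp_minus_two_pi_nat)
    finally have "z ^ T = 1" .
    moreover have "z \<noteq> 1"
    proof
      assume "z = 1"
      then have eq: "cis (2 * pi * real j / real T) = cis (2 * pi * real 0 / real T)"
        by (simp add: z_def exp_minus cis_conv_exp mult_ac)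
      have "inj_on (\<lambda>k. cis (2 * pi * real k / real T)) {..<T}"
        using bij_betw_roots_unity [of T] T_pos by (simp add: bij_betw_def)
      from inj_onD [OF this eq] have "j = 0"
        using that T_pos by simp
      then show False using False by simp
    qed
    ultimately show ?thesis using False
      by (simp add: pow sum_gp_strict)
  qed simp
  have "(\<Sum>r<T. component r v) =
      (1 / of_nat T) *s (\<Sum>r<T. \<Sum>j<T. exp (- (2 * of_real pi * \<i> * of_nat r * of_nat j / of_nat T)) *s (g ^^ j) v)"
    unfolding component_def by (simp add: scale_sum_right)
  also have "\<dots> = (1 / of_nat T) *s (\<Sum>j<T. (\<Sum>r<T. exp (- (2 * of_real pi * \<i> * of_nat r * of_nat j / of_nat T))) *s (g ^^ j) v)"
    by (subst sum.swap) (simp add: scale_sum_left)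
  also have "\<dots> = (1 / of_nat T) *s (\<Sum>j<T. if j = 0 then of_nat T *s v else 0)"
    by (intro arg_cong [where f = "scale _"] sum.cong) (auto simp: char_sum)
  also have "\<dots> = v"
    using T_pos T0 by simp
  finally show ?thesis .
qed

definition res_exponent :: "rat \<Rightarrow> nat \<Rightarrow> complex" where
  "res_exponent m r = of_int (- 1 + \<lfloor>m\<rfloor> + step_delta (bar T m) r) + of_nat r / of_nat T"

text \<open>In \<open>bullet m p n u v\<close> the arguments come in the order of the indices of
  \<open>u \<bullet>\<^bsub>g,m,p\<^esub>\<^bsup>n\<^esup> v\<close>, and \<open>diamond m n r u v\<close> is \<open>u \<diamond>\<^bsub>g,m\<^esub>\<^bsup>n\<^esup> v\<close> for \<open>u\<close> in \<open>eigenspace r\<close>.\<close>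

definition bullet_hom :: "rat \<Rightarrow> rat \<Rightarrow> rat \<Rightarrow> nat \<Rightarrow> 'v \<Rightarrow> 'v \<Rightarrow> 'v" where
  "bullet_hom m p n r u v =
     (let e = \<lfloor>m\<rfloor> + \<lfloor>n\<rfloor> - \<lfloor>p\<rfloor> + step_delta (bar T m) r + step_delta (bar T n) (T - r)
      in if (int (bar T p) - int (bar T n)) mod int T = int r mod int T
         then \<Sum>i\<le>nat \<lfloor>p\<rfloor>. ((-1) ^ i * (of_int (e - 1 + int i) gchoose i)) *s
                res_Y (res_exponent m r) (e + int i) u v
         else 0)"

definition bullet :: "rat \<Rightarrow> rat \<Rightarrow> rat \<Rightarrow> 'v \<Rightarrow> 'v \<Rightarrow> 'v" where
  "bullet m p n u v = (\<Sum>r<T. bullet_hom m p n r (component r u) v)"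

definition diamond :: "rat \<Rightarrow> rat \<Rightarrow> nat \<Rightarrow> 'v \<Rightarrow> 'v \<Rightarrow> 'v" where
  "diamond m n r u v =
     res_Y (res_exponent m r)
       (\<lfloor>m\<rfloor> + \<lfloor>n\<rfloor> + step_delta (bar T m) r + step_delta (bar T n) (T - r) + 1) u v"

definition O1 :: "rat \<Rightarrow> rat \<Rightarrow> 'v set" where
  "O1 n m = span {diamond m n r u v |r u v. r < T \<and> u \<in> eigenspace r}
          + span {D u + of_rat (m - n) *s u |u. True}"

definition O2 :: "rat \<Rightarrow> rat \<Rightarrow> 'v set" where
  "O2 n m = span {bullet m p3 n u
        (bullet m p1 p3 (bullet p1 p2 p3 a b) c - bullet m p2 p3 a (bullet m p1 p2 b c))
      |a b c u p1 p2 p3. p1 \<in> frac_nats T \<and> p2 \<in> frac_nats T \<and> p3 \<in> frac_nats T}"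

definition O3 :: "rat \<Rightarrow> rat \<Rightarrow> 'v set" where
  "O3 n m = span {bullet m p1 n (bullet p1 p2 n u x) v
      |u x v p1 p2. p1 \<in> frac_nats T \<and> p2 \<in> frac_nats T \<and> x \<in> O1 p2 p1}"

definition O_tilde :: "rat \<Rightarrow> rat \<Rightarrow> 'v set" where
  "O_tilde n m = O1 n m + O2 n m + O3 n m"

definition A_bimod :: "rat \<Rightarrow> rat \<Rightarrow> (complex, 'v set) module" where
  "A_bimod n m = quotient_space scale UNIV (O_tilde n m)"

text \<open>Products of cosets are formed from all representatives, as in \<^const>\<open>rcoset_mult\<close>.\<close>

definition A_alg :: "rat \<Rightarrow> (complex, 'v set) module" where
  "A_alg m = (quotient_space scale UNIV (O1 m m))
     \<lparr>monoid.mult := (\<lambda>B Z. \<Union>x\<in>B. \<Union>z\<in>Z. bullet m m m x z +o O1 m m),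
      one := vac +o O1 m m\<rparr>"

text \<open>The right action of \<open>A_alg m\<close> on \<open>A_bimod n m\<close> is induced by \<open>\<bullet>\<^bsub>g,m,m\<^esub>\<^bsup>n\<^esup>\<close>, with upper index
  \<open>n\<close>: the product \<open>\<bullet>\<^bsub>g,m,p\<^esub>\<^bsup>n\<^esup>\<close> pairs degrees \<open>(n, p)\<close> and \<open>(p, m)\<close> into \<open>(n, m)\<close>.\<close>

definition A_right_act :: "rat \<Rightarrow> rat \<Rightarrow> 'v set \<Rightarrow> 'v set \<Rightarrow> 'v set" where
  "A_right_act n m B Z = (\<Union>x\<in>B. \<Union>z\<in>Z. bullet m m n x z +o O_tilde n m)"

section \<open>The space \<open>M\<^sub>g\<^sup>(\<^sup>m\<^sup>)(U)\<close>\<close>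

definition M_part :: "rat \<Rightarrow> (complex, 'u) module \<Rightarrow> ('v set \<Rightarrow> 'u \<Rightarrow> 'u) \<Rightarrow> rat \<Rightarrow>
    (complex, (('v set \<times> 'u) \<Rightarrow>\<^sub>0 complex) set) module" where
  "M_part m U act n = tensor_product (A_alg m) (A_bimod n m) (A_right_act n m) U act"

definition M_space :: "rat \<Rightarrow> (complex, 'u) module \<Rightarrow> ('v set \<Rightarrow> 'u \<Rightarrow> 'u) \<Rightarrow>
    (complex, rat \<Rightarrow> (('v set \<times> 'u) \<Rightarrow>\<^sub>0 complex) set) module" where
  "M_space m U act = direct_sum (frac_nats T) (M_part m U act)"

definition M_homog :: "rat \<Rightarrow> (complex, 'u) module \<Rightarrow> ('v set \<Rightarrow> 'u \<Rightarrow> 'u) \<Rightarrow> rat \<Rightarrow>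
    (rat \<Rightarrow> (('v set \<times> 'u) \<Rightarrow>\<^sub>0 complex) set) set" where
  "M_homog m U act n = direct_sum_inj (frac_nats T) (M_part m U act) n ` carrier (M_part m U act n)"

text \<open>\<open>M_elem m U act n v w\<close> is \<open>(v + O_tilde n m) \<otimes> w\<close> in degree \<open>n\<close>.\<close>

definition M_elem :: "rat \<Rightarrow> (complex, 'u) module \<Rightarrow> ('v set \<Rightarrow> 'u \<Rightarrow> 'u) \<Rightarrow> rat \<Rightarrow> 'v \<Rightarrow> 'u \<Rightarrow>
    rat \<Rightarrow> (('v set \<times> 'u) \<Rightarrow>\<^sub>0 complex) set" where
  "M_elem m U act n v w = direct_sum_inj (frac_nats T) (M_part m U act) n
     (pure_tensor (A_alg m) (A_bimod n m) (A_right_act n m) U act (v +o O_tilde n m) w)"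

text \<open>The prescription for the operators on pure tensors. As pure tensors span, it determines a
  family of linear operators on the carrier of \<open>M_space m U act\<close>.\<close>

definition M_mode_formula :: "rat \<Rightarrow> (complex, 'u) module \<Rightarrow> ('v set \<Rightarrow> 'u \<Rightarrow> 'u) \<Rightarrow>
    ('v \<Rightarrow> rat \<Rightarrow> (rat \<Rightarrow> (('v set \<times> 'u) \<Rightarrow>\<^sub>0 complex) set) \<Rightarrow>
      (rat \<Rightarrow> (('v set \<times> 'u) \<Rightarrow>\<^sub>0 complex) set)) \<Rightarrow> bool" where
  "M_mode_formula m U act modeM \<longleftrightarrow>
     (\<forall>u v. \<forall>w\<in>carrier U. \<forall>n\<in>frac_nats T. \<forall>p\<in>frac_ints T.
        modeM u p (M_elem m U act n v w) =
          (if n - p - 1 \<ge> 0 then M_elem m U act (n - p - 1) (bullet m n (n - p - 1) u v) w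
           else \<zero>\<^bsub>M_space m U act\<^esub>))"

end

section \<open>Twisted \<open>\<phi>\<close>-coordinated modules\<close>

text \<open>\<open>modeW v p\<close> is the coefficient \<open>v\<^sub>p\<close> of \<open>x\<^sup>-\<^sup>p\<^sup>-\<^sup>1\<close> in \<open>Y\<^sub>W(v, x)\<close>; only
  \<open>p \<in> frac_ints T\<close> matters.\<close>

locale twisted_phi_module_data = vertex_algebra_aut scale mode vac g T +
  W: Module.module "ring_of_type_algebra :: complex ring" W
  for scale :: "complex \<Rightarrow> 'v::ab_group_add \<Rightarrow> 'v" (infixr \<open>*s\<close> 75) and mode vac g T
    and W :: "(complex, 'w) module" +
  fixes modeW :: "'v \<Rightarrow> rat \<Rightarrow> 'w \<Rightarrow> 'w"
begin

text \<open>The coefficient of \<open>x\<^sub>1\<^sup>a x\<^sub>2\<^sup>b\<close> in \<open>(x\<^sub>1 - x\<^sub>2)\<^sup>k Y\<^sub>W(u, x\<^sub>1) Y\<^sub>W(v, x\<^sub>2) w\<close>.\<close>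

definition prod_coeff :: "nat \<Rightarrow> 'v \<Rightarrow> 'v \<Rightarrow> 'w \<Rightarrow> rat \<Rightarrow> rat \<Rightarrow> 'w" where
  "prod_coeff k u v w a b =
     (\<Oplus>\<^bsub>W\<^esub>j\<in>{..k}. ((-1) ^ j * of_nat (k choose j)) \<odot>\<^bsub>W\<^esub>
        modeW u (of_nat k - of_nat j - a - 1) (modeW v (of_nat j - b - 1) w))"

text \<open>\<open>(x\<^sub>1 - x\<^sub>2)\<^sup>k Y\<^sub>W(u, x\<^sub>1) Y\<^sub>W(v, x\<^sub>2) w\<close> is a Laurent series in \<open>x\<^sub>1\<^sup>1\<^sup>/\<^sup>T, x\<^sub>2\<^sup>1\<^sup>/\<^sup>T\<close>.\<close>

definition prod_laurent :: "nat \<Rightarrow> 'v \<Rightarrow> 'v \<Rightarrow> 'w \<Rightarrow> bool" where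
  "prod_laurent k u v w \<longleftrightarrow>
     (\<exists>N. \<forall>a\<in>frac_ints T. \<forall>b\<in>frac_ints T. a < N \<or> b < N \<longrightarrow> prod_coeff k u v w a b = \<zero>\<^bsub>W\<^esub>)"

text \<open>
  The coefficients of \<open>x\<^sub>0\<^sup>s x\<^sub>2\<^sup>c\<close> on both sides of the associativity relation. On the left,
  \<open>x\<^sub>2\<^sup>k\<close> shifts the mode; on the right, \<open>x\<^sub>1\<^sup>a x\<^sub>2\<^sup>b\<close> becomes \<open>x\<^sub>2\<^sup>a\<^sup>+\<^sup>b exp(a x\<^sub>0)\<close>, and the sum
  has finite support whenever \<open>prod_laurent k u v w\<close> holds.
\<close>

definition phi_lhs_coeff :: "nat \<Rightarrow> 'v \<Rightarrow> 'v \<Rightarrow> 'w \<Rightarrow> int \<Rightarrow> rat \<Rightarrow> 'w" where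
  "phi_lhs_coeff k u v w s c =
     modeW (Y_subst_coeff (fps_to_fls (fps_exp 1 - 1) ^ k) fls_X u v s) (of_nat k - c - 1) w"

definition phi_rhs_coeff :: "nat \<Rightarrow> 'v \<Rightarrow> 'v \<Rightarrow> 'w \<Rightarrow> int \<Rightarrow> rat \<Rightarrow> 'w" where
  "phi_rhs_coeff k u v w s c =
     (\<Oplus>\<^bsub>W\<^esub>a\<in>{a \<in> frac_ints T. prod_coeff k u v w a (c - a) \<noteq> \<zero>\<^bsub>W\<^esub>}.
        fls_nth (fps_to_fls (fps_exp (of_rat a))) s \<odot>\<^bsub>W\<^esub> prod_coeff k u v w a (c - a))"

end

locale twisted_phi_module = twisted_phi_module_data scale mode vac g T W modeW
  for scale :: "complex \<Rightarrow> 'v::ab_group_add \<Rightarrow> 'v" (infixr \<open>*s\<close> 75) and mode vac g T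
    and W :: "(complex, 'w) module" and modeW +
  assumes modeW_closed: "\<lbrakk>p \<in> frac_ints T; w \<in> carrier W\<rbrakk> \<Longrightarrow> modeW v p w \<in> carrier W"
    and modeW_add_right: "\<lbrakk>p \<in> frac_ints T; w \<in> carrier W; w' \<in> carrier W\<rbrakk>
          \<Longrightarrow> modeW v p (w \<oplus>\<^bsub>W\<^esub> w') = modeW v p w \<oplus>\<^bsub>W\<^esub> modeW v p w'"
    and modeW_smult_right: "\<lbrakk>p \<in> frac_ints T; w \<in> carrier W\<rbrakk>
          \<Longrightarrow> modeW v p (c \<odot>\<^bsub>W\<^esub> w) = c \<odot>\<^bsub>W\<^esub> modeW v p w"
    and modeW_add_left: "\<lbrakk>p \<in> frac_ints T; w \<in> carrier W\<rbrakk>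
          \<Longrightarrow> modeW (v + v') p w = modeW v p w \<oplus>\<^bsub>W\<^esub> modeW v' p w"
    and modeW_smult_left: "\<lbrakk>p \<in> frac_ints T; w \<in> carrier W\<rbrakk>
          \<Longrightarrow> modeW (c *s v) p w = c \<odot>\<^bsub>W\<^esub> modeW v p w"
    and modeW_truncation: "w \<in> carrier W
          \<Longrightarrow> \<exists>N. \<forall>p\<in>frac_ints T. p \<ge> N \<longrightarrow> modeW v p w = \<zero>\<^bsub>W\<^esub>"
    and modeW_vacuum: "\<lbrakk>p \<in> frac_ints T; w \<in> carrier W\<rbrakk>
          \<Longrightarrow> modeW vac p w = (if p = -1 then w else \<zero>\<^bsub>W\<^esub>)"
    and modeW_twisted: "\<lbrakk>r < T; u \<in> eigenspace r; w \<in> carrier W; p \<in> frac_ints T;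
            p - of_nat r / of_nat T \<notin> \<int>\<rbrakk> \<Longrightarrow> modeW u p w = \<zero>\<^bsub>W\<^esub>"
    and modeW_phi: "\<exists>k. \<forall>w\<in>carrier W. prod_laurent k u v w \<and>
          (\<forall>s. \<forall>c\<in>frac_ints T. phi_lhs_coeff k u v w s c = phi_rhs_coeff k u v w s c)"

locale graded_twisted_phi_module = twisted_phi_module scale mode vac g T W modeW
  for scale :: "complex \<Rightarrow> 'v::ab_group_add \<Rightarrow> 'v" (infixr \<open>*s\<close> 75) and mode vac g T
    and W :: "(complex, 'w) module" and modeW +
  fixes Wn :: "rat \<Rightarrow> 'w set"
  assumes Wn_submodule: "n \<in> frac_nats T \<Longrightarrow> submodule (Wn n) (ring_of_type_algebra :: complex ring) W"
    and Wn_direct_sum: "w \<in> carrier W \<Longrightarrow>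
          \<exists>!f. f \<in> (\<Pi>\<^sub>E n\<in>frac_nats T. Wn n) \<and> finite {n \<in> frac_nats T. f n \<noteq> \<zero>\<^bsub>W\<^esub>} \<and>
               w = (\<Oplus>\<^bsub>W\<^esub>n\<in>{n \<in> frac_nats T. f n \<noteq> \<zero>\<^bsub>W\<^esub>}. f n)"
    and modeW_degree: "\<lbrakk>n \<in> frac_nats T; p \<in> frac_ints T; w \<in> Wn n\<rbrakk>
          \<Longrightarrow> modeW v p w \<in> (if n - p - 1 \<ge> 0 then Wn (n - p - 1) else {\<zero>\<^bsub>W\<^esub>})"

end

(* Applying a linear functional that kills O1 turns the whole problem into one about scalar series.
   Let n0, n2 be degrees, u in the eigenspace V^r and y = e^x - 1. Up to an explicit power of 1 + y,
   the relations (D^i u) diamond v = 0 for all i say that y^k Y(u, log(1+y)) v is a polynomial in y,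
   of degree bounded in terms of n0, n2 and k. Re-expanded in powers of 1 + y it is a finite
   combination of exponentials e^(ax); expanded at infinity instead, its quotient by y^k has the
   products u bullet v, one for each intermediate degree, as coefficients. Comparing the two
   expansions (a Vandermonde convolution) gives weak commutativity and associativity together, with
   a k that depends on u and v only. The relations O2 and O3 serve to make the operators well
   defined on the tensor product and to identify compositions of operators with bullet products. *)

theory Submission
  imports Defs
begin

text \<open>A composition of two operators is the operator of a bullet product, and an element of
  \<open>O1 q n\<close> acts as zero from degree \<open>n\<close> to degree \<open>q\<close>. Each
  coefficient of the module axioms, read from one source degree to one target degree, thus becomes
  membership of an element of V in \<open>O1 q n\<close>; the vector acted on has disappeared, which
  is why k can be chosen before it. Membership is tested by functionals because scalar series can be
  composed under y = e^x - 1 and back, and because a subspace is cut out by the functionals that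
  vanish on it.

  The other obstacle is the stability of \<open>O_tilde\<close> under multiplication. Generators of
  \<open>O2\<close> carry a factor only on the left of an associator, and generators of
  \<open>O3\<close> always carry a factor on the right of u . x. The pentagon identity handles the
  missing right factor in \<open>O2\<close>.\<close>

section \<open>Substitution into formal series\<close>

text \<open>Each step splits off one constant term, P = P_0 + y P'. The remainder is a multiple of
  f^I, hence invisible in any fixed coefficient once I is large; this links infinite compositions to
  the finite sums behind \<open>Y_subst_coeff\<close>.\<close>

lemma fps_compose_split:
  fixes P f :: "'a::field fps"
  assumes "fps_nth f 0 = 0"
  shows "P oo f = (\<Sum>i<I. fps_const (fps_nth P i) * f ^ i) + f ^ I * (fps_shift I P oo f)"
proof (induction I)
  case (Suc I)
  have "fps_shift I P = fps_const (fps_nth P I) + fps_X * fps_shift (Suc I) P"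
    by (rule fps_ext) (simp add: fps_X_def[symmetric] nat_less_iff)
  then have "fps_shift I P oo f = fps_const (fps_nth P I) + f * (fps_shift (Suc I) P oo f)"
    using assms by (simp add: fps_compose_add_distrib fps_compose_mult_distrib fps_X_fps_compose_startby0)
  with Suc show ?case by (simp add: algebra_simps)
qed simp

lemma fps_exp_minus_one_oo_ln: "(fps_exp (1::complex) - 1) oo fps_ln 1 = fps_X"
  unfolding fps_ln_fps_exp_inv[OF one_neq_zero] by (rule fps_inv_right) simp_all

lemma fps_ln_oo_exp_minus_one: "fps_ln (1::complex) oo (fps_exp 1 - 1) = fps_X"
  unfolding fps_ln_fps_exp_inv[OF one_neq_zero] by (rule fps_inv) simp_all

text \<open>The equation (1+y)B' = aB of the binomial series turns under y = e^x - 1 into F' = aF,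
  which has e^(ax) as its only solution with constant term 1.\<close>

lemma fps_binomial_oo_exp_minus_one:
  "fps_binomial (a::complex) oo (fps_exp 1 - 1) = fps_exp a"
proof -
  let ?E = "fps_exp (1::complex) - 1" and ?B = "fps_binomial a"
  have "(1 + fps_X :: complex fps) * inverse (1 + fps_X) = 1"
    by (intro inverse_mult_eq_1') simp
  then have "(1 + fps_X) * fps_deriv ?B = fps_const a * ?B"
    by (simp add: fps_binomial_deriv fps_divide_unit mult.assoc mult.left_commute[of "1 + fps_X"])
  then have "((1 + fps_X) * fps_deriv ?B) oo ?E = (fps_const a * ?B) oo ?E"
    by simp
  then have "fps_exp 1 * (fps_deriv ?B oo ?E) = fps_const a * (?B oo ?E)"
    by (simp add: fps_compose_add_distrib fps_compose_mult_distrib fps_X_fps_compose_startby0)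
  moreover have "fps_deriv (?B oo ?E) = (fps_deriv ?B oo ?E) * fps_exp 1"
    by (subst fps_compose_deriv) simp_all
  ultimately have "fps_deriv (?B oo ?E) = fps_const a * (?B oo ?E)"
    by (simp add: mult.commute)
  then show ?thesis
    by (simp add: fps_exp_unique_ODE)
qed

lemma fps_X_times_exp_quotient: "fps_X * fps_shift 1 (fps_exp (1::complex) - 1) = fps_exp 1 - 1"
  by (rule fps_ext) (simp add: fps_X_mult_nth)

lemma power_int_minus_mult_eq:
  fixes A L p s :: "'a::field"
  assumes "A ^ k * p = L ^ k * s" "A \<noteq> 0" "L \<noteq> 0"
  shows "L powi (- int k) * p = A powi (- int k) * s"
  using assms by (simp add: power_int_minus field_simps)

context vertex_algebra
begin

lemma mode_add_left: "mode (u + u') n v = mode u n v + mode u' n v"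
  and mode_scale_left: "mode (c *s u) n v = c *s mode u n v"
proof -
  interpret L: Vector_Spaces.linear scale scale "\<lambda>u. mode u n v" by (rule mode_linear_left)
  show "mode (u + u') n v = mode u n v + mode u' n v" by (rule L.add)
  show "mode (c *s u) n v = c *s mode u n v" by (rule L.scale)
qed

lemma mode_add_right: "mode u n (v + v') = mode u n v + mode u n v'"
  and mode_scale_right: "mode u n (c *s v) = c *s mode u n v"
  and mode_zero_right [simp]: "mode u n 0 = 0"
proof -
  interpret L: Vector_Spaces.linear scale scale "mode u n" by (rule mode_linear_right)
  show "mode u n (v + v') = mode u n v + mode u n v'" by (rule L.add)
  show "mode u n (c *s v) = c *s mode u n v" by (rule L.scale)
  show "mode u n 0 = 0" by (rule L.zero)
qed

text \<open>With no pole of order above \<open>k\<close>, Y(u,x)v is x^(-k) times a power series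
  whose i-th coefficient is the mode of index k-1-i. The second conjunct says that every multiple of
  f^I is invisible at \<open>j\<close>, so the same cutoff discards the remainder in
  \<open>fps_compose_split\<close>.\<close>

lemma Y_subst_coeff_finite:
  assumes k: "\<And>n. n \<ge> int k \<Longrightarrow> mode u n v = 0" and f: "fps_nth f 0 = 0" "f \<noteq> 0"
  shows "\<exists>I0. \<forall>I\<ge>I0. Y_subst_coeff h (fps_to_fls f) u v j =
     (\<Sum>i<I. fls_nth (h * fps_to_fls f powi (- int k) * fps_to_fls (f ^ i)) j *s mode u (int k - 1 - int i) v)
    \<and> (\<forall>p. fls_nth (h * fps_to_fls f powi (- int k) * fps_to_fls (f ^ I * p)) j = 0)"
proof -
  let ?f = "fps_to_fls f"
  define h' where "h' = h * ?f powi (- int k)"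
  have f0: "?f \<noteq> 0" using f by simp
  have sub: "fls_subdegree (fps_to_fls (f ^ i * p)) \<ge> int i" if "f ^ i * p \<noteq> 0" for i p
  proof -
    have "subdegree f \<ge> 1" using f by (metis less_one linorder_not_le nth_subdegree_nonzero)
    then have "subdegree (f ^ i) \<ge> i"
      using mult_le_mono2[of 1 "subdegree f" i] by (simp add: subdegree_power)
    moreover have "subdegree (f ^ i * p) = subdegree (f ^ i) + subdegree p"
      using that by (intro subdegree_mult) auto
    ultimately have "subdegree (f ^ i * p) \<ge> i" by linarith
    then show ?thesis by (simp add: fls_subdegree_fls_to_fps)
  qed
  have vanish: "fls_nth (h' * fps_to_fls (f ^ i * p)) j = 0" if "int i > j - fls_subdegree h'" for i p
  proof (cases "f ^ i * p = 0")
    case False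
    from sub[OF False] that show ?thesis by (intro fls_times_nth_eq0) linarith
  next
    case True
    show ?thesis unfolding True by simp
  qed
  \<comment> \<open>As f has positive order, h' f^i p has order at least i plus the order of h'; the
    cutoff is where this exceeds j.\<close>
  have "Y_subst_coeff h ?f u v j = (\<Sum>i<I. fls_nth (h' * fps_to_fls (f ^ i)) j *s mode u (int k - 1 - int i) v)
      \<and> (\<forall>p. fls_nth (h' * fps_to_fls (f ^ I * p)) j = 0)" if I: "I \<ge> nat (j - fls_subdegree h' + 1)" for I
  proof
    have pw: "h * ?f powi (- n - 1) = h' * fps_to_fls (f ^ nat (int k - 1 - n))" if "n \<le> int k - 1" for n
    proof -
      have exponent: "- n - 1 = - int k + int (nat (int k - 1 - n))" using that by simp
      have "?f powi (- n - 1) = ?f powi (- int k) * ?f powi (int (nat (int k - 1 - n)))"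
        by (simp only: exponent power_int_add[OF disjI1[OF f0]])
      then show ?thesis by (simp only: h'_def fps_to_fls_power power_int_of_nat mult.assoc)
    qed
    have "Y_subst_coeff h ?f u v j = (\<Sum>n\<in>(\<lambda>i. int k - 1 - int i) ` {..<I}. fls_nth (h * ?f powi (- n - 1)) j *s mode u n v)"
      unfolding Y_subst_coeff_def
    proof (rule Sum_any.expand_superset)
      show "{n. fls_nth (h * ?f powi (- n - 1)) j *s mode u n v \<noteq> 0} \<subseteq> (\<lambda>i. int k - 1 - int i) ` {..<I}"
      proof
        fix n assume "n \<in> {n. fls_nth (h * ?f powi (- n - 1)) j *s mode u n v \<noteq> 0}"
        then have nz: "mode u n v \<noteq> 0" "fls_nth (h * ?f powi (- n - 1)) j \<noteq> 0" by auto
        then have n: "n \<le> int k - 1" using k[of n] by force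
        have "\<not> nat (int k - 1 - n) \<ge> I"
        proof
          assume "nat (int k - 1 - n) \<ge> I"
          with I have "int (nat (int k - 1 - n)) > j - fls_subdegree h'" by linarith
          from vanish[OF this, of 1] nz(2) pw[OF n] show False by simp
        qed
        then show "n \<in> (\<lambda>i. int k - 1 - int i) ` {..<I}"
          using n by (intro image_eqI[of _ _ "nat (int k - 1 - n)"]) auto
      qed
    qed simp
    also have "\<dots> = (\<Sum>i<I. fls_nth (h' * fps_to_fls (f ^ i)) j *s mode u (int k - 1 - int i) v)"
    proof (subst sum.reindex)
      show "inj_on (\<lambda>i. int k - 1 - int i) {..<I}" by (auto intro: inj_onI)
      have "h * ?f powi (- (int k - 1 - int i) - 1) = h' * fps_to_fls (f ^ i)" for i
      proof -
        have "int k - 1 - int i \<le> int k - 1" "nat (int k - 1 - (int k - 1 - int i)) = i"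
          by simp_all
        then show ?thesis using pw[of "int k - 1 - int i"] by (simp only:)
      qed
      then show "(sum ((\<lambda>n. fls_nth (h * ?f powi (- n - 1)) j *s mode u n v) \<circ> (\<lambda>i. int k - 1 - int i)) {..<I}) =
          (\<Sum>i<I. fls_nth (h' * fps_to_fls (f ^ i)) j *s mode u (int k - 1 - int i) v)"
        by (simp only: o_def)
    qed
    finally show "Y_subst_coeff h ?f u v j = \<dots>" .
    show "\<forall>p. fls_nth (h' * fps_to_fls (f ^ I * p)) j = 0"
      using I by (intro allI vanish) linarith
  qed
  note main = this
  show ?thesis
    unfolding h'_def[symmetric] by (intro exI[of _ "nat (j - fls_subdegree h' + 1)"] allI impI main)
qed

text \<open>A functional passes through the finite sum, and \<open>fps_compose_split\<close>
  reassembles the resulting scalars into a genuine composition of series. This is the passage from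
  V-valued to scalar series.\<close>

lemma functional_Y_subst_coeff:
  assumes \<phi>: "Vector_Spaces.linear scale (*) \<phi>"
    and k: "\<And>n. n \<ge> int k \<Longrightarrow> mode u n v = 0" and f: "fps_nth f 0 = 0" "f \<noteq> 0"
  shows "\<phi> (Y_subst_coeff h (fps_to_fls f) u v j) =
     fls_nth (h * fps_to_fls f powi (- int k) *
       fps_to_fls (Abs_fps (\<lambda>i. \<phi> (mode u (int k - 1 - int i) v)) oo f)) j"
proof -
  interpret \<phi>: Vector_Spaces.linear scale "(*)" \<phi> by (rule \<phi>)
  define P where "P = Abs_fps (\<lambda>i. \<phi> (mode u (int k - 1 - int i) v))"
  define h' where "h' = h * fps_to_fls f powi (- int k)"
  obtain I where Y: "Y_subst_coeff h (fps_to_fls f) u v j =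
       (\<Sum>i<I. fls_nth (h' * fps_to_fls (f ^ i)) j *s mode u (int k - 1 - int i) v)"
    and 0: "\<And>p. fls_nth (h' * fps_to_fls (f ^ I * p)) j = 0"
  proof -
    obtain I0 where "\<forall>I\<ge>I0. Y_subst_coeff h (fps_to_fls f) u v j =
       (\<Sum>i<I. fls_nth (h' * fps_to_fls (f ^ i)) j *s mode u (int k - 1 - int i) v) \<and>
       (\<forall>p. fls_nth (h' * fps_to_fls (f ^ I * p)) j = 0)"
      using Y_subst_coeff_finite[OF k f, where h = h and j = j] unfolding h'_def by (rule exE)
    from spec[OF this, of I0] show ?thesis by (intro that[of I0]) simp_all
  qed
  have "fls_nth (h' * fps_to_fls (P oo f)) j =
      fls_nth (h' * fps_to_fls (\<Sum>i<I. fps_const (fps_nth P i) * f ^ i)) j"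
    by (subst fps_compose_split[OF f(1), of _ I]) (simp add: ring_distribs 0)
  also have "h' * fps_to_fls (\<Sum>i<I. fps_const (fps_nth P i) * f ^ i) =
      (\<Sum>i<I. fls_const (fps_nth P i) * (h' * fps_to_fls (f ^ i)))"
    by (induction I) (simp_all add: ring_distribs fls_times_fps_to_fls mult_ac fps_to_fls_power)
  also have "fls_nth \<dots> j = (\<Sum>i<I. fps_nth P i * fls_nth (h' * fps_to_fls (f ^ i)) j)"
    by (simp add: fls_nth_sum)
  also have "\<dots> = \<phi> (Y_subst_coeff h (fps_to_fls f) u v j)"
    by (simp add: Y \<phi>.sum \<phi>.scale P_def mult.commute)
  finally show ?thesis by (simp add: P_def h'_def)
qed

text \<open>The image of \<open>(e\<^sup>x - 1)\<^sup>k Y(u, x) v\<close> under \<open>\<phi>\<close>, for \<open>k\<close> so large that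
  \<open>x\<^sup>k Y(u, x) v\<close> has no pole.\<close>

definition exp_series :: "('v \<Rightarrow> complex) \<Rightarrow> nat \<Rightarrow> 'v \<Rightarrow> 'v \<Rightarrow> complex fps" where
  "exp_series \<phi> k u v =
     fps_shift 1 (fps_exp 1 - 1) ^ k * Abs_fps (\<lambda>i. \<phi> (mode u (int k - 1 - int i) v))"

text \<open>The pole x^(-k) cancels against (e^x - 1)^k = x^k E^k, where E = (e^x - 1)/x is a power
  series. The left-hand side of the associativity axiom is thereby expressed through
  \<open>exp_series\<close>.\<close>

lemma functional_phi_coeff:
  assumes \<phi>: "Vector_Spaces.linear scale (*) \<phi>" and k: "\<And>n. n \<ge> int k \<Longrightarrow> mode u n v = 0"
  shows "\<phi> (Y_subst_coeff (fps_to_fls (fps_exp 1 - 1) ^ k) fls_X u v s) =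
     fls_nth (fps_to_fls (exp_series \<phi> k u v)) s"
proof -
  let ?E = "fps_shift 1 (fps_exp (1::complex) - 1)"
  let ?P = "Abs_fps (\<lambda>i. \<phi> (mode u (int k - 1 - int i) v))"
  have "\<phi> (Y_subst_coeff (fps_to_fls (fps_exp 1 - 1) ^ k) fls_X u v s) =
     fls_nth (fps_to_fls (fps_exp 1 - 1) ^ k * fps_to_fls fps_X powi (- int k) * fps_to_fls ?P) s"
    using functional_Y_subst_coeff[OF \<phi> k, where f = fps_X] by simp
  also have "fps_to_fls (fps_exp (1::complex) - 1) ^ k * fps_to_fls fps_X powi (- int k) * fps_to_fls ?P =
      fps_to_fls (exp_series \<phi> k u v)"
  proof -
    have "fps_to_fls (fps_exp (1::complex) - 1) = fps_to_fls fps_X * fps_to_fls ?E"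
      unfolding fls_times_fps_to_fls[symmetric] fps_X_times_exp_quotient ..
    moreover
    have "fps_to_fls fps_X ^ k * fps_to_fls (fps_X :: complex fps) powi (- int k) = 1"
      by (subst power_int_minus, subst power_int_of_nat, rule right_inverse) simp
    moreover have "(A * B) ^ k * C * Q = (A ^ k * C) * (B ^ k * Q)" for A B C Q :: "complex fls"
      by (simp add: power_mult_distrib mult_ac)
    ultimately show ?thesis
      by (simp only: exp_series_def fls_times_fps_to_fls fps_to_fls_power mult_1)
  qed
  finally show ?thesis .
qed

text \<open>The series of \<open>functional_phi_coeff\<close> reappears: with x = log(1+y) the
  factor (e^x - 1)^k is y^k, so y^k Y(u,log(1+y))v becomes \<open>exp_series\<close> composed with
  the logarithm. The index b + k - 1 comes from taking the residue against y^(-b-k).\<close>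

lemma functional_res_Y:
  assumes \<phi>: "Vector_Spaces.linear scale (*) \<phi>" and k: "\<And>n. n \<ge> int k \<Longrightarrow> mode u n v = 0"
  shows "\<phi> (res_Y a b u v) =
     fls_nth (fps_to_fls (fps_binomial a * (exp_series \<phi> k u v oo fps_ln 1))) (b + int k - 1)"
proof -
  let ?E = "fps_shift 1 (fps_exp (1::complex) - 1)" and ?l = "fps_ln (1::complex)"
  let ?P = "Abs_fps (\<lambda>i. \<phi> (mode u (int k - 1 - int i) v))"
  let ?S = "exp_series \<phi> k u v oo ?l"
  have l: "?l \<noteq> 0" by (auto simp: fps_eq_iff fps_ln_nth intro!: exI[of _ 1])
  have X0: "fls_X \<noteq> (0 :: complex fls)" by simp
  have "?l * (?E oo ?l) = (fps_X * ?E) oo ?l"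
    by (simp add: fps_compose_mult_distrib fps_X_fps_compose_startby0)
  also have "\<dots> = fps_X"
    by (simp only: fps_X_times_exp_quotient fps_exp_minus_one_oo_ln)
  finally have lE: "?l * (?E oo ?l) = fps_X" .
  have "fps_X ^ k = (?l * (?E oo ?l)) ^ k" by (simp only: lE)
  also have "\<dots> = ?l ^ k * (?E ^ k oo ?l)"
    by (simp add: power_mult_distrib fps_compose_power)
  finally have "fps_X ^ k = ?l ^ k * (?E ^ k oo ?l)" .
  then have "fps_X ^ k * (?P oo ?l) = ?l ^ k * ?S"
    by (simp add: exp_series_def fps_compose_mult_distrib mult.assoc)
  then have "fps_to_fls (fps_X ^ k * (?P oo ?l)) = fps_to_fls (?l ^ k * ?S)"
    by (simp only:)
  then have "fls_X ^ k * fps_to_fls (?P oo ?l) = fps_to_fls ?l ^ k * fps_to_fls ?S"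
    by (simp only: fls_times_fps_to_fls fps_to_fls_power fps_X_to_fls)
  then have *: "fps_to_fls ?l powi (- int k) * fps_to_fls (?P oo ?l) = fls_X powi (- int k) * fps_to_fls ?S"
    using l X0 by (intro power_int_minus_mult_eq) auto
  have "\<phi> (res_Y a b u v) = fls_nth (fps_to_fls (fps_binomial a) * fls_X powi (- b) *
      (fps_to_fls ?l powi (- int k) * fps_to_fls (?P oo ?l))) (- 1)"
    unfolding res_Y_def by (subst functional_Y_subst_coeff[OF \<phi> k]) (simp_all add: l mult.assoc)
  also have "\<dots> = fls_nth (fls_X powi (- b + - int k) * fps_to_fls (fps_binomial a * ?S)) (- 1)"
  proof -
    have "B * A * (C * S) = A * C * (B * S)" for A B C S :: "complex fls"
      by (simp add: mult_ac)
    then show ?thesis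
      unfolding * power_int_add[OF disjI1[OF X0]] fls_times_fps_to_fls by (rule arg_cong)
  qed
  also have "\<dots> = fls_nth (fps_to_fls (fps_binomial a * ?S)) (- 1 + - (- b + - int k))"
    by (simp only: fls_X_power_int fls_X_intpow_times_conv_shift(1) fls_shift_nth)
  also have "- 1 + - (- b + - int k) = b + int k - 1" by simp
  finally show ?thesis .
qed

end

section \<open>Modes of D u and a recursion for residues\<close>

lemma fls_deriv_power_int:
  fixes F :: "complex fls"
  assumes "F \<noteq> 0"
  shows "fls_deriv (F powi n) = of_int n * F powi (n - 1) * fls_deriv F"
proof (cases "n \<ge> 0")
  case True
  then obtain m where n: "n = int m" using nonneg_int_cases by blast
  show ?thesis
  proof (cases m)
    case (Suc m')
    with n have "n - 1 = int m'" by simp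
    with n Suc show ?thesis
      by (simp only: power_int_of_nat fls_deriv_power) simp
  qed (simp add: n)
next
  case False
  then obtain m where n: "n = - int m" by (metis int_cases4 linorder_not_le nless_le of_nat_0_le_iff)
  with False obtain m' where m: "m = Suc m'" using not0_implies_Suc by auto
  have "F powi n * F ^ m = 1" using assms by (simp add: n power_int_minus)
  then have "fls_deriv (F powi n * F ^ m) = 0" by simp
  moreover have "fls_deriv (F ^ m) = of_nat m * F ^ m' * fls_deriv F"
    unfolding m by (simp only: fls_deriv_power) simp
  ultimately have "fls_deriv (F powi n) * F ^ m = - (F powi n * (of_nat m * F ^ m' * fls_deriv F))"
    by (simp only: fls_deriv_mult) (simp add: eq_neg_iff_add_eq_0 add.commute)
  then have "fls_deriv (F powi n) = - (F powi n * (of_nat m * F ^ m' * fls_deriv F)) / F ^ m"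
    using assms by (simp add: field_simps)
  also have "\<dots> = - of_nat m * (F powi n * F ^ m' / F ^ m) * fls_deriv F"
    by simp
  also have "F powi n * F ^ m' / F ^ m = F powi (n - 1)"
    using assms by (simp add: m power_int_diff)
  also have "- of_nat m * F powi (n - 1) * fls_deriv F = of_int n * F powi (n - 1) * fls_deriv F"
    by (simp add: n)
  finally show ?thesis .
qed

context vertex_algebra
begin

text \<open>The Jacobi identity for (u_(-2) vac)_n: with first exponent 0 the left side has one
  term, and on the right \<open>vac\<close> leaves only the summand in which its mode index is -1.
  For n < 0 this summand sits in the first product, for n > 0 in the second, and for n = 0 there is
  none.\<close>

lemma mode_D: "mode (D u) n w = - of_int n *s mode u (n - 1) w"
proof -
  have L: "(\<lambda>i. (of_int 0 gchoose i) *s mode (mode u (- 2 + int i) vac) (0 + n - int i) w) =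
      (\<lambda>i. mode (D u) n w when i = 0)"
  proof
    show "(of_int 0 gchoose i) *s mode (mode u (- 2 + int i) vac) (0 + n - int i) w =
        (mode (D u) n w when i = 0)" for i
      by (cases i) (simp_all add: D_def)
  qed
  have R: "(\<lambda>i. ((-1) ^ i * (of_int (- 2) gchoose i)) *s
         (mode u (0 + - 2 - int i) (mode vac (n + int i) w)
          - ((-1) powi (- 2)) *s mode vac (- 2 + n - int i) (mode u (0 + int i) w))) =
      (\<lambda>i. (- of_int n *s mode u (n - 1) w) when (i = (if n < 0 then nat (- 1 - n) else nat (n - 1)) \<and> n \<noteq> 0))"
  proof
    fix i :: nat
    \<comment> \<open>The coefficients of 1/(1-x)^2.\<close>
    have g: "(-1) ^ i * (- 2 gchoose i) = (of_nat i + 1 :: complex)"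
    proof -
      have "(- 2 gchoose i) = (-1) ^ i * ((1 + of_nat i) gchoose i :: complex)"
        using gbinomial_negated_upper[of "-2::complex" i] by (simp add: algebra_simps)
      also have "((1 + of_nat i) gchoose i :: complex) = of_nat (Suc i choose i)"
        unfolding binomial_gbinomial by simp
      finally show ?thesis by (simp flip: power_add add: mult_2[symmetric])
    qed
    show "((-1) ^ i * (of_int (- 2) gchoose i)) *s
         (mode u (0 + - 2 - int i) (mode vac (n + int i) w)
          - ((-1) powi (- 2)) *s mode vac (- 2 + n - int i) (mode u (0 + int i) w)) =
       (- of_int n *s mode u (n - 1) w when (i = (if n < 0 then nat (- 1 - n) else nat (n - 1)) \<and> n \<noteq> 0))"
      using g by (cases "n < 0"; cases "n = 0") (auto simp: when_def vacuum power_int_def scale_right_diff_distrib)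
  qed
  show ?thesis
    using jacobi[of 0 u "- 2" vac n w] unfolding L R by (cases "n = 0") (simp_all)
qed

text \<open>The coefficient form of Y(u,x) vac = e^(xD) u; each use of \<open>mode_D\<close> lowers
  the index by one and contributes one factor of the factorial.\<close>

lemma mode_neg_vac: "mode u (- 1 - int i) vac = (1 / fact i) *s (D ^^ i) u"
proof (induction i arbitrary: u)
  case 0
  show ?case using creation(2) by simp
next
  case (Suc i)
  have "mode (D u) (- 1 - int i) vac = of_nat (Suc i) *s mode u (- 1 - int (Suc i)) vac"
    by (simp add: mode_D algebra_simps)
  then have "mode u (- 1 - int (Suc i)) vac = (1 / of_nat (Suc i)) *s mode (D u) (- 1 - int i) vac"
    by (simp del: of_nat_Suc)
  then show ?case by (simp add: Suc funpow_swap1 del: of_nat_Suc)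
qed

lemma fps_ln_nonzero [simp]: "fps_ln (1::complex) \<noteq> 0"
  by (auto simp: fps_eq_iff fps_ln_nth intro!: exI[of _ 1])

lemma res_Y_finite:
  assumes k: "\<And>n. n \<ge> int k \<Longrightarrow> mode u n v = 0"
  shows "\<exists>I0. \<forall>I\<ge>I0. res_Y a b u v =
     (\<Sum>i<I. fls_nth (fps_to_fls (fps_binomial a) * fls_X powi (- b) *
        fps_to_fls (fps_ln 1) powi (- int k) * fps_to_fls (fps_ln 1 ^ i)) (- 1) *s
        mode u (int k - 1 - int i) v)"
proof -
  obtain I0 where *: "\<forall>I\<ge>I0. res_Y a b u v =
     (\<Sum>i<I. fls_nth (fps_to_fls (fps_binomial a) * fls_X powi (- b) *
        fps_to_fls (fps_ln 1) powi (- int k) * fps_to_fls (fps_ln 1 ^ i)) (- 1) *s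
        mode u (int k - 1 - int i) v) \<and>
     (\<forall>p. fls_nth (fps_to_fls (fps_binomial a) * fls_X powi (- b) *
        fps_to_fls (fps_ln 1) powi (- int k) * fps_to_fls (fps_ln 1 ^ I * p)) (- 1) = 0)"
    unfolding res_Y_def by (rule exE[OF Y_subst_coeff_finite[OF k fps_ln_0 fps_ln_nonzero]])
  show ?thesis
    by (intro exI[of _ I0] allI impI) (rule conjunct1[OF mp[OF spec[OF *]]])
qed

text \<open>Residues of derivatives vanish. Differentiate (1+y)^(a+1) y^(-b) Y(u,log(1+y))v, using
  that the derivative of Y(u,log(1+y)) is (1+y)^(-1) Y(Du,log(1+y)), and split (1+y)^(a+1) y^(-b-1)
  as (1+y)^a times y^(-b-1) + y^(-b).\<close>

lemma res_Y_D:
  "of_int b *s res_Y a (b + 1) u v = res_Y a b (D u) v + (a + 1 - of_int b) *s res_Y a b u v"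
proof -
  let ?l = "fps_ln (1::complex)"
  obtain N where N: "\<And>n. n \<ge> N \<Longrightarrow> mode u n v = 0" using truncation by blast
  define k where "k = nat N"
  have k: "mode u n v = 0" if "n \<ge> int k" for n
  proof -
    from that have "n \<ge> N" unfolding k_def by linarith
    then show ?thesis by (rule N)
  qed
  \<comment> \<open>Y(Du,x)v is the derivative of Y(u,x)v, so its pole may be one order
    higher.\<close>
  have kD: "mode (D u) n v = 0" if "n \<ge> int (Suc k)" for n using k that by (simp add: mode_D)
  let ?B = "fps_to_fls (fps_binomial a)" and ?L = "fps_to_fls ?l"
  obtain I1 where I1: "\<forall>I\<ge>I1. res_Y a (b + 1) u v =
      (\<Sum>i<I. fls_nth (?B * fls_X powi (- (b + 1)) * ?L powi (- int k) * fps_to_fls (?l ^ i)) (- 1) *s mode u (int k - 1 - int i) v)"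
    by (rule exE[OF res_Y_finite[OF k, where a = a and b = "b + 1"]])
  obtain I2 where I2: "\<forall>I\<ge>I2. res_Y a b u v =
      (\<Sum>i<I. fls_nth (?B * fls_X powi (- b) * ?L powi (- int k) * fps_to_fls (?l ^ i)) (- 1) *s mode u (int k - 1 - int i) v)"
    by (rule exE[OF res_Y_finite[OF k, where a = a and b = "b"]])
  obtain I3 where I3: "\<forall>I\<ge>I3. res_Y a b (D u) v =
      (\<Sum>i<I. fls_nth (?B * fls_X powi (- b) * ?L powi (- int (Suc k)) * fps_to_fls (?l ^ i)) (- 1) *s mode (D u) (int (Suc k) - 1 - int i) v)"
    by (rule exE[OF res_Y_finite[OF kD, where a = a and b = "b"]])
  define I where "I = max I1 (max I2 I3)"
  \<comment> \<open>The identity is checked for each power L^q of log(1+y) separately, q = i - k;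
    the factor q from differentiating L^q is the one that \<open>mode_D\<close> produces at the
    matching mode of \<open>D u\<close>.\<close>
  have key: "of_int b * fls_nth (?B * fls_X powi (- (b + 1)) * ?L powi (- int k) * fps_to_fls (?l ^ i)) (- 1) =
      (of_nat i - of_nat k) * fls_nth (?B * fls_X powi (- b) * ?L powi (- int (Suc k)) * fps_to_fls (?l ^ i)) (- 1)
      + (a + 1 - of_int b) * fls_nth (?B * fls_X powi (- b) * ?L powi (- int k) * fps_to_fls (?l ^ i)) (- 1)" for i
  proof -
    define q where "q = int i - int k"
    let ?F = "?L powi q" and ?X = "fls_X :: complex fls"
    have L0: "?L \<noteq> 0" by simp
    have X0: "?X \<noteq> 0" by simp
    have F: "?L powi (- int k) * fps_to_fls (?l ^ i) = ?F"
      unfolding q_def using L0 power_int_add[of ?L "- int k" "int i"] by (simp add: fps_to_fls_power)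
    have F1: "?L powi (- int (Suc k)) * fps_to_fls (?l ^ i) = ?L powi (q - 1)"
      unfolding q_def using L0 power_int_add[of ?L "- int (Suc k)" "int i"]
      by (simp add: fps_to_fls_power algebra_simps)
    have inv: "(1 + fps_X :: complex fps) * inverse (1 + fps_X) = 1"
      by (intro inverse_mult_eq_1') simp
    have dL: "(1 + ?X) * fls_deriv ?L = 1"
    proof -
      have "(1 + ?X) * fls_deriv ?L = fps_to_fls ((1 + fps_X) * fps_deriv ?l)"
        by (simp add: fls_times_fps_to_fls fls_deriv_fps_to_fls del: fps_X_to_fls) (simp add: fps_ln_deriv)
      also have "(1 + fps_X) * fps_deriv ?l = 1"
        using inv by (simp add: fps_ln_deriv)
      finally show ?thesis by simp
    qed
    have dB: "(1 + ?X) * fls_deriv ?B = fls_const a * ?B"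
    proof -
      have "(1 + ?X) * fls_deriv ?B = fps_to_fls ((1 + fps_X) * fps_deriv (fps_binomial a))"
        by (simp add: fls_times_fps_to_fls fls_deriv_fps_to_fls)
      also have "(1 + fps_X) * fps_deriv (fps_binomial a) = fps_const a * fps_binomial a"
        using inv by (simp add: fps_binomial_deriv fps_divide_unit mult.assoc mult.left_commute[of "1 + fps_X"])
      finally show ?thesis by (simp add: fls_times_fps_to_fls)
    qed
    let ?Y = "?X powi (- b)"
    have Y1: "?X powi (- (b + 1)) * ?X = ?Y"
      using X0 power_int_add_1[of ?X "- (b + 1)"] by (simp del: fls_X_power_int)
    have dY: "fls_deriv ?Y = - of_int b * ?X powi (- (b + 1))"
    proof -
      have "- b - 1 = - (b + 1)" by simp
      then show ?thesis
        using fls_deriv_power_int[OF X0, of "- b"] by (simp only: of_int_minus fls_deriv_X mult_1_right)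
    qed
    have dF: "fls_deriv ?F = of_int q * ?L powi (q - 1) * fls_deriv ?L"
      by (rule fls_deriv_power_int[OF L0])
    have "fls_deriv ((1 + ?X) * ?B * ?Y * ?F) =
       ?B * ?Y * ?F + ((1 + ?X) * fls_deriv ?B) * ?Y * ?F
       + (1 + ?X) * ?B * fls_deriv ?Y * ?F + (1 + ?X) * ?B * ?Y * fls_deriv ?F"
      by (simp only: fls_deriv_mult fls_deriv_add fls_deriv_one fls_deriv_X add_0_left mult_1_left) (simp only: algebra_simps mult_1_left)
    also have "\<dots> = ?B * ?Y * ?F + fls_const a * (?B * ?Y * ?F)
       - of_int b * (?B * ?X powi (- (b + 1)) * ?F + ?B * (?X powi (- (b + 1)) * ?X) * ?F)
       + of_int q * (?B * ?Y * ?L powi (q - 1)) * ((1 + ?X) * fls_deriv ?L)"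
    proof -
      have "x1 * x2 * x3 + x4 * x1 * x2 * x3 + (1 + x5) * x1 * (- x6 * x7) * x3 + (1 + x5) * x1 * x2 * (x8 * x9 * x0) =
         x1 * x2 * x3 + x4 * (x1 * x2 * x3) - x6 * (x1 * x7 * x3 + x1 * (x7 * x5) * x3) + x8 * (x1 * x2 * x9) * ((1 + x5) * x0)"
        for x1 x2 x3 x4 x5 x6 x7 x8 x9 x0 :: "complex fls"
        by (simp add: algebra_simps)
      then show ?thesis unfolding dB dY dF .
    qed
    finally have d: "fls_deriv ((1 + ?X) * ?B * ?Y * ?F) = fls_const (1 + a - of_int b) * (?B * ?Y * ?F)
       - fls_const (of_int b) * (?B * ?X powi (- (b + 1)) * ?F)
       + fls_const (of_int q) * (?B * ?Y * ?L powi (q - 1))"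
      unfolding Y1 dL by (simp add: algebra_simps fls_of_int flip: fls_plus_const fls_minus_const del: fls_X_power_int)
    have "0 = fls_nth (fls_deriv ((1 + ?X) * ?B * ?Y * ?F)) (- 1)" by (simp only: fls_deriv_residue)
    also have "\<dots> = (1 + a - of_int b) * fls_nth (?B * ?Y * ?F) (- 1)
       - of_int b * fls_nth (?B * ?X powi (- (b + 1)) * ?F) (- 1)
       + of_int q * fls_nth (?B * ?Y * ?L powi (q - 1)) (- 1)"
      unfolding d by (simp del: fls_X_power_int fls_deriv_nth)
    finally show ?thesis
      unfolding mult.assoc[of _ "?L powi _"] F F1 by (simp add: q_def algebra_simps del: fls_X_power_int)
  qed
  have D: "mode (D u) (int (Suc k) - 1 - int i) v = (of_nat i - of_nat k) *s mode u (int k - 1 - int i) v" for i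
  proof -
    have "int (Suc k) - 1 - int i - 1 = int k - 1 - int i"
      "- of_int (int (Suc k) - 1 - int i) = (of_nat i - of_nat k :: complex)" by simp_all
    then show ?thesis unfolding mode_D by (simp only:)
  qed
  have "of_int b *s res_Y a (b + 1) u v = (\<Sum>i<I. (of_int b * fls_nth (?B * fls_X powi (- (b + 1)) * ?L powi (- int k) * fps_to_fls (?l ^ i)) (- 1)) *s mode u (int k - 1 - int i) v)"
    using I1[rule_format, of I] by (simp only: I_def max.cobounded1 scale_sum_right scale_scale)
  also have "\<dots> =
      (\<Sum>i<I. ((of_nat i - of_nat k) * fls_nth (?B * fls_X powi (- b) * ?L powi (- int (Suc k)) * fps_to_fls (?l ^ i)) (- 1)) *s mode u (int k - 1 - int i) v)
      + (\<Sum>i<I. ((a + 1 - of_int b) * fls_nth (?B * fls_X powi (- b) * ?L powi (- int k) * fps_to_fls (?l ^ i)) (- 1)) *s mode u (int k - 1 - int i) v)"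
    unfolding key scale_left_distrib sum.distrib ..
  also have "(\<Sum>i<I. ((of_nat i - of_nat k) * fls_nth (?B * fls_X powi (- b) * ?L powi (- int (Suc k)) * fps_to_fls (?l ^ i)) (- 1)) *s mode u (int k - 1 - int i) v)
      = res_Y a b (D u) v"
    using I3[rule_format, of I] unfolding D scale_scale by (simp only: I_def max.cobounded2 max.coboundedI2 mult.commute)
  also have "(\<Sum>i<I. ((a + 1 - of_int b) * fls_nth (?B * fls_X powi (- b) * ?L powi (- int k) * fps_to_fls (?l ^ i)) (- 1)) *s mode u (int k - 1 - int i) v)
      = (a + 1 - of_int b) *s res_Y a b u v"
    using I2[rule_format, of I] by (simp only: I_def max.cobounded1 max.coboundedI2 scale_sum_right scale_scale)
  finally show ?thesis .
qed

end

section \<open>Detecting subspaces by functionals; bilinearity of residues\<close>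

context vertex_algebra
begin

text \<open>If x were outside N, a basis of N together with x would be independent, and extending
  the function with value 1 at x and 0 on the basis would give a functional that contradicts the
  hypothesis.\<close>

lemma mem_subspaceI:
  assumes N: "subspace N"
    and \<phi>: "\<And>\<phi>. Vector_Spaces.linear scale (*) \<phi> \<Longrightarrow> (\<And>y. y \<in> N \<Longrightarrow> \<phi> y = 0) \<Longrightarrow> \<phi> x = 0"
  shows "x \<in> N"
proof (rule ccontr)
  assume x: "x \<notin> N"
  interpret C: vector_space "(*) :: complex \<Rightarrow> complex \<Rightarrow> complex"
    by standard (simp_all add: algebra_simps)
  interpret VC: vector_space_pair scale "(*) :: complex \<Rightarrow> complex \<Rightarrow> complex" ..
  obtain B where B: "B \<subseteq> N" "independent B" "N \<subseteq> span B"
    using maximal_independent_subset by blast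
  have sB: "span B = N"
    using B N by (meson span_minimal subset_antisym)
  then have "independent (insert x B)"
    using B x by (simp add: independent_insert)
  from VC.linear_independent_extend[OF this, of "\<lambda>y. if y = x then 1 else 0"]
  obtain \<psi> where lin: "Vector_Spaces.linear scale (*) \<psi>"
    and \<psi>: "\<And>y. y \<in> insert x B \<Longrightarrow> \<psi> y = (if y = x then 1 else 0)" by blast
  have "\<psi> y = 0" if "y \<in> N" for y
  proof (rule VC.linear_eq_0_on_span[OF lin])
    show "\<psi> b = 0" if "b \<in> B" for b using \<psi>[of b] that B x by auto
  qed (use that sB in simp)
  with \<phi>[OF lin] have "\<psi> x = 0" by blast
  then show False using \<psi>[of x] by simp
qed

lemma functional_eqI:
  assumes "\<And>\<phi>. Vector_Spaces.linear scale (*) \<phi> \<Longrightarrow> \<phi> x = \<phi> y"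
  shows "x = y"
proof -
  have "x - y \<in> {0}"
  proof (rule mem_subspaceI)
    fix \<phi> assume \<phi>: "Vector_Spaces.linear scale (*) \<phi>"
    then interpret \<phi>: Vector_Spaces.linear scale "(*)" \<phi> .
    show "\<phi> (x - y) = 0" using assms[OF \<phi>] by (simp add: \<phi>.diff)
  qed simp
  then show ?thesis by simp
qed

lemma mode_bound:
  obtains k :: nat where "\<And>n. n \<ge> int k \<Longrightarrow> mode u n v = 0"
proof -
  obtain N where N: "\<And>n. n \<ge> N \<Longrightarrow> mode u n v = 0" using truncation by blast
  show thesis
  proof (rule that[of "nat N"])
    fix n assume "n \<ge> int (nat N)"
    then have "n \<ge> N" by linarith
    then show "mode u n v = 0" by (rule N)
  qed
qed

lemma mode_bound_finite:
  assumes "finite S"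
  obtains k :: nat where "\<And>u v n. (u, v) \<in> S \<Longrightarrow> n \<ge> int k \<Longrightarrow> mode u n v = 0"
proof -
  have "\<exists>k::nat. \<forall>u v n. (u, v) \<in> S \<longrightarrow> n \<ge> int k \<longrightarrow> mode u n v = 0"
    using assms
  proof (induction S)
    case (insert p S)
    obtain u v where p: "p = (u, v)" by force
    obtain k1 where k1: "\<forall>u v n. (u, v) \<in> S \<longrightarrow> n \<ge> int k1 \<longrightarrow> mode u n v = 0"
      using insert.IH by blast
    obtain k2 :: nat where k2: "\<And>n. n \<ge> int k2 \<Longrightarrow> mode u n v = 0" using mode_bound by blast
    show ?case
    proof (intro exI[of _ "max k1 k2"] allI impI)
      fix u' v' n assume "(u', v') \<in> insert p S" "n \<ge> int (max k1 k2)"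
      then show "mode u' n v' = 0" using k1 k2 p by auto
    qed
  qed simp
  then show thesis using that by blast
qed

text \<open>Phrased as a linear relation between modes, so that linearity in either argument is an
  instance. One pole bound has to serve all three pairs before the scalar series can be
  compared.\<close>

lemma Y_subst_coeff_combination:
  assumes m: "\<And>n. mode u n v = c *s mode u1 n v1 + d *s mode u2 n v2"
    and f: "fps_nth f 0 = 0" "f \<noteq> 0"
  shows "Y_subst_coeff h (fps_to_fls f) u v j =
     c *s Y_subst_coeff h (fps_to_fls f) u1 v1 j + d *s Y_subst_coeff h (fps_to_fls f) u2 v2 j"
proof (rule functional_eqI)
  fix \<phi> assume \<phi>: "Vector_Spaces.linear scale (*) \<phi>"
  then interpret \<phi>: Vector_Spaces.linear scale "(*)" \<phi> .
  obtain k :: nat where k: "\<And>u' v' n. (u', v') \<in> {(u, v), (u1, v1), (u2, v2)} \<Longrightarrow> n \<ge> int k \<Longrightarrow> mode u' n v' = 0"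
    by (rule mode_bound_finite[of "{(u, v), (u1, v1), (u2, v2)}"]) auto
  have "Abs_fps (\<lambda>i. \<phi> (mode u (int k - 1 - int i) v)) =
      fps_const c * Abs_fps (\<lambda>i. \<phi> (mode u1 (int k - 1 - int i) v1)) +
      fps_const d * Abs_fps (\<lambda>i. \<phi> (mode u2 (int k - 1 - int i) v2))"
    by (rule fps_ext) (simp add: m \<phi>.add \<phi>.scale)
  then have "fps_to_fls (Abs_fps (\<lambda>i. \<phi> (mode u (int k - 1 - int i) v)) oo f) =
      fls_const c * fps_to_fls (Abs_fps (\<lambda>i. \<phi> (mode u1 (int k - 1 - int i) v1)) oo f) +
      fls_const d * fps_to_fls (Abs_fps (\<lambda>i. \<phi> (mode u2 (int k - 1 - int i) v2)) oo f)"
    using f by (simp add: fps_compose_add_distrib fps_compose_mult_distrib fls_times_fps_to_fls)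
  then have "fls_nth (h * fps_to_fls f powi (- int k) * fps_to_fls (Abs_fps (\<lambda>i. \<phi> (mode u (int k - 1 - int i) v)) oo f)) j =
      fls_nth (fls_const c * (h * fps_to_fls f powi (- int k) * fps_to_fls (Abs_fps (\<lambda>i. \<phi> (mode u1 (int k - 1 - int i) v1)) oo f))
       + fls_const d * (h * fps_to_fls f powi (- int k) * fps_to_fls (Abs_fps (\<lambda>i. \<phi> (mode u2 (int k - 1 - int i) v2)) oo f))) j"
    by (simp only: distrib_left mult.left_commute[of _ "fls_const _"])
  then show "\<phi> (Y_subst_coeff h (fps_to_fls f) u v j) = \<phi> (c *s Y_subst_coeff h (fps_to_fls f) u1 v1 j + d *s Y_subst_coeff h (fps_to_fls f) u2 v2 j)"
    using functional_Y_subst_coeff[OF \<phi> k f, where h = h and j = j] by (simp add: \<phi>.add \<phi>.scale)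
qed

lemma res_Y_combination_left:
  "res_Y a b (c *s u + d *s u') v = c *s res_Y a b u v + d *s res_Y a b u' v"
  unfolding res_Y_def
  by (rule Y_subst_coeff_combination) (simp_all add: mode_add_left mode_scale_left)

lemma res_Y_combination_right:
  "res_Y a b u (c *s v + d *s v') = c *s res_Y a b u v + d *s res_Y a b u v'"
  unfolding res_Y_def
  by (rule Y_subst_coeff_combination) (simp_all add: mode_add_right mode_scale_right)

end

section \<open>Eigencomponents and bilinearity of the bullet product\<close>

context vertex_algebra_aut
begin

lemma g_add: "g (u + v) = g u + g v"
  and g_scale: "g (c *s u) = c *s g u"
  using g_linear by (simp_all add: Vector_Spaces.linear_iff module_hom_iff linear.axioms)

lemma g_pow_add: "(g ^^ j) (u + v) = (g ^^ j) u + (g ^^ j) v"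
  and g_pow_scale: "(g ^^ j) (c *s u) = c *s (g ^^ j) u"
  by (induction j) (simp_all add: g_add g_scale)

lemma component_combination:
  "component r (c *s u + d *s v) = c *s component r u + d *s component r v"
  by (simp add: component_def g_pow_add g_pow_scale scale_right_distrib sum.distrib scale_sum_right mult_ac)

text \<open>\<open>component s\<close> commutes with g, so \<open>component s u\<close> is an
  eigenvector for the r-th and the s-th root of unity at once, and these differ for distinct r, s <
  T. The case s = r then follows from \<open>sum_component\<close>.\<close>

lemma component_eigenspace:
  assumes u: "u \<in> eigenspace r" and r: "r < T" and s: "s < T"
  shows "component s u = (if s = r then u else 0)"
proof -
  let ?e = "\<lambda>r. exp (2 * of_real pi * \<i> * of_nat r / of_nat T :: complex)"
  have zero: "component s u = 0" if "s \<noteq> r" "s < T" for s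
  proof -
    have "?e s *s component s u = g (component s u)"
      using component_in_eigenspace[of s u] by (simp add: eigenspace_def)
    also have "\<dots> = component s (g u)"
    proof -
      interpret g: Vector_Spaces.linear scale scale g by (rule g_linear)
      show ?thesis by (simp add: component_def g.scale g.sum funpow_swap1)
    qed
    also have "\<dots> = ?e r *s component s u"
      using u component_combination[of s "?e r" u 0 0] by (simp add: eigenspace_def)
    finally have "(?e s - ?e r) *s component s u = 0"
      by (simp add: scale_left_diff_distrib)
    moreover have "?e s \<noteq> ?e r"
    proof
      assume "?e s = ?e r"
      then have "cis (2 * pi * real s / real T) = cis (2 * pi * real r / real T)"
        by (simp add: cis_conv_exp mult_ac)
      moreover have "inj_on (\<lambda>k. cis (2 * pi * real k / real T)) {..<T}"
        using bij_betw_roots_unity [of T] T_pos by (simp add: bij_betw_def)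
      ultimately have "s = r" using that r by (auto dest: inj_onD)
      with that show False by simp
    qed
    ultimately show ?thesis by simp
  qed
  have "u = (\<Sum>s<T. component s u)" by (simp add: sum_component)
  also have "\<dots> = component r u"
    using r by (subst sum.remove[of _ r]) (auto intro!: sum.neutral zero)
  finally show ?thesis using zero[OF _ s] by auto
qed

lemma D_eigenspace: "u \<in> eigenspace r \<Longrightarrow> D u \<in> eigenspace r"
  by (simp add: eigenspace_def D_def g_mode g_vac mode_scale_left)

lemma vac_eigenspace: "vac \<in> eigenspace 0"
  by (simp add: eigenspace_def g_vac)

lemma bullet_hom_combination_left:
  "bullet_hom m p n r (c *s u + d *s u') v = c *s bullet_hom m p n r u v + d *s bullet_hom m p n r u' v"
  by (simp add: bullet_hom_def Let_def res_Y_combination_left scale_right_distrib sum.distrib scale_sum_right mult_ac)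

lemma bullet_hom_combination_right:
  "bullet_hom m p n r u (c *s v + d *s v') = c *s bullet_hom m p n r u v + d *s bullet_hom m p n r u v'"
  by (simp add: bullet_hom_def Let_def res_Y_combination_right scale_right_distrib sum.distrib scale_sum_right mult_ac)

lemma bullet_combination_left:
  "bullet m p n (c *s u + d *s u') v = c *s bullet m p n u v + d *s bullet m p n u' v"
  by (simp add: bullet_def component_combination bullet_hom_combination_left sum.distrib scale_sum_right)

lemma bullet_combination_right:
  "bullet m p n u (c *s v + d *s v') = c *s bullet m p n u v + d *s bullet m p n u v'"
  by (simp add: bullet_def bullet_hom_combination_right sum.distrib scale_sum_right)

lemma bullet_add_left: "bullet m p n (u + u') v = bullet m p n u v + bullet m p n u' v"
  and bullet_scale_left: "bullet m p n (c *s u) v = c *s bullet m p n u v"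
  and bullet_add_right: "bullet m p n u (v + v') = bullet m p n u v + bullet m p n u v'"
  and bullet_scale_right: "bullet m p n u (c *s v) = c *s bullet m p n u v"
  using bullet_combination_left[of m p n 1 u 1 u' v] bullet_combination_left[of m p n c u 0 u v]
    bullet_combination_right[of m p n u 1 v 1 v'] bullet_combination_right[of m p n u c v 0 v]
  by simp_all

lemma bullet_zero_left [simp]: "bullet m p n 0 v = 0"
  and bullet_zero_right [simp]: "bullet m p n u 0 = 0"
  using bullet_scale_left[of m p n 0 0 v] bullet_scale_right[of m p n u 0 0] by simp_all

lemma bullet_diff_left: "bullet m p n (u - u') v = bullet m p n u v - bullet m p n u' v"
  and bullet_diff_right: "bullet m p n u (v - v') = bullet m p n u v - bullet m p n u v'"
  using bullet_add_left[of m p n "u - u'" u' v] bullet_add_right[of m p n u "v - v'" v']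
  by (simp_all add: algebra_simps)

lemma bullet_sum_left: "bullet m p n (\<Sum>i\<in>A. f i) v = (\<Sum>i\<in>A. bullet m p n (f i) v)"
  by (induction A rule: infinite_finite_induct) (simp_all add: bullet_add_left)

lemma bullet_eigenspace:
  assumes "u \<in> eigenspace r" "r < T"
  shows "bullet m p n u v = bullet_hom m p n r u v"
proof -
  have z: "bullet_hom m p n s 0 v = 0" for s
    using bullet_hom_combination_left[of m p n s 0 0 0 0 v] by simp
  have "bullet m p n u v = (\<Sum>s<T. if s = r then bullet_hom m p n r u v else 0)"
    unfolding bullet_def using assms by (intro sum.cong) (auto simp: component_eigenspace z)
  then show ?thesis using assms by simp
qed

lemma bullet_component_sum: "bullet m p n u v = (\<Sum>r<T. bullet m p n (component r u) v)"
  by (subst bullet_sum_left[symmetric]) (simp add: sum_component)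

end

section \<open>The vacuum and the products\<close>

text \<open>In \<open>bullet m p n vac v\<close>, M and P are the integer parts of m and p, and M +
  d + i is e - 1 + i. For d >= 0 the last binomial has a lower entry of at least M, so only d = i =
  0 survives. For d = -k < 0 put j = M - k + i: then binom(j,i) binom(M,j) = binom(M,k) binom(k,i),
  and the alternating sum of binom(k,i) vanishes; d >= -P ensures that the row is complete.\<close>

lemma vacuum_binomial_sum:
  assumes d: "d \<ge> - int P"
  shows "(\<Sum>i\<le>P. (-1) ^ i * (of_int (int M + d + int i) gchoose i) *
      (if int M + d + int i \<ge> 0 then of_nat M gchoose nat (int M + d + int i) else 0)) = (if d = 0 then 1 else 0 :: complex)"
proof (cases "d \<ge> 0")
  case True
  have "(\<Sum>i\<le>P. (-1) ^ i * (of_int (int M + d + int i) gchoose i) *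
      (if int M + d + int i \<ge> 0 then of_nat M gchoose nat (int M + d + int i) else 0)) =
      (\<Sum>i\<le>P. if i = 0 then (if d = 0 then 1 else 0 :: complex) else 0)"
  proof (rule sum.cong[OF refl])
    fix i
    have "(of_nat M gchoose nat (int M + d + int i) :: complex) = (if d = 0 \<and> i = 0 then 1 else 0)"
    proof (cases "d = 0 \<and> i = 0")
      case True
      then show ?thesis by (simp flip: binomial_gbinomial)
    next
      case False
      with True have "nat (int M + d + int i) > M" by auto
      then show ?thesis using False by (auto simp flip: binomial_gbinomial)
    qed
    then show "(-1) ^ i * (of_int (int M + d + int i) gchoose i) *
      (if int M + d + int i \<ge> 0 then of_nat M gchoose nat (int M + d + int i) else 0) =
      (if i = 0 then (if d = 0 then 1 else 0 :: complex) else 0)" by auto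
  qed
  then show ?thesis by simp
next
  case False
  define k where "k = nat (- d)"
  have k: "d = - int k" "k \<ge> 1" "k \<le> P" using False d by (auto simp: k_def)
  have "(-1) ^ i * (of_int (int M + d + int i) gchoose i) *
      (if int M + d + int i \<ge> 0 then of_nat M gchoose nat (int M + d + int i) else 0) =
      of_nat (M choose k) * ((-1) ^ i * of_nat (k choose i) :: complex)" for i
  proof (cases "int M + d + int i \<ge> 0")
    case True
    define j where "j = nat (int M + d + int i)"
    have j: "int M + d + int i = int j" "j + k = M + i" using True k by (auto simp: j_def)
    have "(j choose i) * (M choose j) = (M choose k) * (k choose i)"
    proof (cases "i \<le> k \<and> k \<le> M")
      case True
      then have "i \<le> j" "j \<le> M" using j by auto
      then have "(M choose j) * (j choose i) = (M choose i) * ((M - i) choose (j - i))"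
        by (rule choose_mult)
      also have "((M - i) choose (j - i)) = ((M - i) choose (k - i))"
      proof -
        have "M - i - (k - i) = j - i" "k - i \<le> M - i" using True j(2) by linarith+
        then show ?thesis using binomial_symmetric[of "k - i" "M - i"] by simp
      qed
      also have "(M choose i) * \<dots> = (M choose k) * (k choose i)"
        using choose_mult[of i k M] True by simp
      finally show ?thesis by (simp add: mult.commute)
    next
      case False
      show ?thesis
      proof (cases "k < i")
        case True
        then have "M < j" using j(2) by linarith
        with True show ?thesis by (simp add: binomial_eq_0)
      next
        case False
        with \<open>\<not> (i \<le> k \<and> k \<le> M)\<close> have "M < k" by simp
        moreover from this have "j < i" using j(2) by linarith
        ultimately show ?thesis by (simp add: binomial_eq_0)
      qed
    qed
    then have "(of_nat (j choose i) * of_nat (M choose j) :: complex) = of_nat (M choose k) * of_nat (k choose i)"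
      by (metis of_nat_mult)
    moreover have "(of_int (int M + d + int i) :: complex) = of_nat j"
      unfolding j by simp
    ultimately show ?thesis
      using True unfolding j_def[symmetric] by (simp flip: binomial_gbinomial)
  next
    case False
    with k have "k > M" by linarith
    with False show ?thesis by simp
  qed
  then have "(\<Sum>i\<le>P. (-1) ^ i * (of_int (int M + d + int i) gchoose i) *
      (if int M + d + int i \<ge> 0 then of_nat M gchoose nat (int M + d + int i) else 0)) =
      of_nat (M choose k) * (\<Sum>i\<le>P. (-1) ^ i * of_nat (k choose i) :: complex)"
    by (simp only: sum_distrib_left)
  also have "(\<Sum>i\<le>P. (-1) ^ i * of_nat (k choose i) :: complex) = (\<Sum>i\<le>k. (-1) ^ i * of_nat (k choose i))"
    using k by (intro sum.mono_neutral_right) auto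
  also have "\<dots> = 0" using k by (intro choose_alternating_sum) simp
  finally show ?thesis using k by simp
qed

lemma fps_exp_oo_ln: "fps_exp (c::complex) oo fps_ln 1 = fps_binomial c"
proof -
  have "fps_exp c oo fps_ln 1 = (fps_binomial c oo (fps_exp 1 - 1)) oo fps_ln 1"
    by (simp only: fps_binomial_oo_exp_minus_one)
  also have "\<dots> = fps_binomial c oo ((fps_exp 1 - 1) oo fps_ln 1)"
    by (rule fps_compose_assoc[symmetric]) simp_all
  finally show ?thesis by (simp only: fps_exp_minus_one_oo_ln fps_compose_fps_X)
qed

lemma frac_nats_iff: "n \<in> frac_nats T \<longleftrightarrow> n \<in> frac_ints T \<and> n \<ge> 0"
proof (cases "T = 0")
  case True
  then show ?thesis by (auto simp: frac_nats_def frac_ints_def)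
next
  case False
  then show ?thesis
  proof (intro iffI conjI)
    assume "n \<in> frac_ints T \<and> n \<ge> 0"
    then obtain k where k: "n = of_int k / of_nat T" "n \<ge> 0" by (auto simp: frac_ints_def)
    with False have "k \<ge> 0" by (simp add: zero_le_divide_iff)
    with k show "n \<in> frac_nats T" by (auto simp: frac_nats_def intro!: image_eqI[of _ _ "nat k"])
  qed (auto simp: frac_nats_def frac_ints_def intro: range_eqI[of _ _ "int _"])
qed

lemma bar_less: "T \<ge> 1 \<Longrightarrow> bar T n < T"
  using frac_lt_1[of n] frac_ge_0[of n]
  by (auto simp: bar_def floor_less_iff nat_less_iff)

lemma frac_ints_decompose:
  assumes "n \<in> frac_ints T" "T \<ge> 1"
  shows "n = of_int \<lfloor>n\<rfloor> + of_nat (bar T n) / of_nat T"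
proof -
  obtain k where k: "n = of_int k / of_nat T" using assms by (auto simp: frac_ints_def)
  have "of_nat T * frac n = of_int (k - int T * \<lfloor>n\<rfloor>)"
    using assms by (simp add: frac_def k field_simps)
  moreover have "of_nat T * frac n \<ge> 0" using frac_ge_0[of n] by simp
  ultimately have "of_nat (bar T n) = of_nat T * frac n"
    unfolding bar_def by (metis floor_of_int of_int_0_le_iff of_nat_nat)
  then show ?thesis using assms by (simp add: frac_def)
qed

lemma frac_ints_add: "a \<in> frac_ints T \<Longrightarrow> b \<in> frac_ints T \<Longrightarrow> a + b \<in> frac_ints T"
  unfolding frac_ints_def by (auto simp flip: add_divide_distrib of_int_add)

lemma frac_ints_diff: "a \<in> frac_ints T \<Longrightarrow> b \<in> frac_ints T \<Longrightarrow> a - b \<in> frac_ints T"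
  unfolding frac_ints_def by (auto simp flip: diff_divide_distrib of_int_diff)

lemma frac_ints_of_int: "T \<ge> 1 \<Longrightarrow> of_int k \<in> frac_ints T"
  unfolding frac_ints_def by (rule range_eqI[of _ _ "k * int T"]) simp

context vertex_algebra
begin

lemma res_Y_vac_left:
  "res_Y a b vac v = (if b \<ge> 1 then a gchoose nat (b - 1) else 0) *s v"
proof -
  have "res_Y a b vac v = Sum_any (\<lambda>n::int. (fls_nth (fps_to_fls (fps_binomial a) * fls_X powi (- b)) (- 1) *s v) when n = - 1)"
    unfolding res_Y_def Y_subst_coeff_def
    by (intro arg_cong[where f = Sum_any] ext) (auto simp: vacuum when_def simp del: fls_X_power_int)
  also have "\<dots> = fls_nth (fls_X powi (- b) * fps_to_fls (fps_binomial a)) (- 1) *s v"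
    by (simp add: mult.commute del: fls_X_power_int)
  also have "fls_nth (fls_X powi (- b) * fps_to_fls (fps_binomial a)) (- 1) = (if b \<ge> 1 then a gchoose nat (b - 1) else 0)"
    by (simp only: fls_X_power_int fls_X_intpow_times_conv_shift(1) fls_shift_nth) auto
  finally show ?thesis .
qed

text \<open>For such a functional e^(xD) becomes the scalar e^(cx), that is (1+y)^c for x =
  log(1+y), and the residue of (1+y)^(a+c) y^(-b) is a binomial coefficient. By
  \<open>creation\<close> the pole bound may be taken to be 0.\<close>

lemma functional_res_Y_vac_right:
  assumes \<phi>: "Vector_Spaces.linear scale (*) \<phi>" and D: "\<And>x. \<phi> (D x) = c * \<phi> x" and b: "b \<ge> 1"
  shows "\<phi> (res_Y a b u vac) = ((a + c) gchoose nat (b - 1)) * \<phi> u"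
proof -
  interpret \<phi>: Vector_Spaces.linear scale "(*)" \<phi> by (rule \<phi>)
  have "\<phi> ((D ^^ i) x) = c ^ i * \<phi> x" for i x
    by (induction i) (simp_all add: D)
  then have "exp_series \<phi> 0 u vac = fps_const (\<phi> u) * fps_exp c"
    by (intro fps_ext) (simp add: exp_series_def mode_neg_vac \<phi>.scale del: of_nat_Suc flip: diff_diff_eq)
  then have "exp_series \<phi> 0 u vac oo fps_ln 1 = fps_const (\<phi> u) * fps_binomial c"
    by (simp add: fps_compose_mult_distrib fps_exp_oo_ln)
  moreover have "\<phi> (res_Y a b u vac) = fls_nth (fps_to_fls (fps_binomial a * (exp_series \<phi> 0 u vac oo fps_ln 1))) (b + int 0 - 1)"
    by (rule functional_res_Y[OF \<phi>]) (simp add: creation)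
  ultimately show ?thesis using b
    by (simp add: mult.left_commute[of "fps_binomial a"] flip: fps_binomial_add_mult)
qed

lemma subspace_set_plus: "subspace A \<Longrightarrow> subspace B \<Longrightarrow> subspace (A + B)"
proof -
  have "A + B = {x + y |x y. x \<in> A \<and> y \<in> B}" by (auto simp: set_plus_def)
  then show "subspace A \<Longrightarrow> subspace B \<Longrightarrow> subspace (A + B)" using subspace_sums[of A B] by simp
qed

end

context vertex_algebra_aut
begin

lemma bar_lt: "bar T n < T" by (rule bar_less[OF T_pos])

text \<open>An exact identity, not one modulo relations; \<open>vac\<close> may therefore be
  inserted as leftmost factor to specialise generators. The vacuum has r = 0, so the two deltas are
  1 and 0 and the exponent is the integer part of m, which leads to
  \<open>vacuum_binomial_sum\<close>.\<close>

lemma bullet_vac: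
  assumes "m \<in> frac_nats T" "p \<in> frac_nats T" "n \<in> frac_nats T"
  shows "bullet m p n vac v = (if n = p then v else 0)"
proof -
  have fr: "m \<ge> 0" "p \<ge> 0" "n \<ge> 0" using assms by (auto simp: frac_nats_iff)
  define M P where "M = nat \<lfloor>m\<rfloor>" and "P = nat \<lfloor>p\<rfloor>"
  define d where "d = \<lfloor>n\<rfloor> - \<lfloor>p\<rfloor>"
  have MP: "\<lfloor>m\<rfloor> = int M" "\<lfloor>p\<rfloor> = int P" "d \<ge> - int P" using fr by (auto simp: M_def P_def d_def)
  have e: "res_exponent m 0 = of_nat M"
    by (simp add: res_exponent_def step_delta_def MP)
  have \<delta>: "step_delta (bar T m) 0 = 1" "step_delta (bar T n) T = 0"
    using bar_lt[of n] by (auto simp: step_delta_def)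
  have "bullet m p n vac v = bullet_hom m p n 0 vac v"
    using vac_eigenspace T_pos by (intro bullet_eigenspace) auto
  also have "\<dots> = (if n = p then v else 0)"
  proof (cases "bar T p = bar T n")
    case True
    then have np: "n = p \<longleftrightarrow> d = 0"
    proof -
      have "n = of_int \<lfloor>n\<rfloor> + of_nat (bar T n) / of_nat T" "p = of_int \<lfloor>p\<rfloor> + of_nat (bar T n) / of_nat T"
        using frac_ints_decompose[of n T] frac_ints_decompose[of p T] assms T_pos
        by (simp_all only: frac_nats_iff True)
      then show ?thesis unfolding d_def by (metis eq_iff_diff_eq_0)
    qed
    have "bullet_hom m p n 0 vac v = (\<Sum>i\<le>P. ((-1) ^ i * (of_int (int M + d + int i) gchoose i)) *s
          (if int M + d + int i \<ge> 0 then of_nat M gchoose nat (int M + d + int i) else 0) *s v)"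
      unfolding bullet_hom_def Let_def res_Y_vac_left e
      by (auto simp: True \<delta> MP d_def algebra_simps intro!: sum.cong)
    also have "\<dots> = (\<Sum>i\<le>P. (-1) ^ i * (of_int (int M + d + int i) gchoose i) *
          (if int M + d + int i \<ge> 0 then of_nat M gchoose nat (int M + d + int i) else 0)) *s v"
      by (simp only: scale_sum_left scale_scale)
    finally show ?thesis
      unfolding vacuum_binomial_sum[OF MP(3)] np by simp
  next
    case False
    have "(int (bar T p) - int (bar T n)) mod int T \<noteq> 0"
    proof
      assume "(int (bar T p) - int (bar T n)) mod int T = 0"
      then have "int (bar T p) mod int T = int (bar T n) mod int T"
        by (simp add: mod_eq_dvd_iff dvd_eq_mod_eq_0)
      then show False using False bar_lt[of p] bar_lt[of n] by simp
    qed
    then show ?thesis using False by (auto simp: bullet_hom_def Let_def)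
  qed
  finally show ?thesis .
qed

lemma subspace_O1: "subspace (O1 n m)"
  unfolding O1_def by (intro subspace_set_plus subspace_span)

lemma subspace_O2: "subspace (O2 n m)"
  unfolding O2_def by (rule subspace_span)

lemma subspace_O3: "subspace (O3 n m)"
  unfolding O3_def by (rule subspace_span)

lemma subspace_O_tilde: "subspace (O_tilde n m)"
  unfolding O_tilde_def by (intro subspace_set_plus subspace_O1 subspace_O2 subspace_O3)

lemma diamond_in_O1:
  assumes "r < T" "u \<in> eigenspace r"
  shows "diamond m n r u v \<in> O1 n m"
proof -
  have "diamond m n r u v + 0 \<in> O1 n m"
    unfolding O1_def using assms by (intro set_plus_intro span_zero span_base) blast
  then show ?thesis by simp
qed

lemma D_in_O1: "D u + of_rat (m - n) *s u \<in> O1 n m"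
proof -
  have "0 + (D u + of_rat (m - n) *s u) \<in> O1 n m"
    unfolding O1_def by (intro set_plus_intro span_zero span_base) blast
  then show ?thesis by simp
qed

lemma O1_subset: "O1 n m \<subseteq> O_tilde n m"
  and O2_subset: "O2 n m \<subseteq> O_tilde n m"
  and O3_subset: "O3 n m \<subseteq> O_tilde n m"
proof -
  have z: "0 \<in> O1 n m" "0 \<in> O2 n m" "0 \<in> O3 n m"
    by (simp_all add: subspace_0 subspace_O1 subspace_O2 subspace_O3)
  show "O1 n m \<subseteq> O_tilde n m"
  proof
    fix x assume "x \<in> O1 n m"
    then have "x + 0 + 0 \<in> O_tilde n m" unfolding O_tilde_def by (intro set_plus_intro z)
    then show "x \<in> O_tilde n m" by simp
  qed
  show "O2 n m \<subseteq> O_tilde n m"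
  proof
    fix x assume "x \<in> O2 n m"
    then have "0 + x + 0 \<in> O_tilde n m" unfolding O_tilde_def by (intro set_plus_intro z)
    then show "x \<in> O_tilde n m" by simp
  qed
  show "O3 n m \<subseteq> O_tilde n m"
  proof
    fix x assume "x \<in> O3 n m"
    then have "0 + 0 + x \<in> O_tilde n m" unfolding O_tilde_def by (intro set_plus_intro z)
    then show "x \<in> O_tilde n m" by simp
  qed
qed

text \<open>A functional that kills the relations D + m - n sees D as the scalar n - m, which turns
  residues against \<open>vac\<close> into binomial coefficients. If the degrees match the
  eigenvalue index r, the upper entry is the integer part N of n, and only the summand i = 0
  survives, with coefficient 1. Otherwise the bullet product is 0, and the diamond relation, now
  with a non-integral exponent, forces the component to be killed as well.\<close>

lemma bullet_vac_right:
  assumes m: "m \<in> frac_nats T" and n: "n \<in> frac_nats T"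
  shows "bullet m m n u vac - u \<in> O1 n m"
proof (rule mem_subspaceI[OF subspace_O1])
  fix \<phi> assume \<phi>: "Vector_Spaces.linear scale (*) \<phi>" and 0: "\<And>y. y \<in> O1 n m \<Longrightarrow> \<phi> y = 0"
  interpret \<phi>: Vector_Spaces.linear scale "(*)" \<phi> by (rule \<phi>)
  define c :: complex where "c = of_rat (n - m)"
  have D: "\<phi> (D x) = c * \<phi> x" for x
    using 0[OF D_in_O1[of x m n]] by (simp add: \<phi>.diff \<phi>.add \<phi>.scale c_def of_rat_diff algebra_simps)
  note res = functional_res_Y_vac_right[OF \<phi> D]
  have fr: "\<lfloor>m\<rfloor> \<ge> 0" "\<lfloor>n\<rfloor> \<ge> 0" using m n by (auto simp: frac_nats_iff)
  have dec: "(of_rat x :: complex) = of_int \<lfloor>x\<rfloor> + of_nat (bar T x) / of_nat T" if "x \<in> frac_nats T" for x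
  proof -
    have "(of_rat x :: complex) = of_rat (of_int \<lfloor>x\<rfloor> + of_nat (bar T x) / of_nat T)"
      using frac_ints_decompose[of x T] that T_pos by (auto simp: frac_nats_iff)
    then show ?thesis by (simp add: of_rat_add of_rat_divide)
  qed
  have "\<phi> (bullet m m n (component r u) vac) = \<phi> (component r u)" if r: "r < T" for r
  proof -
    define w where "w = component r u"
    have w: "w \<in> eigenspace r" by (simp add: w_def component_in_eigenspace)
    define \<delta> \<delta>' where "\<delta> = step_delta (bar T m) r" and "\<delta>' = step_delta (bar T n) (T - r)"
    \<comment> \<open>T divides j exactly when the congruence of \<open>bullet_hom\<close> holds for
      p = m.\<close>
    define j where "j = int (bar T n) + int r - int (bar T m)"
    have exponent: "res_exponent m r + c = of_int (\<lfloor>n\<rfloor> - 1 + \<delta>) + of_int j / of_nat T"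
      by (simp add: res_exponent_def c_def of_rat_diff dec[OF m] dec[OF n] \<delta>_def j_def field_simps diff_divide_distrib add_divide_distrib)
    have \<delta>0: "\<delta> \<in> {0, 1}" "\<delta>' \<in> {0, 1}" by (auto simp: \<delta>_def \<delta>'_def step_delta_def)
    have b: "bullet m m n w vac = bullet_hom m m n r w vac"
      by (rule bullet_eigenspace[OF w r])
    have jb: "- int T < j" "j < 2 * int T" using bar_lt[of m] bar_lt[of n] r by (auto simp: j_def)
    show ?thesis
    proof (cases "int T dvd j")
      case True
      then obtain q where q: "j = int T * q" by (rule dvdE)
      have "\<not> q \<le> - 1"
      proof
        assume "q \<le> - 1"
        from mult_left_mono[OF this, of "int T"] jb q show False by simp
      qed
      moreover have "\<not> 2 \<le> q"
      proof
        assume "2 \<le> q"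
        from mult_left_mono[OF this, of "int T"] jb q show False by linarith
      qed
      ultimately have q01: "q = 0 \<or> q = 1" by auto
      \<comment> \<open>The cases are no wrap-around and one wrap-around modulo T in the congruence
        of bar m with bar n + r. The deltas record which one occurs, so that floor n - 1 +
        \<open>\<delta>\<close> + q is floor n.\<close>
      have \<delta>1: "\<delta> + \<delta>' = 1" "q = 1 - \<delta>"
      proof -
        have "\<delta> + \<delta>' = 1 \<and> q = 1 - \<delta>"
          using q01
        proof
          assume q0: "q = 0"
          then have "bar T m = bar T n + r" using q j_def by auto
          then show ?thesis using q0 bar_lt[of m] by (auto simp: \<delta>_def \<delta>'_def step_delta_def)
        next
          assume q1: "q = 1"
          then have "bar T n + r = bar T m + T" using q j_def by auto
          then show ?thesis using q1 bar_lt[of n] r by (auto simp: \<delta>_def \<delta>'_def step_delta_def)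
        qed
        then show "\<delta> + \<delta>' = 1" "q = 1 - \<delta>" by auto
      qed
      define N where "N = nat \<lfloor>n\<rfloor>"
      have N: "\<lfloor>n\<rfloor> = int N" using fr by (simp add: N_def)
      have ex: "res_exponent m r + c = of_nat N"
        unfolding exponent q using T_pos \<delta>1 by (simp add: N)
      have cond: "(int (bar T m) - int (bar T n)) mod int T = int r mod int T"
      proof -
        have "int (bar T m) - int (bar T n) = int r - int T * q" using q j_def by simp
        then show ?thesis by (simp add: mod_diff_right_eq[symmetric])
      qed
      have e: "\<lfloor>m\<rfloor> + \<lfloor>n\<rfloor> - \<lfloor>m\<rfloor> + step_delta (bar T m) r + step_delta (bar T n) (T - r) = int N + 1"
        using \<delta>1 by (simp add: N \<delta>_def \<delta>'_def)
      have "\<phi> (bullet m m n w vac) = (\<Sum>i\<le>nat \<lfloor>m\<rfloor>. (-1) ^ i * (of_int (int N + int i) gchoose i) *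
          ((of_nat N gchoose (N + i)) * \<phi> w))"
        unfolding b bullet_hom_def Let_def e using cond
        by (simp add: \<phi>.sum \<phi>.scale res ex nat_add_distrib)
      also have "\<dots> = (\<Sum>i\<le>nat \<lfloor>m\<rfloor>. if i = 0 then \<phi> w else 0)"
        by (intro sum.cong refl) (auto simp flip: binomial_gbinomial)
      finally show ?thesis by (simp add: w_def)
    next
      case False
      have nc: "(int (bar T m) - int (bar T n)) mod int T \<noteq> int r mod int T"
      proof
        assume "(int (bar T m) - int (bar T n)) mod int T = int r mod int T"
        then have "int T dvd (int (bar T m) - int (bar T n)) - int r" by (simp add: mod_eq_dvd_iff)
        then have "int T dvd - ((int (bar T m) - int (bar T n)) - int r)" by (simp only: dvd_minus_iff)
        then show False using False by (simp add: j_def algebra_simps)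
      qed
      have "0 = \<phi> (diamond m n r w vac)"
        using 0[OF diamond_in_O1[OF r w]] by simp
      also have "\<dots> = ((res_exponent m r + c) gchoose nat (\<lfloor>m\<rfloor> + \<lfloor>n\<rfloor> + \<delta> + \<delta>')) * \<phi> w"
        unfolding diamond_def \<delta>_def[symmetric] \<delta>'_def[symmetric] using fr \<delta>0 by (subst res) auto
      finally have z: "((res_exponent m r + c) gchoose nat (\<lfloor>m\<rfloor> + \<lfloor>n\<rfloor> + \<delta> + \<delta>')) * \<phi> w = 0" by simp
      \<comment> \<open>The exponent differs from an integer by j/T, which is not an integer; hence
        no factor of the binomial coefficient vanishes.\<close>
      have "res_exponent m r + c \<noteq> of_nat i" for i
      proof
        assume "res_exponent m r + c = of_nat i"
        then have "of_int j / of_nat T = (of_int (int i - (\<lfloor>n\<rfloor> - 1 + \<delta>)) :: complex)"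
          unfolding exponent by (simp add: algebra_simps)
        then have "(of_int j :: complex) = of_int (int i - (\<lfloor>n\<rfloor> - 1 + \<delta>)) * of_nat T"
          by (rule nonzero_divide_eq_eq[THEN iffD1, rotated]) (use T_pos in simp)
        also have "\<dots> = of_int ((int i - (\<lfloor>n\<rfloor> - 1 + \<delta>)) * int T)"
          by (simp only: of_int_mult of_int_of_nat_eq)
        finally have "j = (int i - (\<lfloor>n\<rfloor> - 1 + \<delta>)) * int T" by (simp only: of_int_eq_iff)
        with False show False by simp
      qed
      then have "((res_exponent m r + c) gchoose i) \<noteq> 0" for i
        by (auto simp: gbinomial_prod_rev)
      with z have "\<phi> w = 0" by simp
      moreover have "bullet m m n w vac = 0"
        using nc unfolding b bullet_hom_def by simp
      ultimately show ?thesis by (simp add: w_def)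
    qed
  qed
  then have "\<phi> (bullet m m n u vac) = (\<Sum>r<T. \<phi> (component r u))"
    by (subst bullet_component_sum) (simp add: \<phi>.sum)
  also have "\<dots> = \<phi> u"
    by (simp add: sum_component flip: \<phi>.sum)
  finally show "\<phi> (bullet m m n u vac - u) = 0" by (simp add: \<phi>.diff)
qed

end

section \<open>The relations under left and right multiplication\<close>

context vertex_algebra_aut
begin

lemma bullet_span_right:
  assumes "x \<in> span S" "subspace N" "\<And>y. y \<in> S \<Longrightarrow> bullet m p n u y \<in> N"
  shows "bullet m p n u x \<in> N"
  using assms(1)
proof (induction rule: span_induct_alt)
  case base
  show ?case using assms(2) by (simp add: subspace_0)
next
  case (step c x y)
  then show ?case using assms by (simp add: bullet_add_right bullet_scale_right subspace_add subspace_scale)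
qed

lemma bullet_span_left:
  assumes "x \<in> span S" "subspace N" "\<And>y. y \<in> S \<Longrightarrow> bullet m p n y v \<in> N"
  shows "bullet m p n x v \<in> N"
  using assms(1)
proof (induction rule: span_induct_alt)
  case base
  show ?case using assms(2) by (simp add: subspace_0)
next
  case (step c x y)
  then show ?case using assms by (simp add: bullet_add_left bullet_scale_left subspace_add subspace_scale)
qed

text \<open>Indices are read as for composition of maps: c goes from degree m to p1, b from p1 to
  p2, a from p2 to p3. In this notation the generators of \<open>O2\<close> are the left multiples
  of associators.\<close>

definition associator :: "rat \<Rightarrow> rat \<Rightarrow> rat \<Rightarrow> rat \<Rightarrow> 'v \<Rightarrow> 'v \<Rightarrow> 'v \<Rightarrow> 'v" where
  "associator m p1 p2 p3 a b c =
     bullet m p1 p3 (bullet p1 p2 p3 a b) c - bullet m p2 p3 a (bullet m p1 p2 b c)"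

lemma bullet_associator_in_O2:
  assumes "p1 \<in> frac_nats T" "p2 \<in> frac_nats T" "p3 \<in> frac_nats T"
  shows "bullet m p3 n u (associator m p1 p2 p3 a b c) \<in> O2 n m"
  unfolding O2_def associator_def using assms by (intro span_base) blast

text \<open>A generator of \<open>O2\<close> whose outer factor is \<open>vac\<close>, an exact unit
  by \<open>bullet_vac\<close>.\<close>

lemma associator_in_O2:
  assumes "m \<in> frac_nats T" "p1 \<in> frac_nats T" "p2 \<in> frac_nats T" "n \<in> frac_nats T"
  shows "associator m p1 p2 n a b c \<in> O2 n m"
  using bullet_associator_in_O2[of p1 p2 n m n vac a b c] assms by (simp add: bullet_vac)

lemma bullet_bullet_left:
  "bullet m p1 n (bullet p1 p2 n a b) c = associator m p1 p2 n a b c + bullet m p2 n a (bullet m p1 p2 b c)"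
  by (simp add: associator_def)

text \<open>Rebracketing u(u'A) as (uu')A, for an associator A, costs an associator with last entry
  A; both terms have a shape already known to lie in \<open>O2\<close>.\<close>

lemma O2_bullet_right:
  assumes x: "x \<in> O2 n m" and m: "m \<in> frac_nats T" and n: "n \<in> frac_nats T" and q: "q \<in> frac_nats T"
  shows "bullet m n q u x \<in> O2 q m"
proof (rule bullet_span_right[OF x[unfolded O2_def] subspace_O2])
  fix y assume "y \<in> {bullet m p3 n u
        (bullet m p1 p3 (bullet p1 p2 p3 a b) c - bullet m p2 p3 a (bullet m p1 p2 b c))
      |a b c u p1 p2 p3. p1 \<in> frac_nats T \<and> p2 \<in> frac_nats T \<and> p3 \<in> frac_nats T}"
  then obtain a b c u' p1 p2 p3 where y: "y = bullet m p3 n u' (associator m p1 p2 p3 a b c)"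
    and p: "p1 \<in> frac_nats T" "p2 \<in> frac_nats T" "p3 \<in> frac_nats T"
    unfolding associator_def by blast
  have "bullet m n q u y = bullet m p3 q (bullet p3 n q u u') (associator m p1 p2 p3 a b c)
      - associator m p3 n q u u' (associator m p1 p2 p3 a b c)"
    by (simp add: y bullet_bullet_left)
  then show "bullet m n q u y \<in> O2 q m"
    using p m n q by (simp add: subspace_diff[OF subspace_O2] bullet_associator_in_O2 associator_in_O2)
qed

text \<open>Mac Lane's pentagon expresses the left-hand side by four elements of \<open>O2 n m\<close>.\<close>

lemma associator_bullet_in_O2:
  assumes "m \<in> frac_nats T" "m' \<in> frac_nats T" "p1 \<in> frac_nats T" "p2 \<in> frac_nats T" "n \<in> frac_nats T"
  shows "bullet m m' n (associator m' p1 p2 n a b c) d \<in> O2 n m"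
proof -
  have "bullet m m' n (associator m' p1 p2 n a b c) d =
      associator m m' p1 n (bullet p1 p2 n a b) c d
      + associator m p1 p2 n a b (bullet m m' p1 c d)
      - associator m m' p2 n a (bullet m' p1 p2 b c) d
      - bullet m p2 n a (associator m m' p1 p2 b c d)"
    by (simp add: associator_def bullet_diff_left bullet_diff_right)
  also have "\<dots> \<in> O2 n m"
    using assms by (intro subspace_diff[OF subspace_O2] subspace_add[OF subspace_O2]
        associator_in_O2 bullet_associator_in_O2)
  finally show ?thesis .
qed

text \<open>(uA)z equals u(Az) up to an associator, and Az is covered by the pentagon.\<close>

lemma O2_bullet_left:
  assumes x: "x \<in> O2 n m" and m: "m \<in> frac_nats T" and m': "m' \<in> frac_nats T" and n: "n \<in> frac_nats T"
  shows "bullet m' m n x z \<in> O2 n m'"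
proof (rule bullet_span_left[OF x[unfolded O2_def] subspace_O2])
  fix y assume "y \<in> {bullet m p3 n u
        (bullet m p1 p3 (bullet p1 p2 p3 a b) c - bullet m p2 p3 a (bullet m p1 p2 b c))
      |a b c u p1 p2 p3. p1 \<in> frac_nats T \<and> p2 \<in> frac_nats T \<and> p3 \<in> frac_nats T}"
  then obtain a b c u p1 p2 p3 where y: "y = bullet m p3 n u (associator m p1 p2 p3 a b c)"
    and p: "p1 \<in> frac_nats T" "p2 \<in> frac_nats T" "p3 \<in> frac_nats T"
    unfolding associator_def by blast
  show "bullet m' m n y z \<in> O2 n m'"
    unfolding y bullet_bullet_left using p m n m'
    by (intro subspace_add[OF subspace_O2] associator_in_O2 O2_bullet_right associator_bullet_in_O2)
qed

lemma O3_I: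
  assumes "x \<in> O1 p2 p1" "p1 \<in> frac_nats T" "p2 \<in> frac_nats T"
  shows "bullet m p1 n (bullet p1 p2 n u x) v \<in> O3 n m"
  unfolding O3_def using assms by (intro span_base) blast

text \<open>A generator of \<open>O3\<close> with left factor \<open>vac\<close>. This is the reason
  why elements of \<open>O1 q n\<close> act as zero from degree n to degree q.\<close>

lemma O1_bullet_left:
  assumes "x \<in> O1 q n" "n \<in> frac_nats T" "q \<in> frac_nats T"
  shows "bullet m n q x v \<in> O3 q m"
  using O3_I[OF assms, of m q vac v] assms by (simp add: bullet_vac)

text \<open>Generators of \<open>O3\<close> carry one more factor on the right. Taking it to be
  \<open>vac\<close>, and removing it again modulo \<open>O1\<close> by
  \<open>bullet_vac_right\<close>, reaches the product of u and x itself.\<close>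

lemma O1_bullet_right:
  assumes "x \<in> O1 n m" "m \<in> frac_nats T" "n \<in> frac_nats T" "q \<in> frac_nats T"
  shows "bullet m n q u x \<in> O_tilde q m"
proof -
  let ?y = "bullet m n q u x"
  have "bullet m m q ?y vac \<in> O_tilde q m"
    using O3_subset O3_I[OF assms(1-3)] by blast
  moreover have "bullet m m q ?y vac - ?y \<in> O_tilde q m"
    using O1_subset bullet_vac_right[OF assms(2,4)] by blast
  ultimately have "bullet m m q ?y vac - (bullet m m q ?y vac - ?y) \<in> O_tilde q m"
    by (rule subspace_diff[OF subspace_O_tilde])
  then show ?thesis by simp
qed

text \<open>Moving u inwards past both brackets yields ((uu')x)v, again a generator of
  \<open>O3\<close>, and two terms built from associators.\<close>

lemma O3_bullet_right:
  assumes x: "x \<in> O3 n m" and m: "m \<in> frac_nats T" and n: "n \<in> frac_nats T" and q: "q \<in> frac_nats T"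
  shows "bullet m n q u x \<in> O_tilde q m"
proof (rule bullet_span_right[OF x[unfolded O3_def] subspace_O_tilde])
  fix y assume "y \<in> {bullet m p1 n (bullet p1 p2 n u x) v
      |u x v p1 p2. p1 \<in> frac_nats T \<and> p2 \<in> frac_nats T \<and> x \<in> O1 p2 p1}"
  then obtain u' x1 v p1 p2 where y: "y = bullet m p1 n (bullet p1 p2 n u' x1) v"
    and p: "p1 \<in> frac_nats T" "p2 \<in> frac_nats T" and x1: "x1 \<in> O1 p2 p1" by blast
  have "bullet m n q u y = bullet m p1 q (bullet p1 p2 q (bullet p2 n q u u') x1) v
      - bullet m p1 q (associator p1 p2 n q u u' x1) v
      - associator m p1 n q u (bullet p1 p2 n u' x1) v"
    by (simp add: y associator_def bullet_diff_left)
  also have "\<dots> \<in> O_tilde q m"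
    using p m n q x1 O2_subset O3_subset
    by (intro subspace_diff[OF subspace_O_tilde]) (blast intro: O3_I associator_in_O2 associator_bullet_in_O2)+
  finally show "bullet m n q u y \<in> O_tilde q m" .
qed

lemma O_tilde_bullet_right:
  assumes x: "x \<in> O_tilde n m" and f: "m \<in> frac_nats T" "n \<in> frac_nats T" "q \<in> frac_nats T"
  shows "bullet m n q u x \<in> O_tilde q m"
proof -
  obtain x1 x2 x3 where x: "x = x1 + x2 + x3" "x1 \<in> O1 n m" "x2 \<in> O2 n m" "x3 \<in> O3 n m"
    using x unfolding O_tilde_def by (auto elim!: set_plus_elim)
  show ?thesis
    unfolding x(1) bullet_add_right
    using O1_bullet_right[OF x(2) f] O2_bullet_right[OF x(3) f] O3_bullet_right[OF x(4) f] O2_subset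
    by (blast intro: subspace_add[OF subspace_O_tilde])
qed

lemma O_tilde_bullet_left:
  assumes x: "x \<in> O_tilde n m" and m: "m \<in> frac_nats T" and n: "n \<in> frac_nats T"
  shows "bullet m m n x z \<in> O_tilde n m"
proof -
  obtain x1 x2 x3 where x: "x = x1 + x2 + x3" "x1 \<in> O1 n m" "x2 \<in> O2 n m" "x3 \<in> O3 n m"
    using x unfolding O_tilde_def by (auto elim!: set_plus_elim)
  have "bullet m m n x3 z \<in> O_tilde n m"
  proof (rule bullet_span_left[OF x(4)[unfolded O3_def] subspace_O_tilde])
    fix y assume "y \<in> {bullet m p1 n (bullet p1 p2 n u x) v
        |u x v p1 p2. p1 \<in> frac_nats T \<and> p2 \<in> frac_nats T \<and> x \<in> O1 p2 p1}"
    then obtain u x' v p1 p2 where y: "y = bullet m p1 n (bullet p1 p2 n u x') v"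
      and p: "p1 \<in> frac_nats T" "p2 \<in> frac_nats T" and x': "x' \<in> O1 p2 p1" by blast
    show "bullet m m n y z \<in> O_tilde n m"
      unfolding y bullet_bullet_left[of m m n p1]
      using p m n x' O2_subset O3_subset
      by (intro subspace_add[OF subspace_O_tilde]) (blast intro: O3_I associator_in_O2)+
  qed
  then show ?thesis
    unfolding x(1) bullet_add_left
    using O1_bullet_left[OF x(2) m n] O2_bullet_left[OF x(3) m m n] O2_subset O3_subset
    by (blast intro: subspace_add[OF subspace_O_tilde])
qed

end

section \<open>Re-expansion of polynomials in the shifted variable\<close>

text \<open>The coefficient of (1+y)^l in the part of P of degree below K, obtained from y^t =
  ((1+y) - 1)^t. The exponent l is an integer because it arises from mode indices, which may fall
  outside the range of the powers that occur.\<close>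

definition shifted_coeff :: "complex fps \<Rightarrow> nat \<Rightarrow> int \<Rightarrow> complex" where
  "shifted_coeff P K l = (\<Sum>t<K. if l \<le> int t
     then fps_nth P t * ((-1) ^ nat (int t - l) * (of_nat t gchoose nat (int t - l))) else 0)"

text \<open>For l < 0 the binomial has a lower entry above t; for l >= K no t qualifies. These zeros
  will confine the products to finitely many exponents.\<close>

lemma shifted_coeff_eq_0: "l < 0 \<or> l \<ge> int K \<Longrightarrow> shifted_coeff P K l = 0"
proof -
  assume l: "l < 0 \<or> l \<ge> int K"
  have "(of_nat t gchoose nat (int t - l) :: complex) = 0" if "l < 0" for t
    using that binomial_eq_0[of t "nat (int t - l)"] by (simp flip: binomial_gbinomial)
  then show ?thesis
    using l unfolding shifted_coeff_def by (intro sum.neutral) auto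
qed

text \<open>P is a polynomial here, and 1 + y = e^x turns its expansion in powers of 1 + y into one
  in exponentials.\<close>

lemma fps_oo_exp_minus_one:
  assumes P: "\<And>i. i \<ge> K \<Longrightarrow> fps_nth P i = 0"
  shows "P oo (fps_exp 1 - 1) = (\<Sum>l<K. fps_const (shifted_coeff P K (int l)) * fps_exp (of_nat l))"
proof -
  have "fps_shift K P = 0" by (rule fps_ext) (simp add: P)
  then have "P oo (fps_exp 1 - 1) = (\<Sum>t<K. fps_const (fps_nth P t) * (fps_exp 1 - 1) ^ t)"
    by (subst fps_compose_split[of _ _ K]) simp_all
  also have "\<dots> = (\<Sum>t<K. \<Sum>l<K. if l \<le> t then fps_const (fps_nth P t * ((-1) ^ (t - l) * of_nat (t choose l))) * fps_exp (of_nat l) else 0)"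
  proof (rule sum.cong[OF refl])
    fix t assume t: "t \<in> {..<K}"
    have "(fps_exp 1 - 1 :: complex fps) ^ t = (fps_exp 1 + (- 1)) ^ t" by simp
    also have "\<dots> = (\<Sum>l\<le>t. of_nat (t choose l) * fps_exp 1 ^ l * (- 1) ^ (t - l))"
      by (rule binomial_ring)
    also have "\<dots> = (\<Sum>l\<le>t. fps_const ((-1) ^ (t - l) * of_nat (t choose l)) * fps_exp (of_nat l))"
    proof (rule sum.cong[OF refl])
      fix l
      have "fps_exp (1::complex) ^ l = fps_exp (of_nat l)"
        by (simp add: fps_exp_power_mult)
      moreover have "(- 1 :: complex fps) ^ (t - l) = fps_const ((-1) ^ (t - l))"
        by (simp flip: fps_const_power fps_const_neg fps_const_1_eq_1)
      ultimately show "of_nat (t choose l) * fps_exp 1 ^ l * (- 1) ^ (t - l) =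
          fps_const ((-1) ^ (t - l) * of_nat (t choose l)) * fps_exp (of_nat l :: complex)"
        by (simp add: mult_ac fps_of_nat[symmetric] flip: fps_const_mult)
    qed
    finally have "fps_const (fps_nth P t) * (fps_exp 1 - 1) ^ t =
      (\<Sum>l\<le>t. fps_const (fps_nth P t * ((-1) ^ (t - l) * of_nat (t choose l))) * fps_exp (of_nat l))"
      by (simp only: sum_distrib_left mult.assoc[symmetric] fps_const_mult)
    also have "\<dots> = (\<Sum>l\<in>{..<K} \<inter> {l. l \<le> t}. fps_const (fps_nth P t * ((-1) ^ (t - l) * of_nat (t choose l))) * fps_exp (of_nat l))"
      using t by (intro sum.cong) auto
    also have "\<dots> = (\<Sum>l<K. if l \<le> t then fps_const (fps_nth P t * ((-1) ^ (t - l) * of_nat (t choose l))) * fps_exp (of_nat l) else 0)"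
      by (subst sum.inter_restrict) simp_all
    finally show "fps_const (fps_nth P t) * (fps_exp 1 - 1) ^ t = \<dots>" .
  qed
  also have "\<dots> = (\<Sum>l<K. \<Sum>t<K. if l \<le> t then fps_const (fps_nth P t * ((-1) ^ (t - l) * of_nat (t choose l))) * fps_exp (of_nat l) else 0)"
    by (rule sum.swap)
  also have "\<dots> = (\<Sum>l<K. fps_const (shifted_coeff P K (int l)) * fps_exp (of_nat l))"
  proof (rule sum.cong[OF refl])
    fix l
    have "fps_const (shifted_coeff P K (int l)) = (\<Sum>t<K. if l \<le> t then fps_const (fps_nth P t * ((-1) ^ (t - l) * of_nat (t choose l))) else 0)"
    proof -
      have "shifted_coeff P K (int l) = (\<Sum>t<K. if l \<le> t then fps_nth P t * ((-1) ^ (t - l) * of_nat (t choose l)) else 0)"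
        unfolding shifted_coeff_def
      proof (rule sum.cong[OF refl])
        fix t
        have "(of_nat t gchoose nat (int t - int l) :: complex) = of_nat (t choose l)" if "l \<le> t"
          using that binomial_symmetric[of l t] by (simp add: nat_diff_distrib flip: binomial_gbinomial)
        then show "(if int l \<le> int t then fps_nth P t * ((-1) ^ nat (int t - int l) * (of_nat t gchoose nat (int t - int l))) else 0) =
            (if l \<le> t then fps_nth P t * ((-1) ^ (t - l) * of_nat (t choose l)) else 0)"
          by (simp add: nat_diff_distrib)
      qed
      then show ?thesis
        by (simp add: fps_eq_iff fps_sum_nth sum.neutral if_distrib[where f = "\<lambda>x. fps_nth x _"] cong: if_cong)
    qed
    then show "(\<Sum>t<K. if l \<le> t then fps_const (fps_nth P t * ((-1) ^ (t - l) * of_nat (t choose l))) * fps_exp (of_nat l) else 0) =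
        fps_const (shifted_coeff P K (int l)) * fps_exp (of_nat l)"
      by (simp add: sum_distrib_right if_distrib[where f = "\<lambda>x. x * _"] cong: if_cong)
  qed
  finally show ?thesis .
qed

text \<open>Put t = z + i. The limit K - 1 - z makes the last t equal to K - 1 whatever z is, so the
  cut in a bullet product falls exactly at the top of the polynomial; negative t contribute nothing
  because P is a power series.\<close>

lemma truncated_sum_reindex:
  fixes F :: "nat \<Rightarrow> int \<Rightarrow> complex"
  shows "(if int K - 1 - z \<ge> 0 then \<Sum>i\<le>nat (int K - 1 - z). F i (z + int i) * fls_nth (fps_to_fls P) (z + int i) else 0) =
    (\<Sum>t<K. if z \<le> int t then F (nat (int t - z)) (int t) * fps_nth P t else 0)"
proof -
  let ?H = "\<lambda>t. F (nat (t - z)) t * fls_nth (fps_to_fls P) t"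
  have "(if int K - 1 - z \<ge> 0 then \<Sum>i\<le>nat (int K - 1 - z). F i (z + int i) * fls_nth (fps_to_fls P) (z + int i) else 0) =
      (\<Sum>t\<in>{z..<int K}. ?H t)"
  proof (cases "int K - 1 - z \<ge> 0")
    case True
    have "(\<Sum>i\<le>nat (int K - 1 - z). F i (z + int i) * fls_nth (fps_to_fls P) (z + int i)) = (\<Sum>t\<in>{z..<int K}. ?H t)"
      by (rule sum.reindex_bij_witness[of _ "\<lambda>t. nat (t - z)" "\<lambda>i. z + int i"]) (use True in auto)
    with True show ?thesis by simp
  qed simp
  also have "\<dots> = (\<Sum>t\<in>int ` {..<K}. if z \<le> t then ?H t else 0)"
  proof (rule sum.mono_neutral_cong)
    show "?H t = 0" if "t \<in> {z..<int K} - int ` {..<K}" for t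
    proof -
      have "t < 0"
      proof (rule ccontr)
        assume "\<not> t < 0"
        with that have "t = int (nat t)" "nat t < K" by auto
        with that show False by blast
      qed
      then show ?thesis by simp
    qed
  qed auto
  also have "\<dots> = (\<Sum>t<K. if z \<le> int t then F (nat (int t - z)) (int t) * fps_nth P t else 0)"
    by (subst sum.reindex) (auto intro!: sum.cong)
  finally show ?thesis .
qed

text \<open>The binomials with upper entry t - k come from expanding y^t / y^k in descending powers
  of 1 + y; the alternating sum over j multiplies by y^k = ((1+y) - 1)^k again. Vandermonde's
  identity for k and t - k restores the coefficients of y^t.\<close>

lemma alternating_truncated_sum:
  "(\<Sum>j\<le>k. (-1) ^ j * of_nat (k choose j) *
     (if int K - 1 - (l + int j) \<ge> 0 then \<Sum>i\<le>nat (int K - 1 - (l + int j)).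
        ((-1) ^ i * (of_int (l + int j + int i - int k) gchoose i)) * fls_nth (fps_to_fls P) (l + int j + int i) else 0))
    = shifted_coeff P K l"
proof -
  have "(\<Sum>j\<le>k. (-1) ^ j * of_nat (k choose j) *
     (if int K - 1 - (l + int j) \<ge> 0 then \<Sum>i\<le>nat (int K - 1 - (l + int j)).
        ((-1) ^ i * (of_int (l + int j + int i - int k) gchoose i)) * fls_nth (fps_to_fls P) (l + int j + int i) else 0)) =
    (\<Sum>j\<le>k. (-1) ^ j * of_nat (k choose j) * (\<Sum>t<K. if l + int j \<le> int t then
       ((-1) ^ nat (int t - (l + int j)) * (of_int (int t - int k) gchoose nat (int t - (l + int j)))) * fps_nth P t else 0))"
    by (subst truncated_sum_reindex[where F = "\<lambda>i t. (-1) ^ i * (of_int (t - int k) gchoose i)"]) (rule refl)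
  also have "\<dots> = (\<Sum>t<K. \<Sum>j\<le>k. (-1) ^ j * of_nat (k choose j) * (if l + int j \<le> int t then
       ((-1) ^ nat (int t - (l + int j)) * (of_int (int t - int k) gchoose nat (int t - (l + int j)))) * fps_nth P t else 0))"
    unfolding sum_distrib_left by (rule sum.swap)
  also have "\<dots> = shifted_coeff P K l"
    unfolding shifted_coeff_def
  proof (rule sum.cong[OF refl])
    fix t
    show "(\<Sum>j\<le>k. (-1) ^ j * of_nat (k choose j) * (if l + int j \<le> int t then
       ((-1) ^ nat (int t - (l + int j)) * (of_int (int t - int k) gchoose nat (int t - (l + int j)))) * fps_nth P t else 0)) =
       (if l \<le> int t then fps_nth P t * ((-1) ^ nat (int t - l) * (of_nat t gchoose nat (int t - l))) else 0)"
    proof (cases "l \<le> int t")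
      case True
      define s where "s = nat (int t - l)"
      have s: "int t - l = int s" using True by (simp add: s_def)
      have "(\<Sum>j\<le>k. (-1) ^ j * of_nat (k choose j) * (if l + int j \<le> int t then
       ((-1) ^ nat (int t - (l + int j)) * (of_int (int t - int k) gchoose nat (int t - (l + int j)))) * fps_nth P t else 0)) =
       (\<Sum>j\<in>{..k} \<inter> {j. j \<le> s}. fps_nth P t * ((-1) ^ s * ((of_nat k gchoose j) * (of_int (int t - int k) gchoose (s - j)))))"
      proof (subst sum.inter_restrict, simp, rule sum.cong[OF refl])
        fix j
        have le: "l + int j \<le> int t \<longleftrightarrow> j \<le> s" using s by linarith
        have n: "nat (int t - (l + int j)) = s - j" using s by linarith
        have "(-1 :: complex) ^ j * (-1) ^ (s - j) = (-1) ^ s" if "j \<le> s"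
          using that by (simp flip: power_add)
        then show "(-1) ^ j * of_nat (k choose j) * (if l + int j \<le> int t then
           ((-1) ^ nat (int t - (l + int j)) * (of_int (int t - int k) gchoose nat (int t - (l + int j)))) * fps_nth P t else 0) =
           (if j \<in> {j. j \<le> s} then fps_nth P t * ((-1) ^ s * ((of_nat k gchoose j) * (of_int (int t - int k) gchoose (s - j)))) else 0)"
          unfolding le n binomial_gbinomial by (auto simp: mult_ac)
      qed
      \<comment> \<open>Terms with j > k may be added, as binom(k,j) vanishes there; the bound j <=
        s comes from the guard.\<close>
      also have "\<dots> = (\<Sum>j\<in>{0..s}. fps_nth P t * ((-1) ^ s * ((of_nat k gchoose j) * (of_int (int t - int k) gchoose (s - j)))))"
        by (intro sum.mono_neutral_left) (auto simp flip: binomial_gbinomial simp: binomial_eq_0)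
      also have "\<dots> = fps_nth P t * ((-1) ^ s * (\<Sum>j\<in>{0..s}. (of_nat k gchoose j) * (of_int (int t - int k) gchoose (s - j))))"
        by (simp only: sum_distrib_left)
      also have "(\<Sum>j\<in>{0..s}. (of_nat k gchoose j) * (of_int (int t - int k) gchoose (s - j))) = (of_nat t gchoose s :: complex)"
        by (subst gbinomial_Vandermonde) simp
      finally show ?thesis using True by (simp add: s_def)
    next
      case False
      then show ?thesis by (intro trans[OF sum.neutral]) auto
    qed
  qed
  finally show ?thesis .
qed

section \<open>Weak associativity modulo the relations\<close>

lemma floor_bar_unique:
  assumes n: "n = of_int z + of_nat b / of_nat T" and b: "b < T"
  shows "\<lfloor>n\<rfloor> = z" "bar T n = b"
proof -
  have T: "(of_nat T :: rat) > 0" using b by simp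
  have "of_nat b / of_nat T < (1 :: rat)" using b T by simp
  moreover have "of_nat b / of_nat T \<ge> (0 :: rat)" by simp
  ultimately show z: "\<lfloor>n\<rfloor> = z" unfolding n by (intro floor_unique) simp_all
  have "of_nat T * frac n = of_nat b" unfolding frac_def z using T by (simp add: n)
  then show "bar T n = b" by (simp add: bar_def)
qed

context vertex_algebra_aut
begin

text \<open>The element of V whose operator from degree n0 to degree n2 is the coefficient of x1^a
  in (x1 - x2)^k Y(u,x1) Y(v,x2); the exponent of x2 is then fixed by the degrees. The j-th summand
  passes through the intermediate degree n2 + k - a - j and is 0 when that degree is
  negative.\<close>

definition bullet_prod :: "nat \<Rightarrow> rat \<Rightarrow> rat \<Rightarrow> 'v \<Rightarrow> 'v \<Rightarrow> rat \<Rightarrow> 'v" where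
  "bullet_prod k n0 n2 u v a = (\<Sum>j\<le>k. ((-1) ^ j * of_nat (k choose j)) *s
     (if n2 + of_nat k - a - of_nat j \<ge> 0 then bullet n0 (n2 + of_nat k - a - of_nat j) n2 u v else 0))"

lemma bullet_prod_component_sum:
  "bullet_prod k n0 n2 u v a = (\<Sum>r<T. bullet_prod k n0 n2 (component r u) v a)"
proof -
  have "bullet_prod k n0 n2 u v a = (\<Sum>j\<le>k. \<Sum>r<T. ((-1) ^ j * of_nat (k choose j)) *s
     (if n2 + of_nat k - a - of_nat j \<ge> 0 then bullet n0 (n2 + of_nat k - a - of_nat j) n2 (component r u) v else 0))"
    unfolding bullet_prod_def
  proof (rule sum.cong[OF refl])
    fix j
    show "((-1) ^ j * of_nat (k choose j)) *s
     (if n2 + of_nat k - a - of_nat j \<ge> 0 then bullet n0 (n2 + of_nat k - a - of_nat j) n2 u v else 0) =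
      (\<Sum>r<T. ((-1) ^ j * of_nat (k choose j)) *s
     (if n2 + of_nat k - a - of_nat j \<ge> 0 then bullet n0 (n2 + of_nat k - a - of_nat j) n2 (component r u) v else 0))"
      unfolding scale_sum_right[symmetric]
      by (subst bullet_component_sum) simp
  qed
  then show ?thesis unfolding bullet_prod_def by (simp only: sum.swap[of _ "{..k}"])
qed

text \<open>\<open>res_Y_D\<close> raises the pole order by one at the price of replacing u by D u,
  which stays in the eigenspace. Dividing by b is possible because n0, n2 >= 0 make it
  positive.\<close>

lemma res_Y_in_O1:
  assumes r: "r < T" and n: "n0 \<in> frac_nats T" "n2 \<in> frac_nats T" and u: "u \<in> eigenspace r"
  shows "res_Y (res_exponent n0 r)
    (\<lfloor>n0\<rfloor> + \<lfloor>n2\<rfloor> + step_delta (bar T n0) r + step_delta (bar T n2) (T - r) + 1 + int j) u v \<in> O1 n2 n0"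
  using u
proof (induction j arbitrary: u)
  case 0
  then show ?case using diamond_in_O1[OF r 0] by (simp add: diamond_def)
next
  case (Suc j)
  define b where "b = \<lfloor>n0\<rfloor> + \<lfloor>n2\<rfloor> + step_delta (bar T n0) r + step_delta (bar T n2) (T - r) + 1 + int j"
  have "\<lfloor>n0\<rfloor> \<ge> 0" "\<lfloor>n2\<rfloor> \<ge> 0" using n by (auto simp: frac_nats_iff)
  moreover have "step_delta i l \<ge> 0" for i l by (simp add: step_delta_def)
  ultimately have b: "b > 0" unfolding b_def by (intro add_nonneg_pos add_pos_nonneg add_nonneg_nonneg) simp_all
  have "of_int b *s res_Y (res_exponent n0 r) (b + 1) u v \<in> O1 n2 n0"
    unfolding res_Y_D
    by (intro subspace_add[OF subspace_O1] subspace_scale[OF subspace_O1])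
      (use Suc.IH[OF D_eigenspace[OF Suc.prems]] Suc.IH[OF Suc.prems] in \<open>simp_all only: b_def\<close>)
  from subspace_scale[OF subspace_O1 this, of "1 / of_int b"]
  have "res_Y (res_exponent n0 r) (b + 1) u v \<in> O1 n2 n0" using b by simp
  moreover have "b + 1 = \<lfloor>n0\<rfloor> + \<lfloor>n2\<rfloor> + step_delta (bar T n0) r + step_delta (bar T n2) (T - r) + 1 + int (Suc j)"
    by (simp add: b_def)
  ultimately show ?case by simp
qed

section \<open>The relation for an eigenvector u, between fixed degrees n0 and n2\<close>

context
  fixes r :: nat and n0 n2 :: rat and u v :: 'v and k :: nat and M N :: int
  assumes r: "r < T" and n0: "n0 \<in> frac_nats T" and n2: "n2 \<in> frac_nats T"
    and u: "u \<in> eigenspace r" and k: "\<And>n. n \<ge> int k \<Longrightarrow> mode u n v = 0"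
    and M_eq: "M = \<lfloor>n0\<rfloor> + step_delta (bar T n0) r" and N_eq: "N = \<lfloor>n2\<rfloor> + step_delta (bar T n2) (T - r)"
begin

text \<open>These place the exponents a = l + 1 - M - r/T, 0 <= l < M + N + k, between -n0 - 2 and
  n2 + k + 1. In the bound on N, a delta equal to 1 means bar n2 + r >= T, so the extra 1 is
  absorbed by the fractional parts.\<close>

lemma MN_bounds: "0 \<le> M" "0 \<le> N" "of_int M \<le> n0 + 1" "of_int N - of_nat r / of_nat T \<le> n2" "of_nat r / of_nat T < (1::rat)"
proof -
  have T: "(of_nat T :: rat) > 0" using T_pos by simp
  show "of_nat r / of_nat T < (1::rat)" using r T by simp
  have "\<lfloor>n0\<rfloor> \<ge> 0" "\<lfloor>n2\<rfloor> \<ge> 0" using n0 n2 by (auto simp: frac_nats_iff)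
  then show "0 \<le> M" "0 \<le> N" by (simp_all add: M_eq N_eq step_delta_def)
  have "of_int (step_delta (bar T n0) r) \<le> (1 :: rat)" by (simp add: step_delta_def)
  then show "of_int M \<le> n0 + 1" using of_int_floor_le[of n0] unfolding M_eq of_int_add by linarith
  have d: "n2 = of_int \<lfloor>n2\<rfloor> + of_nat (bar T n2) / of_nat T"
    by (rule frac_ints_decompose) (use n2 T_pos in \<open>auto simp: frac_nats_iff\<close>)
  have "of_int (step_delta (bar T n2) (T - r)) - of_nat r / of_nat T \<le> (of_nat (bar T n2) / of_nat T :: rat)"
  proof (cases "T - r \<le> bar T n2")
    case True
    then have "(of_nat T :: rat) \<le> of_nat (bar T n2) + of_nat r"
      by (metis le_diff_conv of_nat_add of_nat_le_iff)
    then have "(1::rat) \<le> (of_nat (bar T n2) + of_nat r) / of_nat T" using T by simp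
    then show ?thesis using True by (simp add: step_delta_def add_divide_distrib)
  next
    case False
    have "- (of_nat r / of_nat T) \<le> (0::rat)" "(0::rat) \<le> of_nat (bar T n2) / of_nat T" by simp_all
    then have "- (of_nat r / of_nat T) \<le> (of_nat (bar T n2) / of_nat T :: rat)" by (rule order_trans)
    then show ?thesis using False by (simp add: step_delta_def)
  qed
  then show "of_int N - of_nat r / of_nat T \<le> n2"
    by (subst d) (simp add: N_eq)
qed

text \<open>The congruence in \<open>bullet_hom\<close> says that the intermediate degree minus n2
  lies in r/T + Z, hence that a lies in -r/T + Z; for other a each summand is 0 by
  definition.\<close>

lemma bullet_prod_eq_0:
  assumes a: "a \<in> frac_ints T" "\<And>l. a \<noteq> of_int l - of_nat r / of_nat T"
  shows "bullet_prod k' n0 n2 u v a = 0"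
proof -
  have "bullet n0 (n2 + of_nat k' - a - of_nat j) n2 u v = 0" for j
  proof -
    define n1 where n1: "n1 = n2 + of_nat k' - a - of_nat j"
    have "(int (bar T n1) - int (bar T n2)) mod int T \<noteq> int r mod int T"
    proof
      assume "(int (bar T n1) - int (bar T n2)) mod int T = int r mod int T"
      then have "int T dvd int (bar T n1) - int (bar T n2) - int r" by (simp add: mod_eq_dvd_iff)
      then obtain q where "int (bar T n1) - int (bar T n2) - int r = int T * q" by (rule dvdE)
      then have "(of_int (int (bar T n1)) :: rat) = of_int (int (bar T n2) + int r + int T * q)"
        by (simp only: of_int_eq_iff)
      then have q: "of_nat (bar T n1) / of_nat T = (of_nat (bar T n2) / of_nat T + of_nat r / of_nat T + of_int q :: rat)"
        using T_pos by (simp add: field_simps)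
      have "n1 \<in> frac_ints T"
        using a(1) n2 T_pos frac_ints_of_int[OF T_pos, of "int k'"] frac_ints_of_int[OF T_pos, of "int j"]
        unfolding n1 by (intro frac_ints_diff frac_ints_add) (auto simp: frac_nats_iff)
      from frac_ints_decompose[OF this T_pos] frac_ints_decompose[of n2 T] n2 T_pos
      have "n1 = of_int \<lfloor>n1\<rfloor> + of_nat (bar T n1) / of_nat T" "n2 = of_int \<lfloor>n2\<rfloor> + of_nat (bar T n2) / of_nat T"
        by (auto simp: frac_nats_iff)
      then have "a = of_int (\<lfloor>n2\<rfloor> + int k' - int j - \<lfloor>n1\<rfloor> - q) - of_nat r / of_nat T"
        using n1 q by simp
      then show False using a(2) by blast
    qed
    then have "bullet n0 n1 n2 u v = 0"
      by (simp add: bullet_eigenspace[OF u r] bullet_hom_def)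
    then show ?thesis unfolding n1 .
  qed
  then show ?thesis unfolding bullet_prod_def by (simp only: if_cancel scale_zero_right sum.neutral_const)
qed

context
  fixes \<phi> :: "'v \<Rightarrow> complex"
  assumes \<phi>: "Vector_Spaces.linear scale (*) \<phi>" and \<phi>_O1: "\<And>y. y \<in> O1 n2 n0 \<Longrightarrow> \<phi> y = 0"
begin

text \<open>\<open>res_poly\<close> is the image under the functional of (1+y)^c y^k Y(u,log(1+y))v
  with c = \<open>res_exponent n0 r\<close>, and \<open>res_deg\<close> is a strict bound for its
  degree.\<close>

abbreviation (input) "res_poly \<equiv> fps_binomial (res_exponent n0 r) * (exp_series \<phi> k u v oo fps_ln 1)"
abbreviation (input) "res_deg \<equiv> nat (M + N + int k)"

text \<open>The shift k - 1 in \<open>functional_res_Y\<close> makes the coefficient of index M + N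
  + k + j the residue of pole order M + N + 1 + j, where \<open>res_Y_in_O1\<close> starts to
  apply.\<close>

lemma res_poly_eq_0:
  assumes "i \<ge> res_deg"
  shows "fps_nth res_poly i = 0"
proof -
  define j where "j = i - res_deg"
  have i: "int i = M + N + int k + int j" using assms MN_bounds by (simp add: j_def)
  have "0 = \<phi> (res_Y (res_exponent n0 r) (M + N + 1 + int j) u v)"
    using \<phi>_O1[OF res_Y_in_O1[OF r n0 n2 u, of j v]] by (simp add: M_eq N_eq algebra_simps)
  also have "\<dots> = fls_nth (fps_to_fls res_poly) (M + N + 1 + int j + int k - 1)"
    by (rule functional_res_Y[OF \<phi> k])
  also have "M + N + 1 + int j + int k - 1 = int i" using i by simp
  finally show ?thesis by simp
qed

text \<open>Since a = l - \<open>res_exponent n0 r\<close>, the power x1^a corresponds to (1+y)^l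
  once the prefactor of \<open>res_poly\<close> is taken out. The integer part of the j-th
  intermediate degree is K - 1 - (l + j) with K = \<open>res_deg\<close>, exactly the limit in
  \<open>alternating_truncated_sum\<close>.\<close>

lemma functional_bullet_prod:
  assumes a: "a = of_int (l + 1 - M) - of_nat r / of_nat T"
  shows "\<phi> (bullet_prod k n0 n2 u v a) = shifted_coeff res_poly res_deg l"
proof -
  interpret \<phi>: Vector_Spaces.linear scale "(*)" \<phi> by (rule \<phi>)
  have T: "(of_nat T :: rat) > 0" using T_pos by simp
  have K: "int res_deg = M + N + int k" using MN_bounds by simp
  have "\<phi> (if n2 + of_nat k - a - of_nat j \<ge> 0 then bullet n0 (n2 + of_nat k - a - of_nat j) n2 u v else 0) =
     (if int res_deg - 1 - (l + int j) \<ge> 0 then \<Sum>i\<le>nat (int res_deg - 1 - (l + int j)).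
        ((-1) ^ i * (of_int (l + int j + int i - int k) gchoose i)) * fls_nth (fps_to_fls res_poly) (l + int j + int i) else 0)" for j
  proof -
    define n1 where "n1 = n2 + of_nat k - a - of_nat j"
    define p where "p = int res_deg - 1 - (l + int j)"
    define \<delta> where "\<delta> = step_delta (bar T n2) (T - r)"
    \<comment> \<open>This will be \<open>bar T n1\<close>: bar n2 + r, reduced by T when the delta
      is 1.\<close>
    define b where "b = nat (int (bar T n2) + int r - int T * \<delta>)"
    have b: "int b = int (bar T n2) + int r - int T * \<delta>" "b < T"
      using r bar_lt[of n2] by (auto simp: b_def \<delta>_def step_delta_def)
    have d: "n2 = of_int \<lfloor>n2\<rfloor> + of_nat (bar T n2) / of_nat T"
      by (rule frac_ints_decompose) (use n2 T_pos in \<open>auto simp: frac_nats_iff\<close>)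
    have "(of_int (int b) :: rat) = of_int (int (bar T n2) + int r - int T * \<delta>)"
      by (simp only: b)
    then have b': "of_nat b / of_nat T = (of_nat (bar T n2) / of_nat T + of_nat r / of_nat T - of_int \<delta> :: rat)"
      using T by (simp add: field_simps)
    have n1_eq: "n1 = of_int p + of_nat b / of_nat T"
      unfolding n1_def a b' p_def K by (subst d) (simp add: N_eq \<delta>_def)
    note fl = floor_bar_unique[OF n1_eq b(2)]
    have p0: "n1 \<ge> 0 \<longleftrightarrow> p \<ge> 0" using fl(1) by (metis zero_le_floor)
    have cond: "(int (bar T n1) - int (bar T n2)) mod int T = int r mod int T"
    proof -
      have "int (bar T n1) - int (bar T n2) = int r - int T * \<delta>" using b fl by simp
      then show ?thesis by (simp add: mod_diff_right_eq[symmetric])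
    qed
    have e: "\<lfloor>n0\<rfloor> + \<lfloor>n2\<rfloor> - \<lfloor>n1\<rfloor> + step_delta (bar T n0) r + step_delta (bar T n2) (T - r) = l + int j - int k + 1"
      unfolding fl(1) p_def K by (simp add: M_eq N_eq)
    have "\<phi> (bullet n0 n1 n2 u v) = (\<Sum>i\<le>nat p.
        ((-1) ^ i * (of_int (l + int j + int i - int k) gchoose i)) * fls_nth (fps_to_fls res_poly) (l + int j + int i))"
    proof -
      have "\<phi> (bullet n0 n1 n2 u v) = (\<Sum>i\<le>nat p.
        ((-1) ^ i * (of_int (l + int j - int k + 1 - 1 + int i) gchoose i)) *
          \<phi> (res_Y (res_exponent n0 r) (l + int j - int k + 1 + int i) u v))"
        unfolding bullet_eigenspace[OF u r] bullet_hom_def Let_def e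
        unfolding fl(1) if_P[OF cond] by (simp only: \<phi>.sum \<phi>.scale)
      also have "\<dots> = (\<Sum>i\<le>nat p.
        ((-1) ^ i * (of_int (l + int j + int i - int k) gchoose i)) * fls_nth (fps_to_fls res_poly) (l + int j + int i))"
      proof (rule sum.cong[OF refl])
        fix i
        have i: "l + int j - int k + 1 - 1 + int i = l + int j + int i - int k"
            "l + int j - int k + 1 + int i + int k - 1 = l + int j + int i" by simp_all
        show "((-1) ^ i * (of_int (l + int j - int k + 1 - 1 + int i) gchoose i)) *
          \<phi> (res_Y (res_exponent n0 r) (l + int j - int k + 1 + int i) u v) =
          ((-1) ^ i * (of_int (l + int j + int i - int k) gchoose i)) * fls_nth (fps_to_fls res_poly) (l + int j + int i)"
        proof -
          have "\<phi> (res_Y (res_exponent n0 r) (l + int j - int k + 1 + int i) u v) =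
              fls_nth (fps_to_fls res_poly) (l + int j - int k + 1 + int i + int k - 1)"
            by (rule functional_res_Y[OF \<phi> k])
          then show ?thesis by (simp only: i)
        qed
      qed
      finally show ?thesis .
    qed
    then show ?thesis unfolding n1_def[symmetric] p_def[symmetric] p0 by simp
  qed
  then have "\<phi> (bullet_prod k n0 n2 u v a) = (\<Sum>j\<le>k. (-1) ^ j * of_nat (k choose j) *
     (if int res_deg - 1 - (l + int j) \<ge> 0 then \<Sum>i\<le>nat (int res_deg - 1 - (l + int j)).
        ((-1) ^ i * (of_int (l + int j + int i - int k) gchoose i)) * fls_nth (fps_to_fls res_poly) (l + int j + int i) else 0))"
    unfolding bullet_prod_def by (simp only: \<phi>.sum \<phi>.scale)
  then show ?thesis by (simp only: alternating_truncated_sum)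
qed

lemma functional_bullet_prod_eq_0:
  assumes a: "a \<in> frac_ints T" and
    out: "\<And>l. a = of_int (l + 1 - M) - of_nat r / of_nat T \<Longrightarrow> l < 0 \<or> l \<ge> int res_deg"
  shows "\<phi> (bullet_prod k n0 n2 u v a) = 0"
proof (cases "\<exists>l. a = of_int (l + 1 - M) - of_nat r / of_nat T")
  case True
  then obtain l where l: "a = of_int (l + 1 - M) - of_nat r / of_nat T" by blast
  show ?thesis unfolding functional_bullet_prod[OF l] using out[OF l] by (rule shifted_coeff_eq_0)
next
  case False
  interpret \<phi>: Vector_Spaces.linear scale "(*)" \<phi> by (rule \<phi>)
  have "a \<noteq> of_int l - of_nat r / of_nat T" for l
  proof
    assume "a = of_int l - of_nat r / of_nat T"
    then have "a = of_int ((l - 1 + M) + 1 - M) - of_nat r / of_nat T" by simp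
    with False show False by blast
  qed
  with a have "bullet_prod k n0 n2 u v a = 0" by (intro bullet_prod_eq_0)
  then show ?thesis by (simp add: \<phi>.zero)
qed

text \<open>The set A is arbitrary because the support met later depends on the vector acted on.
  Only the exponents \<open>pos l\<close> contribute, and e^(pos l x) is e^(lx) divided by the
  prefactor e^(cx), c = \<open>res_exponent n0 r\<close>; so the sum is \<open>res_poly\<close> at y
  = e^x - 1 without its prefactor, which is \<open>exp_series\<close>.\<close>

lemma functional_phi_relation:
  assumes A: "finite A" "A \<subseteq> frac_ints T" "{a \<in> frac_ints T. - n0 - 2 \<le> a \<and> a \<le> n2 + of_nat k + 1} \<subseteq> A"
  shows "(\<Sum>a\<in>A. fls_nth (fps_to_fls (fps_exp (of_rat a))) s * \<phi> (bullet_prod k n0 n2 u v a)) =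
    \<phi> (Y_subst_coeff (fps_to_fls (fps_exp 1 - 1) ^ k) fls_X u v s)"
proof -
  define pos where "pos l = (of_int (int l + 1 - M) - of_nat r / of_nat T :: rat)" for l :: nat
  have T: "(of_nat T :: rat) > 0" using T_pos by simp
  have pos_frac: "pos l \<in> frac_ints T" for l
  proof -
    have "of_nat r / of_nat T \<in> frac_ints T" unfolding frac_ints_def by (rule range_eqI[of _ _ "int r"]) simp
    then show ?thesis unfolding pos_def by (intro frac_ints_diff frac_ints_of_int T_pos)
  qed
  have pos_A: "pos ` {..<res_deg} \<subseteq> A"
  proof
    fix a assume "a \<in> pos ` {..<res_deg}"
    then obtain l where l: "l < res_deg" "a = pos l" by auto
    have "(of_int (int l) :: rat) \<le> of_int (M + N + int k)" using l(1) by (simp only: of_int_le_iff)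
    moreover have "(of_int (int l) :: rat) \<ge> 0" by simp
    ultimately have "- n0 - 2 \<le> a" "a \<le> n2 + of_nat k + 1"
      using MN_bounds unfolding l(2) pos_def by (simp_all only: of_int_add of_int_diff of_int_of_nat_eq of_int_1)
    then show "a \<in> A" using A(3) pos_frac[of l] l(2) by blast
  qed
  have "(\<Sum>a\<in>A. fls_nth (fps_to_fls (fps_exp (of_rat a))) s * \<phi> (bullet_prod k n0 n2 u v a)) =
     (\<Sum>a\<in>pos ` {..<res_deg}. fls_nth (fps_to_fls (fps_exp (of_rat a))) s * \<phi> (bullet_prod k n0 n2 u v a))"
  proof (rule sum.mono_neutral_right[OF A(1) pos_A], rule ballI)
    fix a assume a: "a \<in> A - pos ` {..<res_deg}"
    have "\<phi> (bullet_prod k n0 n2 u v a) = 0"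
    proof (rule functional_bullet_prod_eq_0)
      show "a \<in> frac_ints T" using a A(2) by blast
      fix l assume l: "a = of_int (l + 1 - M) - of_nat r / of_nat T"
      show "l < 0 \<or> l \<ge> int res_deg"
      proof (rule ccontr)
        assume *: "\<not> (l < 0 \<or> l \<ge> int res_deg)"
        then have "a = pos (nat l)" by (simp add: l pos_def)
        moreover from * have "nat l < res_deg" by linarith
        ultimately have "a = pos (nat l)" "nat l < res_deg" .
        with a show False by blast
      qed
    qed
    then show "fls_nth (fps_to_fls (fps_exp (of_rat a))) s * \<phi> (bullet_prod k n0 n2 u v a) = 0" by simp
  qed
  also have "\<dots> = (\<Sum>l<res_deg. fls_nth (fps_to_fls (fps_exp (of_rat (pos l)))) s * shifted_coeff res_poly res_deg (int l))"
    by (subst sum.reindex) (auto intro!: inj_onI sum.cong simp: pos_def functional_bullet_prod[OF refl] simp del: of_int_diff of_int_add fps_to_fls_nth)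
  also have "\<dots> = fls_nth (fps_to_fls (\<Sum>l<res_deg. fps_const (shifted_coeff res_poly res_deg (int l)) * fps_exp (of_rat (pos l)))) s"
    by (simp add: fps_sum_nth mult.commute)
  also have "(\<Sum>l<res_deg. fps_const (shifted_coeff res_poly res_deg (int l)) * fps_exp (of_rat (pos l))) = exp_series \<phi> k u v"
  proof -
    have pos': "of_rat (pos l) = of_nat l + - res_exponent n0 r" for l
      by (simp add: pos_def res_exponent_def M_eq of_rat_diff of_rat_add of_rat_divide)
    \<comment> \<open>To y and back: the substitution of log(1+y) exposes the polynomial, that of
      e^x - 1 turns its powers of 1 + y into exponentials.\<close>
    have "exp_series \<phi> k u v = (exp_series \<phi> k u v oo fps_ln 1) oo (fps_exp 1 - 1)"
      by (subst fps_compose_assoc[symmetric]) (simp_all add: fps_ln_oo_exp_minus_one)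
    also have "exp_series \<phi> k u v oo fps_ln 1 = fps_binomial (- res_exponent n0 r) * res_poly"
      by (simp only: mult.assoc[symmetric] flip: fps_binomial_add_mult) simp
    also have "(fps_binomial (- res_exponent n0 r) * res_poly) oo (fps_exp 1 - 1) =
        fps_exp (- res_exponent n0 r) * (\<Sum>l<res_deg. fps_const (shifted_coeff res_poly res_deg (int l)) * fps_exp (of_nat l))"
    proof -
      have "res_poly oo (fps_exp 1 - 1) = (\<Sum>l<res_deg. fps_const (shifted_coeff res_poly res_deg (int l)) * fps_exp (of_nat l))"
        by (rule fps_oo_exp_minus_one) (rule res_poly_eq_0)
      moreover
      have "(A * B) oo (fps_exp 1 - 1) = (A oo (fps_exp 1 - 1)) * (B oo (fps_exp 1 - 1))" for A B :: "complex fps"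
        by (rule fps_compose_mult_distrib) simp
      from this[of "fps_binomial (- res_exponent n0 r)" res_poly] calculation show ?thesis by (simp only: fps_binomial_oo_exp_minus_one)
    qed
    also have "\<dots> = (\<Sum>l<res_deg. fps_const (shifted_coeff res_poly res_deg (int l)) * fps_exp (of_rat (pos l)))"
      unfolding sum_distrib_left
    proof (rule sum.cong[OF refl])
      fix l
      have "e * (c * x) = c * (x * e)" for e c x :: "complex fps" by (simp add: mult_ac)
      then show "fps_exp (- res_exponent n0 r) * (fps_const (shifted_coeff res_poly res_deg (int l)) * fps_exp (of_nat l)) =
          fps_const (shifted_coeff res_poly res_deg (int l)) * fps_exp (of_rat (pos l))"
        unfolding pos' fps_exp_add_mult .
    qed
    finally show ?thesis by (rule sym)
  qed
  also have "fls_nth (fps_to_fls (exp_series \<phi> k u v)) s = \<phi> (Y_subst_coeff (fps_to_fls (fps_exp 1 - 1) ^ k) fls_X u v s)"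
    by (rule functional_phi_coeff[OF \<phi> k, symmetric])
  finally show ?thesis .
qed

end

text \<open>Such exponents could only come from l < 0. The bound involves the source degree n0
  alone, neither n2 nor k, and this yields a lower bound for the powers of x1.\<close>

lemma eigenspace_bullet_prod_lower:
  assumes a: "a \<in> frac_ints T" "a < - n0 - 2"
  shows "bullet_prod k n0 n2 u v a \<in> O1 n2 n0"
proof (rule mem_subspaceI[OF subspace_O1])
  fix \<phi> assume \<phi>: "Vector_Spaces.linear scale (*) \<phi>" and 0: "\<And>y. y \<in> O1 n2 n0 \<Longrightarrow> \<phi> y = 0"
  show "\<phi> (bullet_prod k n0 n2 u v a) = 0"
  proof (rule functional_bullet_prod_eq_0[OF \<phi> 0 a(1)])
    fix l assume "a = of_int (l + 1 - M) - of_nat r / of_nat T"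
    then have "(of_int l :: rat) = a - 1 + of_int M + of_nat r / of_nat T" by simp
    then have "(of_int l :: rat) < of_int 0" using a(2) MN_bounds by simp
    then show "l < 0 \<or> l \<ge> int (nat (M + N + int k))" by (simp only: of_int_less_iff simp_thms)
  qed
qed

lemma eigenspace_phi_relation:
  assumes A: "finite A" "A \<subseteq> frac_ints T" "{a \<in> frac_ints T. - n0 - 2 \<le> a \<and> a \<le> n2 + of_nat k + 1} \<subseteq> A"
  shows "(\<Sum>a\<in>A. fls_nth (fps_to_fls (fps_exp (of_rat a))) s *s bullet_prod k n0 n2 u v a)
    - Y_subst_coeff (fps_to_fls (fps_exp 1 - 1) ^ k) fls_X u v s \<in> O1 n2 n0"
proof (rule mem_subspaceI[OF subspace_O1])
  fix \<phi> assume \<phi>: "Vector_Spaces.linear scale (*) \<phi>" and 0: "\<And>y. y \<in> O1 n2 n0 \<Longrightarrow> \<phi> y = 0"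
  interpret \<phi>: Vector_Spaces.linear scale "(*)" \<phi> by (rule \<phi>)
  show "\<phi> ((\<Sum>a\<in>A. fls_nth (fps_to_fls (fps_exp (of_rat a))) s *s bullet_prod k n0 n2 u v a)
    - Y_subst_coeff (fps_to_fls (fps_exp 1 - 1) ^ k) fls_X u v s) = 0"
    using functional_phi_relation[OF \<phi> 0 A, of s] by (simp only: \<phi>.diff \<phi>.sum \<phi>.scale diff_self)
qed

end

lemma bullet_prod_lower:
  assumes n: "n0 \<in> frac_nats T" "n2 \<in> frac_nats T"
    and k: "\<And>r n. r < T \<Longrightarrow> n \<ge> int k \<Longrightarrow> mode (component r u) n v = 0"
    and a: "a \<in> frac_ints T" "a < - n0 - 2"
  shows "bullet_prod k n0 n2 u v a \<in> O1 n2 n0"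
proof (subst bullet_prod_component_sum, rule subspace_sum[OF subspace_O1])
  fix r assume "r \<in> {..<T}"
  then have r: "r < T" by simp
  show "bullet_prod k n0 n2 (component r u) v a \<in> O1 n2 n0"
    by (rule eigenspace_bullet_prod_lower[OF r n component_in_eigenspace k[OF r] refl refl a])
qed

text \<open>Summation over the eigencomponents of u; \<open>k\<close> therefore has to bound the
  poles of all of them against v.\<close>

lemma phi_relation:
  assumes n: "n0 \<in> frac_nats T" "n2 \<in> frac_nats T"
    and k: "\<And>r n. r < T \<Longrightarrow> n \<ge> int k \<Longrightarrow> mode (component r u) n v = 0"
    and A: "finite A" "A \<subseteq> frac_ints T" "{a \<in> frac_ints T. - n0 - 2 \<le> a \<and> a \<le> n2 + of_nat k + 1} \<subseteq> A"
  shows "(\<Sum>a\<in>A. fls_nth (fps_to_fls (fps_exp (of_rat a))) s *s bullet_prod k n0 n2 u v a)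
    - Y_subst_coeff (fps_to_fls (fps_exp 1 - 1) ^ k) fls_X u v s \<in> O1 n2 n0"
proof -
  let ?Y = "\<lambda>u. Y_subst_coeff (fps_to_fls (fps_exp 1 - 1) ^ k) fls_X u v s"
  have Y: "?Y (\<Sum>r\<in>I. f r) = (\<Sum>r\<in>I. ?Y (f r))" if "finite I" for I and f :: "nat \<Rightarrow> 'v"
    using that
  proof (induction I)
    case empty
    then show ?case
      using Y_subst_coeff_combination[of 0 v 0 0 v 0 0 v fps_X "fps_to_fls (fps_exp 1 - 1) ^ k" s] mode_scale_left[of 0 0] by simp
  next
    case (insert r I)
    then show ?case
      using Y_subst_coeff_combination[of "f r + sum f I" v 1 "f r" v 1 "sum f I" v fps_X "fps_to_fls (fps_exp 1 - 1) ^ k" s]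
      by (simp add: mode_add_left)
  qed
  have "(\<Sum>a\<in>A. fls_nth (fps_to_fls (fps_exp (of_rat a))) s *s bullet_prod k n0 n2 u v a) - ?Y u =
     (\<Sum>r<T. (\<Sum>a\<in>A. fls_nth (fps_to_fls (fps_exp (of_rat a))) s *s bullet_prod k n0 n2 (component r u) v a) - ?Y (component r u))"
  proof -
    have "?Y u = (\<Sum>r<T. ?Y (component r u))"
      using Y[of "{..<T}" "\<lambda>r. component r u"] by (simp add: sum_component)
    moreover have "(\<Sum>a\<in>A. fls_nth (fps_to_fls (fps_exp (of_rat a))) s *s bullet_prod k n0 n2 u v a) =
        (\<Sum>r<T. \<Sum>a\<in>A. fls_nth (fps_to_fls (fps_exp (of_rat a))) s *s bullet_prod k n0 n2 (component r u) v a)"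
      by (subst bullet_prod_component_sum) (simp only: scale_sum_right sum.swap[of _ A])
    ultimately show ?thesis by (simp only: sum_subtractf)
  qed
  also have "\<dots> \<in> O1 n2 n0"
  proof (rule subspace_sum[OF subspace_O1])
    fix r assume "r \<in> {..<T}"
    then have r: "r < T" by simp
    show "(\<Sum>a\<in>A. fls_nth (fps_to_fls (fps_exp (of_rat a))) s *s bullet_prod k n0 n2 (component r u) v a)
        - ?Y (component r u) \<in> O1 n2 n0"
      by (rule eigenspace_phi_relation[OF r n component_in_eigenspace k[OF r] refl refl A])
  qed
  finally show ?thesis .
qed

end

section \<open>Quotients, direct sums and tensor products\<close>

lemma ring_of_type_algebra_simps [simp]:
  "carrier (ring_of_type_algebra :: 'a::ring_1 ring) = UNIV"
  "monoid.mult (ring_of_type_algebra :: 'a ring) = (*)"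
  "one (ring_of_type_algebra :: 'a ring) = 1"
  "zero (ring_of_type_algebra :: 'a ring) = 0"
  "add (ring_of_type_algebra :: 'a ring) = (+)"
  by (simp_all add: ring_of_type_algebra_def)

context vector_space
begin

lemma coset_eq_iff:
  assumes N: "subspace N"
  shows "x +o N = y +o N \<longleftrightarrow> x - y \<in> N"
proof
  show "x - y \<in> N" if "x +o N = y +o N"
    using that subspace_0[OF N] set_plus_imp_minus[of x y N] set_plus_intro2[of 0 N x] by simp
  assume xy: "x - y \<in> N"
  show "x +o N = y +o N"
  proof (intro Set.set_eqI iffI)
    fix z assume "z \<in> x +o N"
    then have "z - x \<in> N" by (rule set_plus_imp_minus)
    from subspace_add[OF N this xy] show "z \<in> y +o N" by (intro set_minus_imp_plus) simp
  next
    fix z assume "z \<in> y +o N"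
    then have "z - y \<in> N" by (rule set_plus_imp_minus)
    from subspace_diff[OF N this xy] show "z \<in> x +o N" by (intro set_minus_imp_plus) simp
  qed
qed

lemma coset_eqI: "subspace N \<Longrightarrow> x - y \<in> N \<Longrightarrow> x +o N = y +o N"
  by (simp add: coset_eq_iff)

lemma subspace_plus_self: "subspace N \<Longrightarrow> N + N = N"
  using subspace_add[of N] subspace_0[of N]
  by (auto simp: set_plus_def intro: bexI[of _ 0])

lemma coset_add: "subspace N \<Longrightarrow> (x +o N) + (y +o N) = (x + y) +o N"
  by (simp add: set_plus_rearrange subspace_plus_self)

text \<open>Maps between quotients are encoded as the image of a coset enlarged by the target
  subspace, which avoids choosing representatives; this evaluates every map of that form.\<close>

lemma coset_image_plus:
  assumes N: "subspace N" "subspace N'" and f: "\<And>x y. f (x + y) = f x + f y" "\<And>x. x \<in> N \<Longrightarrow> f x \<in> N'"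
  shows "f ` (x +o N) + N' = f x +o N'"
proof (intro Set.set_eqI iffI)
  fix z assume "z \<in> f ` (x +o N) + N'"
  then obtain n n' where z: "z = f (x + n) + n'" "n \<in> N" "n' \<in> N'"
    by (auto elim!: set_plus_elim simp: elt_set_plus_def)
  have "f n + n' \<in> N'" by (intro subspace_add[OF N(2)] f z)
  then show "z \<in> f x +o N'" by (auto simp: z f(1) elt_set_plus_def add.assoc)
next
  fix z assume "z \<in> f x +o N'"
  then obtain n' where z: "z = f x + n'" "n' \<in> N'" by (auto simp: elt_set_plus_def)
  have "x \<in> x +o N" using subspace_0[OF N(1)] by (force simp: elt_set_plus_def)
  with z show "z \<in> f ` (x +o N) + N'" by (auto intro!: set_plus_intro)
qed

lemma coset_scale: "subspace N \<Longrightarrow> scale c ` (x +o N) + N = scale c x +o N"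
  by (rule coset_image_plus) (simp_all add: scale_right_distrib subspace_scale)

end

lemma quotient_space_simps:
  "carrier (quotient_space s S N) = (\<lambda>x. x +o N) ` S"
  "zero (quotient_space s S N) = N"
  "add (quotient_space s S N) = (+)"
  "module.smult (quotient_space s S N) c B = s c ` B + N"
  by (simp_all add: quotient_space_def)

lemma (in vector_space) module_quotient_space:
  fixes s :: "complex \<Rightarrow> 'c::ab_group_add \<Rightarrow> 'c"
  assumes s: "vector_space s" and S: "module.subspace s S" and N: "module.subspace s N"
  shows "Module.module (ring_of_type_algebra :: complex ring) (quotient_space s S N)"
proof -
  interpret s: vector_space s by (rule s)
  have "N + (a +o N) = a +o N" "(a +o N) + N = a +o N" for a
    using s.coset_add[OF N, of 0 a] s.coset_add[OF N, of a 0] by simp_all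
  note q = quotient_space_simps s.coset_add[OF N] s.coset_scale[OF N] this
  show ?thesis
  proof (rule Module.moduleI)
    show "cring (ring_of_type_algebra :: complex ring)" by (rule cring_from_type_algebra)
    show "abelian_group (quotient_space s S N)"
    proof (rule abelian_groupI)
      show "\<exists>y\<in>carrier (quotient_space s S N). y \<oplus>\<^bsub>quotient_space s S N\<^esub> x = \<zero>\<^bsub>quotient_space s S N\<^esub>"
        if x: "x \<in> carrier (quotient_space s S N)" for x
      proof -
        obtain a where a: "x = a +o N" "a \<in> S" using x by (auto simp: q)
        have "- a \<in> S" using s.subspace_neg[OF S a(2)] .
        then show ?thesis by (intro bexI[of _ "(- a) +o N"]) (auto simp: q a)
      qed
      show "\<zero>\<^bsub>quotient_space s S N\<^esub> \<in> carrier (quotient_space s S N)"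
        using s.subspace_0[OF S] by (auto simp: q intro!: image_eqI[of _ _ 0])
    qed (auto simp: q add_ac s.subspace_add[OF S])
  qed (auto simp: q s.subspace_scale[OF S], auto simp: s.scale_left_distrib s.scale_right_distrib)
qed

lemma direct_sum_simps:
  "carrier (direct_sum I B) = {f \<in> \<Pi>\<^sub>E i\<in>I. carrier (B i). finite {i \<in> I. f i \<noteq> \<zero>\<^bsub>B i\<^esub>}}"
  "zero (direct_sum I B) = (\<lambda>i\<in>I. \<zero>\<^bsub>B i\<^esub>)"
  "f \<oplus>\<^bsub>direct_sum I B\<^esub> h = (\<lambda>i\<in>I. f i \<oplus>\<^bsub>B i\<^esub> h i)"
  "c \<odot>\<^bsub>direct_sum I B\<^esub> f = (\<lambda>i\<in>I. c \<odot>\<^bsub>B i\<^esub> f i)"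
  by (simp_all add: direct_sum_def)

lemma module_direct_sum:
  assumes B: "\<And>i. i \<in> I \<Longrightarrow> Module.module (ring_of_type_algebra :: complex ring) (B i)"
  shows "Module.module (ring_of_type_algebra :: complex ring) (direct_sum I B)"
proof -
  let ?W = "direct_sum I B"
  have ag: "abelian_group (B i)" if "i \<in> I" for i
    using B[OF that] by (rule Module.module.axioms(2))
  have am: "abelian_monoid (B i)" if "i \<in> I" for i
    using ag[OF that] by (rule abelian_group.axioms(1))
  have val: "f i \<in> carrier (B i)" if "f \<in> carrier ?W" "i \<in> I" for f i
    using that by (auto simp: direct_sum_simps)
  have closed: "(\<lambda>i\<in>I. h i) \<in> carrier ?W"
    if "\<And>i. i \<in> I \<Longrightarrow> h i \<in> carrier (B i)" "finite S" "\<And>i. i \<in> I \<Longrightarrow> i \<notin> S \<Longrightarrow> h i = \<zero>\<^bsub>B i\<^esub>" for h S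
    using that by (auto simp: direct_sum_simps intro: finite_subset[of _ S])
  have supp: "finite {i \<in> I. f i \<noteq> \<zero>\<^bsub>B i\<^esub>}" if "f \<in> carrier ?W" for f
    using that by (simp add: direct_sum_simps)
  have ext: "f = h" if "f \<in> extensional I" "h \<in> extensional I" "\<And>i. i \<in> I \<Longrightarrow> f i = h i" for f h
    using that by (rule extensionalityI)
  have extW: "f \<in> extensional I" if "f \<in> carrier ?W" for f
    using that by (simp add: direct_sum_simps PiE_def)
  show ?thesis
  proof (rule Module.moduleI)
    show "cring (ring_of_type_algebra :: complex ring)" by (rule cring_from_type_algebra)
    show "abelian_group ?W"
    proof (rule abelian_groupI)
      fix x y assume xy: "x \<in> carrier ?W" "y \<in> carrier ?W"
      show "x \<oplus>\<^bsub>?W\<^esub> y \<in> carrier ?W"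
        unfolding direct_sum_simps(3)
        by (rule closed[OF _ finite_UnI[OF supp[OF xy(1)] supp[OF xy(2)]]])
          (use xy in \<open>auto intro!: abelian_monoid.a_closed[OF am] val[OF xy(1)] val[OF xy(2)] simp: abelian_monoid.l_zero[OF am] abelian_monoid.zero_closed[OF am]\<close>)
      show "x \<oplus>\<^bsub>?W\<^esub> y = y \<oplus>\<^bsub>?W\<^esub> x"
        unfolding direct_sum_simps by (rule ext) (auto intro!: abelian_monoid.a_comm[OF am] val[OF xy(1)] val[OF xy(2)])
      fix z assume z: "z \<in> carrier ?W"
      show "(x \<oplus>\<^bsub>?W\<^esub> y) \<oplus>\<^bsub>?W\<^esub> z = x \<oplus>\<^bsub>?W\<^esub> (y \<oplus>\<^bsub>?W\<^esub> z)"
        unfolding direct_sum_simps by (rule ext) (auto intro!: abelian_monoid.a_assoc[OF am] val[OF xy(1)] val[OF xy(2)] val[OF z])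
    next
      show "\<zero>\<^bsub>?W\<^esub> \<in> carrier ?W"
        unfolding direct_sum_simps(2) by (rule closed[of _ "{}"]) (auto intro: abelian_monoid.zero_closed[OF am])
      fix x assume x: "x \<in> carrier ?W"
      show "\<zero>\<^bsub>?W\<^esub> \<oplus>\<^bsub>?W\<^esub> x = x"
        unfolding direct_sum_simps(2,3) by (rule ext) (auto intro!: abelian_monoid.l_zero[OF am] val[OF x] extW[OF x])
      show "\<exists>y\<in>carrier ?W. y \<oplus>\<^bsub>?W\<^esub> x = \<zero>\<^bsub>?W\<^esub>"
      proof
        show "(\<lambda>i\<in>I. \<ominus>\<^bsub>B i\<^esub> x i) \<in> carrier ?W"
          by (rule closed[OF _ supp[OF x]])
            (use val[OF x] in \<open>auto intro!: abelian_group.a_inv_closed[OF ag] abelian_group.minus_equality[OF ag] abelian_monoid.l_zero[OF am] abelian_monoid.zero_closed[OF am]\<close>)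
        show "(\<lambda>i\<in>I. \<ominus>\<^bsub>B i\<^esub> x i) \<oplus>\<^bsub>?W\<^esub> x = \<zero>\<^bsub>?W\<^esub>"
          unfolding direct_sum_simps(2,3) by (rule ext) (auto intro!: abelian_group.l_neg[OF ag] val[OF x])
      qed
    qed
    fix a b :: complex and x y assume xy: "x \<in> carrier ?W" "y \<in> carrier ?W"
    show "a \<odot>\<^bsub>?W\<^esub> x \<in> carrier ?W"
      unfolding direct_sum_simps(4)
      by (rule closed[OF _ supp[OF xy(1)]])
        (use val[OF xy(1)] in \<open>auto intro!: Module.module.smult_closed[OF B] Module.module.smult_r_null[OF B]\<close>)
    note laws = Module.module.smult_l_distr[OF B, simplified] Module.module.smult_r_distr[OF B, simplified]
      Module.module.smult_assoc1[OF B, simplified]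
    show "(a \<oplus>\<^bsub>ring_of_type_algebra\<^esub> b) \<odot>\<^bsub>?W\<^esub> x = a \<odot>\<^bsub>?W\<^esub> x \<oplus>\<^bsub>?W\<^esub> b \<odot>\<^bsub>?W\<^esub> x"
      unfolding direct_sum_simps by (rule ext) (auto simp: laws val[OF xy(1)] val[OF xy(2)])
    show "a \<odot>\<^bsub>?W\<^esub> (x \<oplus>\<^bsub>?W\<^esub> y) = a \<odot>\<^bsub>?W\<^esub> x \<oplus>\<^bsub>?W\<^esub> a \<odot>\<^bsub>?W\<^esub> y"
      unfolding direct_sum_simps by (rule ext) (auto simp: laws val[OF xy(1)] val[OF xy(2)])
    show "(a \<otimes>\<^bsub>ring_of_type_algebra\<^esub> b) \<odot>\<^bsub>?W\<^esub> x = a \<odot>\<^bsub>?W\<^esub> (b \<odot>\<^bsub>?W\<^esub> x)"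
      unfolding direct_sum_simps by (rule ext) (auto simp: laws val[OF xy(1)] val[OF xy(2)])
  next
    fix x assume x: "x \<in> carrier ?W"
    show "\<one>\<^bsub>ring_of_type_algebra\<^esub> \<odot>\<^bsub>?W\<^esub> x = x"
      unfolding direct_sum_simps by (rule ext) (auto simp: Module.module.smult_one[OF B, simplified] val[OF x] intro!: extW[OF x])
  qed
qed

text \<open>The linear extension of the map sending (x,u) to (h x, u), which is to induce h tensor
  id. It is linear for every function h, additive or not.\<close>

definition free_push :: "('x \<Rightarrow> 'y) \<Rightarrow> (('x \<times> 'u) \<Rightarrow>\<^sub>0 complex) \<Rightarrow> (('y \<times> 'u) \<Rightarrow>\<^sub>0 complex)" where
  "free_push h f = (\<Sum>p\<in>Poly_Mapping.keys f. free_scale (Poly_Mapping.lookup f p) (free_gen (h (fst p), snd p)))"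

text \<open>Cancellation makes the supports of f, g and f + g differ; sums over a common finite set
  can be compared.\<close>

lemma free_push_superset:
  assumes "finite A" "Poly_Mapping.keys f \<subseteq> A"
  shows "free_push h f = (\<Sum>p\<in>A. free_scale (Poly_Mapping.lookup f p) (free_gen (h (fst p), snd p)))"
  unfolding free_push_def using assms
  by (intro sum.mono_neutral_left) (auto simp: in_keys_iff)

lemma free_push_add: "free_push h (f + g) = free_push h f + free_push h g"
proof -
  let ?A = "Poly_Mapping.keys f \<union> Poly_Mapping.keys g"
  have "Poly_Mapping.keys (f + g) \<subseteq> ?A" by (rule Poly_Mapping.keys_add)
  then show ?thesis
    by (simp add: free_push_superset[of ?A] lookup_add free_space.scale_left_distrib sum.distrib)
qed

lemma free_push_scale: "free_push h (free_scale c f) = free_scale c (free_push h f)"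
proof -
  have "Poly_Mapping.keys (free_scale c f) \<subseteq> Poly_Mapping.keys f" by (auto simp: in_keys_iff)
  then show ?thesis
    by (simp add: free_push_superset[of "Poly_Mapping.keys f"] free_space.scale_sum_right)
qed

lemma free_push_diff: "free_push h (f - g) = free_push h f - free_push h g"
  using free_push_add[of h "f - g" g] by (simp add: algebra_simps)

lemma free_push_zero [simp]: "free_push h 0 = 0"
  by (simp add: free_push_def)

lemma free_push_gen [simp]: "free_push h (free_gen p) = free_gen (h (fst p), snd p)"
  by (simp add: free_push_def)

lemma keys_free_scale_subset: "Poly_Mapping.keys (free_scale c f) \<subseteq> Poly_Mapping.keys f"
  by (auto simp: in_keys_iff)

lemma subspace_keys: "free_space.subspace {f :: _ \<Rightarrow>\<^sub>0 complex. Poly_Mapping.keys f \<subseteq> S}"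
proof (rule free_space.subspaceI)
  fix f g :: "_ \<Rightarrow>\<^sub>0 complex" assume "f \<in> {f. Poly_Mapping.keys f \<subseteq> S}" "g \<in> {f. Poly_Mapping.keys f \<subseteq> S}"
  then show "f + g \<in> {f. Poly_Mapping.keys f \<subseteq> S}" using Poly_Mapping.keys_add[of f g] by auto
next
  fix c and f :: "_ \<Rightarrow>\<^sub>0 complex" assume "f \<in> {f. Poly_Mapping.keys f \<subseteq> S}"
  then show "free_scale c f \<in> {f. Poly_Mapping.keys f \<subseteq> S}" using keys_free_scale_subset[of c f] by auto
qed simp

lemma keys_free_push:
  assumes f: "Poly_Mapping.keys f \<subseteq> C \<times> S" and h: "\<And>x. x \<in> C \<Longrightarrow> h x \<in> C'"
  shows "Poly_Mapping.keys (free_push h f) \<subseteq> C' \<times> S"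
proof -
  have "free_push h f \<in> {f. Poly_Mapping.keys f \<subseteq> C' \<times> S}"
    unfolding free_push_def
  proof (intro free_space.subspace_sum[OF subspace_keys] free_space.subspace_scale[OF subspace_keys])
    fix p assume "p \<in> Poly_Mapping.keys f"
    with f have "p \<in> C \<times> S" by blast
    then show "free_gen (h (fst p), snd p) \<in> {f. Poly_Mapping.keys f \<subseteq> C' \<times> S}" using h by auto
  qed
  then show ?thesis by simp
qed

lemma free_push_cong:
  assumes "\<And>p. p \<in> Poly_Mapping.keys f \<Longrightarrow> h (fst p) = h' (fst p)"
  shows "free_push h f = free_push h' f"
  unfolding free_push_def using assms by (intro sum.cong) auto

lemma free_push_ident:
  assumes "\<And>p. p \<in> Poly_Mapping.keys f \<Longrightarrow> h (fst p) = fst p"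
  shows "free_push h f = f"
proof -
  have "free_push h f = (\<Sum>p\<in>Poly_Mapping.keys f. Poly_Mapping.single p (Poly_Mapping.lookup f p))"
    unfolding free_push_def using assms
    by (intro sum.cong) (auto intro!: poly_mapping_eqI simp: lookup_single when_def)
  also have "\<dots> = f"
    by (rule poly_mapping_eqI) (auto simp: lookup_sum lookup_single when_def in_keys_iff)
  finally show ?thesis .
qed

lemma free_push_free_push:
  "free_push h (free_push h' f) = free_push (h \<circ> h') f"
proof -
  have "free_push h (\<Sum>p\<in>A. free_scale (c p) (free_gen (h' (fst p), snd p))) =
      (\<Sum>p\<in>A. free_scale (c p) (free_gen (h (h' (fst p)), snd p)))" for A and c :: "_ \<Rightarrow> complex"
    by (induction A rule: infinite_finite_induct) (simp_all add: free_push_add free_push_scale)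
  then show ?thesis by (simp add: free_push_def[of h' f] free_push_def[of "h \<circ> h'" f])
qed

lemma subspace_tensor_relations: "free_space.subspace (tensor_relations A B r U l)"
  unfolding tensor_relations_def by (rule free_space.subspace_span)

lemma tensor_relations_add_left:
    "x \<in> carrier B \<Longrightarrow> y \<in> carrier B \<Longrightarrow> u \<in> carrier U \<Longrightarrow>
      free_gen (x \<oplus>\<^bsub>B\<^esub> y, u) - free_gen (x, u) - free_gen (y, u) \<in> tensor_relations A B r U l"
  and tensor_relations_add_right:
    "x \<in> carrier B \<Longrightarrow> u \<in> carrier U \<Longrightarrow> w \<in> carrier U \<Longrightarrow>
      free_gen (x, u \<oplus>\<^bsub>U\<^esub> w) - free_gen (x, u) - free_gen (x, w) \<in> tensor_relations A B r U l"
  and tensor_relations_smult_left: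
    "x \<in> carrier B \<Longrightarrow> u \<in> carrier U \<Longrightarrow>
      free_gen (c \<odot>\<^bsub>B\<^esub> x, u) - free_scale c (free_gen (x, u)) \<in> tensor_relations A B r U l"
  and tensor_relations_smult_right:
    "x \<in> carrier B \<Longrightarrow> u \<in> carrier U \<Longrightarrow>
      free_gen (x, c \<odot>\<^bsub>U\<^esub> u) - free_scale c (free_gen (x, u)) \<in> tensor_relations A B r U l"
  and tensor_relations_balanced:
    "x \<in> carrier B \<Longrightarrow> a \<in> carrier A \<Longrightarrow> u \<in> carrier U \<Longrightarrow>
      free_gen (r x a, u) - free_gen (x, l a u) \<in> tensor_relations A B r U l"
  unfolding tensor_relations_def by (rule free_space.span_base; blast)+

text \<open>A linear map that commutes with the right actions sends each of the five kinds of
  generators to one of the same kind; this is the well-definedness of h tensor id.\<close>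

lemma free_push_tensor_relations:
  assumes f: "f \<in> tensor_relations A B r U l"
    and closed: "\<And>x. x \<in> carrier B \<Longrightarrow> h x \<in> carrier B'"
    and add: "\<And>x y. x \<in> carrier B \<Longrightarrow> y \<in> carrier B \<Longrightarrow> h (x \<oplus>\<^bsub>B\<^esub> y) = h x \<oplus>\<^bsub>B'\<^esub> h y"
    and smult: "\<And>c x. x \<in> carrier B \<Longrightarrow> h (c \<odot>\<^bsub>B\<^esub> x) = c \<odot>\<^bsub>B'\<^esub> h x"
    and ract: "\<And>x a. x \<in> carrier B \<Longrightarrow> a \<in> carrier A \<Longrightarrow> h (r x a) = r' (h x) a"
  shows "free_push h f \<in> tensor_relations A B' r' U l"
  using f unfolding tensor_relations_def[of A B]
proof (induction rule: free_space.span_induct_alt)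
  case base
  show ?case by (simp add: free_space.subspace_0[OF subspace_tensor_relations])
next
  case (step c f g)
  have "free_push h f \<in> tensor_relations A B' r' U l"
    using step(1)
    by (elim UnE CollectE exE conjE)
      (simp_all add: free_push_diff free_push_scale add smult ract closed tensor_relations_add_left
        tensor_relations_add_right tensor_relations_smult_left tensor_relations_smult_right tensor_relations_balanced)
  then show ?case
    using step(2) by (simp add: free_push_add free_push_scale
        free_space.subspace_add[OF subspace_tensor_relations] free_space.subspace_scale[OF subspace_tensor_relations])
qed

section \<open>The module structure\<close>

text \<open>Reduces a linear relation between induced maps to pure tensors, where it is required
  only modulo N.\<close>

lemma free_push_combination:
  assumes N: "free_space.subspace N" and f: "Poly_Mapping.keys f \<subseteq> C \<times> S"
    and gen: "\<And>x u. x \<in> C \<Longrightarrow> u \<in> S \<Longrightarrow>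
      free_gen (h x, u) - free_scale c (free_gen (h1 x, u)) - free_scale d (free_gen (h2 x, u)) \<in> N"
  shows "free_push h f - free_scale c (free_push h1 f) - free_scale d (free_push h2 f) \<in> N"
proof -
  have "free_push h f - free_scale c (free_push h1 f) - free_scale d (free_push h2 f) =
     (\<Sum>p\<in>Poly_Mapping.keys f. free_scale (Poly_Mapping.lookup f p)
        (free_gen (h (fst p), snd p) - free_scale c (free_gen (h1 (fst p), snd p)) - free_scale d (free_gen (h2 (fst p), snd p))))"
    unfolding free_push_def free_space.scale_sum_right sum_subtractf[symmetric]
    by (intro sum.cong) (simp_all add: free_space.scale_right_diff_distrib mult.commute)
  also have "\<dots> \<in> N"
    using f by (intro free_space.subspace_sum[OF N] free_space.subspace_scale[OF N] gen) auto
  finally show ?thesis .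
qed

lemma direct_sum_finsum:
  assumes B: "\<And>i. i \<in> I \<Longrightarrow> Module.module (ring_of_type_algebra :: complex ring) (B i)"
    and A: "finite A" "\<And>a. a \<in> A \<Longrightarrow> h a \<in> carrier (direct_sum I B)" and i: "i \<in> I"
  shows "(\<Oplus>\<^bsub>direct_sum I B\<^esub>a\<in>A. h a) i = (\<Oplus>\<^bsub>B i\<^esub>a\<in>A. h a i)"
proof -
  interpret W: Module.module "ring_of_type_algebra :: complex ring" "direct_sum I B"
    by (rule module_direct_sum[OF B])
  interpret Bi: Module.module "ring_of_type_algebra :: complex ring" "B i"
    by (rule B[OF i])
  have val: "w i \<in> carrier (B i)" if "w \<in> carrier (direct_sum I B)" for w
    using that i by (auto simp: direct_sum_simps)
  show ?thesis
    using A
  proof (induction A)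
    case empty
    show ?case using i by (simp add: direct_sum_simps)
  next
    case (insert a A)
    have ha: "h a \<in> carrier (direct_sum I B)" and hA: "h \<in> A \<rightarrow> carrier (direct_sum I B)"
      using insert.prems by auto
    have "(\<Oplus>\<^bsub>direct_sum I B\<^esub>a\<in>insert a A. h a) = h a \<oplus>\<^bsub>direct_sum I B\<^esub> (\<Oplus>\<^bsub>direct_sum I B\<^esub>a\<in>A. h a)"
      by (rule W.finsum_insert[OF insert.hyps hA ha])
    moreover have "(\<Oplus>\<^bsub>B i\<^esub>a\<in>insert a A. h a i) = h a i \<oplus>\<^bsub>B i\<^esub> (\<Oplus>\<^bsub>B i\<^esub>a\<in>A. h a i)"
      by (rule Bi.finsum_insert[OF insert.hyps]) (use ha hA val in auto)
    ultimately show ?case using insert.IH insert.prems i by (simp add: direct_sum_simps(3))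
  qed
qed

lemma finite_frac_ints_interval:
  assumes "T \<ge> 1"
  shows "finite {a \<in> frac_ints T. l \<le> a \<and> a \<le> h}"
proof (rule finite_subset)
  have T: "(of_nat T :: rat) > 0" using assms by simp
  show "{a \<in> frac_ints T. l \<le> a \<and> a \<le> h} \<subseteq> (\<lambda>k. of_int k / of_nat T) ` {\<lceil>l * of_nat T\<rceil>..\<lfloor>h * of_nat T\<rfloor>}"
    using T by (auto simp: frac_ints_def ceiling_le_iff le_floor_iff field_simps)
qed simp

section \<open>Left multiplication between the tensor products of fixed degree\<close>

context vertex_algebra_aut
begin

lemma A_bimod_simps:
  "carrier (A_bimod n m) = range (\<lambda>x. x +o O_tilde n m)"
  "Xa \<oplus>\<^bsub>A_bimod n m\<^esub> Y = Xa + Y"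
  "c \<odot>\<^bsub>A_bimod n m\<^esub> Xa = scale c ` Xa + O_tilde n m"
  by (simp_all add: A_bimod_def quotient_space_simps)

lemma carrier_A_alg: "carrier (A_alg m) = range (\<lambda>x. x +o O1 m m)"
  by (simp add: A_alg_def quotient_space_simps)

definition bimod_op :: "rat \<Rightarrow> rat \<Rightarrow> rat \<Rightarrow> 'v \<Rightarrow> 'v set \<Rightarrow> 'v set" where
  "bimod_op m n q x Xa = bullet m n q x ` Xa + O_tilde q m"

lemma bimod_op_coset:
  assumes "m \<in> frac_nats T" "n \<in> frac_nats T" "q \<in> frac_nats T"
  shows "bimod_op m n q x (v +o O_tilde n m) = bullet m n q x v +o O_tilde q m"
  unfolding bimod_op_def
  by (rule coset_image_plus[OF subspace_O_tilde subspace_O_tilde])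
    (simp_all add: bullet_add_right O_tilde_bullet_right assms)

text \<open>Changing x costs a product with an element of \<open>O_tilde\<close> on the left,
  changing z one with an element of \<open>O1\<close> on the right. Both stay in
  \<open>O_tilde\<close>, so the union runs over a single coset.\<close>

lemma A_right_act_coset:
  assumes m: "m \<in> frac_nats T" and n: "n \<in> frac_nats T"
  shows "A_right_act n m (x +o O_tilde n m) (z +o O1 m m) = bullet m m n x z +o O_tilde n m"
proof -
  have "bullet m m n x' z' +o O_tilde n m = bullet m m n x z +o O_tilde n m"
    if x': "x' \<in> x +o O_tilde n m" and z': "z' \<in> z +o O1 m m" for x' z'
  proof (rule coset_eqI[OF subspace_O_tilde])
    have "bullet m m n x' z' - bullet m m n x z = bullet m m n (x' - x) z' + bullet m m n x (z' - z)"
      by (simp add: bullet_diff_left bullet_diff_right)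
    also have "\<dots> \<in> O_tilde n m"
      using O_tilde_bullet_left[OF set_plus_imp_minus[OF x'] m n] O1_bullet_right[OF set_plus_imp_minus[OF z'] m m n]
      by (rule subspace_add[OF subspace_O_tilde])
    finally show "bullet m m n x' z' - bullet m m n x z \<in> O_tilde n m" .
  qed
  moreover have "x \<in> x +o O_tilde n m" "z \<in> z +o O1 m m"
    using set_plus_intro2[OF subspace_0[OF subspace_O_tilde], of x] set_plus_intro2[OF subspace_0[OF subspace_O1], of z] by simp_all
  ultimately show ?thesis unfolding A_right_act_def by blast
qed

abbreviation (input) M_relations where
  "M_relations m U act n \<equiv> tensor_relations (A_alg m) (A_bimod n m) (A_right_act n m) U act"

lemma M_part_simps:
  "carrier (M_part m U act n) = (\<lambda>f. f +o M_relations m U act n) ` {f. Poly_Mapping.keys f \<subseteq> carrier (A_bimod n m) \<times> carrier U}"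
  "zero (M_part m U act n) = M_relations m U act n"
  "add (M_part m U act n) = (+)"
  "module.smult (M_part m U act n) c Xa = free_scale c ` Xa + M_relations m U act n"
  by (simp_all add: M_part_def tensor_product_def quotient_space_simps)

lemma module_M_part: "Module.module (ring_of_type_algebra :: complex ring) (M_part m U act n)"
  unfolding M_part_def tensor_product_def
  by (rule module_quotient_space[OF free_space.vector_space_axioms subspace_keys subspace_tensor_relations])

definition tensor_op :: "rat \<Rightarrow> (complex, 'u) module \<Rightarrow> ('v set \<Rightarrow> 'u \<Rightarrow> 'u) \<Rightarrow> rat \<Rightarrow> rat \<Rightarrow> 'v \<Rightarrow>
    (('v set \<times> 'u) \<Rightarrow>\<^sub>0 complex) set \<Rightarrow> (('v set \<times> 'u) \<Rightarrow>\<^sub>0 complex) set" where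
  "tensor_op m U act n q x Xa = free_push (bimod_op m n q x) ` Xa + M_relations m U act q"

text \<open>Given by its value in the target degree q: from q = n - p - 1 the source degree is n = q
  + p + 1, and a negative source contributes 0. Restriction to \<open>frac_nats T\<close> keeps the
  families extensional.\<close>

definition M_op :: "rat \<Rightarrow> (complex, 'u) module \<Rightarrow> ('v set \<Rightarrow> 'u \<Rightarrow> 'u) \<Rightarrow> 'v \<Rightarrow> rat \<Rightarrow>
    (rat \<Rightarrow> (('v set \<times> 'u) \<Rightarrow>\<^sub>0 complex) set) \<Rightarrow> rat \<Rightarrow> (('v set \<times> 'u) \<Rightarrow>\<^sub>0 complex) set" where
  "M_op m U act u p f = (\<lambda>q\<in>frac_nats T.
     if q + p + 1 \<ge> 0 then tensor_op m U act (q + p + 1) q u (f (q + p + 1)) else \<zero>\<^bsub>M_part m U act q\<^esub>)"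

context
  fixes m :: rat and U :: "(complex, 'u) module" and act :: "'v set \<Rightarrow> 'u \<Rightarrow> 'u"
  assumes m: "m \<in> frac_nats T" and act: "algebra_left_module (A_alg m) U act"
begin

abbreviation (input) "Rel n \<equiv> M_relations m U act n"
abbreviation (input) "MP n \<equiv> M_part m U act n"
abbreviation (input) "Op n q x Xa \<equiv> tensor_op m U act n q x Xa"

lemmas subspace_Rel = subspace_tensor_relations

lemma MP_cases:
  assumes "Xa \<in> carrier (MP n)"
  obtains f where "Xa = f +o Rel n" "Poly_Mapping.keys f \<subseteq> carrier (A_bimod n m) \<times> carrier U"
  using assms by (auto simp: M_part_simps)

lemma MP_I: "Poly_Mapping.keys f \<subseteq> carrier (A_bimod n m) \<times> carrier U \<Longrightarrow> f +o Rel n \<in> carrier (MP n)"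
  by (auto simp: M_part_simps)

lemma bimod_op_closed:
  assumes n: "n \<in> frac_nats T" and q: "q \<in> frac_nats T"
  shows "Xa \<in> carrier (A_bimod n m) \<Longrightarrow> bimod_op m n q x Xa \<in> carrier (A_bimod q m)"
  by (auto simp: A_bimod_simps bimod_op_coset[OF m n q])

text \<open>The condition that is not formal is compatibility of left multiplication with the right
  action of the algebra; the difference is an associator and lies in \<open>O2\<close>.\<close>

lemma tensor_op_coset:
  assumes n: "n \<in> frac_nats T" and q: "q \<in> frac_nats T"
  shows "Op n q x (f +o Rel n) = free_push (bimod_op m n q x) f +o Rel q"
  unfolding tensor_op_def
proof (rule free_space.coset_image_plus[OF subspace_Rel subspace_Rel free_push_add])
  fix f assume "f \<in> Rel n"
  then show "free_push (bimod_op m n q x) f \<in> Rel q"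
  proof (rule free_push_tensor_relations)
    show "bimod_op m n q x Xa \<in> carrier (A_bimod q m)" if "Xa \<in> carrier (A_bimod n m)" for Xa
      using that by (rule bimod_op_closed[OF n q])
    show "bimod_op m n q x (Xa \<oplus>\<^bsub>A_bimod n m\<^esub> Y) = bimod_op m n q x Xa \<oplus>\<^bsub>A_bimod q m\<^esub> bimod_op m n q x Y"
      if "Xa \<in> carrier (A_bimod n m)" "Y \<in> carrier (A_bimod n m)" for Xa Y
      using that by (auto simp: A_bimod_simps bimod_op_coset[OF m n q] coset_add[OF subspace_O_tilde] bullet_add_right)
    show "bimod_op m n q x (c \<odot>\<^bsub>A_bimod n m\<^esub> Xa) = c \<odot>\<^bsub>A_bimod q m\<^esub> bimod_op m n q x Xa"
      if "Xa \<in> carrier (A_bimod n m)" for c Xa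
      using that by (auto simp: A_bimod_simps bimod_op_coset[OF m n q] coset_scale[OF subspace_O_tilde] bullet_scale_right)
    fix Xa Z assume "Xa \<in> carrier (A_bimod n m)" "Z \<in> carrier (A_alg m)"
    then obtain v z where v: "Xa = v +o O_tilde n m" "Z = z +o O1 m m"
      by (auto simp: A_bimod_simps carrier_A_alg)
    have "bullet m m q (bullet m n q x v) z - bullet m n q x (bullet m m n v z) \<in> O_tilde q m"
      using associator_in_O2[OF m m n q, of x v z] O2_subset by (auto simp: associator_def)
    then show "bimod_op m n q x (A_right_act n m Xa Z) = A_right_act q m (bimod_op m n q x Xa) Z"
      unfolding v A_right_act_coset[OF m n] bimod_op_coset[OF m n q] A_right_act_coset[OF m q]
      by (intro sym[OF coset_eqI[OF subspace_O_tilde]])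
  qed
qed

lemma tensor_op_closed:
  assumes n: "n \<in> frac_nats T" and q: "q \<in> frac_nats T" and Xa: "Xa \<in> carrier (MP n)"
  shows "Op n q x Xa \<in> carrier (MP q)"
  using Xa by (rule MP_cases)
    (simp add: tensor_op_coset[OF n q] MP_I keys_free_push bimod_op_closed[OF n q])

lemma MP_coset_simps:
  "(f +o Rel n) \<oplus>\<^bsub>MP n\<^esub> (f' +o Rel n) = (f + f') +o Rel n"
  "c \<odot>\<^bsub>MP n\<^esub> (f +o Rel n) = free_scale c f +o Rel n"
  by (simp_all add: M_part_simps free_space.coset_add[OF subspace_Rel] free_space.coset_scale[OF subspace_Rel])

lemma tensor_op_add_right:
  assumes n: "n \<in> frac_nats T" and q: "q \<in> frac_nats T" and Xa: "Xa \<in> carrier (MP n)" "Y \<in> carrier (MP n)"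
  shows "Op n q x (Xa \<oplus>\<^bsub>MP n\<^esub> Y) = Op n q x Xa \<oplus>\<^bsub>MP q\<^esub> Op n q x Y"
  using Xa by (elim MP_cases) (simp add: MP_coset_simps tensor_op_coset[OF n q] free_push_add)

lemma tensor_op_smult_right:
  assumes n: "n \<in> frac_nats T" and q: "q \<in> frac_nats T" and Xa: "Xa \<in> carrier (MP n)"
  shows "Op n q x (c \<odot>\<^bsub>MP n\<^esub> Xa) = c \<odot>\<^bsub>MP q\<^esub> Op n q x Xa"
  using Xa by (elim MP_cases) (simp add: MP_coset_simps tensor_op_coset[OF n q] free_push_scale)

lemma tensor_op_zero_right:
  assumes n: "n \<in> frac_nats T" and q: "q \<in> frac_nats T"
  shows "Op n q x \<zero>\<^bsub>MP n\<^esub> = \<zero>\<^bsub>MP q\<^esub>"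
  using tensor_op_coset[OF n q, of x 0] by (simp add: M_part_simps)

lemma Rel_combination:
  assumes Xa: "Xa \<in> carrier (A_bimod q m)" "Y \<in> carrier (A_bimod q m)" and u: "u \<in> carrier U"
  shows "free_gen (c \<odot>\<^bsub>A_bimod q m\<^esub> Xa \<oplus>\<^bsub>A_bimod q m\<^esub> d \<odot>\<^bsub>A_bimod q m\<^esub> Y, u)
     - free_scale c (free_gen (Xa, u)) - free_scale d (free_gen (Y, u)) \<in> Rel q"
proof -
  let ?B = "A_bimod q m"
  have cl: "c \<odot>\<^bsub>?B\<^esub> Xa \<in> carrier ?B" "d \<odot>\<^bsub>?B\<^esub> Y \<in> carrier ?B"
    using Xa by (auto simp: A_bimod_simps coset_scale[OF subspace_O_tilde])
  have "free_gen (c \<odot>\<^bsub>?B\<^esub> Xa \<oplus>\<^bsub>?B\<^esub> d \<odot>\<^bsub>?B\<^esub> Y, u) - free_scale c (free_gen (Xa, u)) - free_scale d (free_gen (Y, u)) =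
     (free_gen (c \<odot>\<^bsub>?B\<^esub> Xa \<oplus>\<^bsub>?B\<^esub> d \<odot>\<^bsub>?B\<^esub> Y, u) - free_gen (c \<odot>\<^bsub>?B\<^esub> Xa, u) - free_gen (d \<odot>\<^bsub>?B\<^esub> Y, u))
     + (free_gen (c \<odot>\<^bsub>?B\<^esub> Xa, u) - free_scale c (free_gen (Xa, u)))
     + (free_gen (d \<odot>\<^bsub>?B\<^esub> Y, u) - free_scale d (free_gen (Y, u)))" by simp
  also have "\<dots> \<in> Rel q"
    by (intro free_space.subspace_add[OF subspace_Rel] tensor_relations_add_left tensor_relations_smult_left cl Xa u)
  finally show ?thesis .
qed

text \<open>The hypothesis is imposed only modulo \<open>O_tilde\<close>, so this yields linearity
  in x and, with c = d = 0, the vanishing of operators.\<close>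

lemma tensor_op_combination:
  assumes n: "n \<in> frac_nats T" and q: "q \<in> frac_nats T" and Xa: "Xa \<in> carrier (MP n)"
    and x: "\<And>v. bullet m n q x v - (c *s bullet m n q x1 v + d *s bullet m n q x2 v) \<in> O_tilde q m"
  shows "Op n q x Xa = c \<odot>\<^bsub>MP q\<^esub> Op n q x1 Xa \<oplus>\<^bsub>MP q\<^esub> d \<odot>\<^bsub>MP q\<^esub> Op n q x2 Xa"
proof -
  obtain f where f: "Xa = f +o Rel n" "Poly_Mapping.keys f \<subseteq> carrier (A_bimod n m) \<times> carrier U"
    using Xa by (rule MP_cases)
  have "free_push (bimod_op m n q x) f - free_scale c (free_push (bimod_op m n q x1) f)
      - free_scale d (free_push (bimod_op m n q x2) f) \<in> Rel q"
  proof (rule free_push_combination[OF subspace_Rel f(2)])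
    fix V u assume V: "V \<in> carrier (A_bimod n m)" and u: "u \<in> carrier U"
    have "bimod_op m n q x V = c \<odot>\<^bsub>A_bimod q m\<^esub> bimod_op m n q x1 V \<oplus>\<^bsub>A_bimod q m\<^esub> d \<odot>\<^bsub>A_bimod q m\<^esub> bimod_op m n q x2 V"
    proof -
      obtain v where v: "V = v +o O_tilde n m" using V by (auto simp: A_bimod_simps)
      show ?thesis
        unfolding v A_bimod_simps bimod_op_coset[OF m n q] coset_scale[OF subspace_O_tilde] coset_add[OF subspace_O_tilde]
        by (rule coset_eqI[OF subspace_O_tilde x])
    qed
    then show "free_gen (bimod_op m n q x V, u) - free_scale c (free_gen (bimod_op m n q x1 V, u))
      - free_scale d (free_gen (bimod_op m n q x2 V, u)) \<in> Rel q"
      using Rel_combination[OF bimod_op_closed[OF n q V] bimod_op_closed[OF n q V] u] by simp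
  qed
  then show ?thesis
    by (simp add: f(1) tensor_op_coset[OF n q] MP_coset_simps free_space.coset_eq_iff[OF subspace_Rel] diff_diff_eq)
qed

lemma tensor_op_eq_zero:
  assumes n: "n \<in> frac_nats T" and q: "q \<in> frac_nats T" and Xa: "Xa \<in> carrier (MP n)"
    and x: "\<And>v. bullet m n q x v \<in> O_tilde q m"
  shows "Op n q x Xa = \<zero>\<^bsub>MP q\<^esub>"
proof -
  interpret MP: Module.module "ring_of_type_algebra :: complex ring" "MP q" by (rule module_M_part)
  have "Op n q x Xa = 0 \<odot>\<^bsub>MP q\<^esub> Op n q x Xa \<oplus>\<^bsub>MP q\<^esub> 0 \<odot>\<^bsub>MP q\<^esub> Op n q x Xa"
    by (rule tensor_op_combination[OF n q Xa]) (simp add: x)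
  then show ?thesis
    using MP.smult_l_null[OF tensor_op_closed[OF n q Xa, of x]] by simp
qed

lemma tensor_op_add_left:
  assumes n: "n \<in> frac_nats T" and q: "q \<in> frac_nats T" and Xa: "Xa \<in> carrier (MP n)"
  shows "Op n q (x + y) Xa = Op n q x Xa \<oplus>\<^bsub>MP q\<^esub> Op n q y Xa"
proof -
  interpret MP: Module.module "ring_of_type_algebra :: complex ring" "MP q" by (rule module_M_part)
  have "Op n q (x + y) Xa = 1 \<odot>\<^bsub>MP q\<^esub> Op n q x Xa \<oplus>\<^bsub>MP q\<^esub> 1 \<odot>\<^bsub>MP q\<^esub> Op n q y Xa"
    by (rule tensor_op_combination[OF n q Xa]) (simp add: bullet_add_left subspace_0[OF subspace_O_tilde])
  then show ?thesis
    using MP.smult_one[OF tensor_op_closed[OF n q Xa, of x]] MP.smult_one[OF tensor_op_closed[OF n q Xa, of y]] by simp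
qed

lemma tensor_op_smult_left:
  assumes n: "n \<in> frac_nats T" and q: "q \<in> frac_nats T" and Xa: "Xa \<in> carrier (MP n)"
  shows "Op n q (c *s x) Xa = c \<odot>\<^bsub>MP q\<^esub> Op n q x Xa"
proof -
  interpret MP: Module.module "ring_of_type_algebra :: complex ring" "MP q" by (rule module_M_part)
  have "Op n q (c *s x) Xa = c \<odot>\<^bsub>MP q\<^esub> Op n q x Xa \<oplus>\<^bsub>MP q\<^esub> 0 \<odot>\<^bsub>MP q\<^esub> Op n q x Xa"
    by (rule tensor_op_combination[OF n q Xa]) (simp add: bullet_scale_left subspace_0[OF subspace_O_tilde])
  moreover have "c \<odot>\<^bsub>MP q\<^esub> Op n q x Xa \<in> carrier (MP q)"
    using MP.smult_closed[of c, OF _ tensor_op_closed[OF n q Xa, of x]] by simp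
  ultimately show ?thesis
    using MP.smult_l_null[OF tensor_op_closed[OF n q Xa, of x]] by simp
qed

lemma tensor_op_O1:
  assumes n: "n \<in> frac_nats T" and q: "q \<in> frac_nats T" and Xa: "Xa \<in> carrier (MP n)" and x: "x \<in> O1 q n"
  shows "Op n q x Xa = \<zero>\<^bsub>MP q\<^esub>"
  using O1_bullet_left[OF x n q] O3_subset by (intro tensor_op_eq_zero[OF n q Xa]) blast

text \<open>Again the difference is an associator in \<open>O2\<close>. The intermediate degree n1
  survives only as an index of the bullet product, so identities between operators become relations
  in V.\<close>

lemma tensor_op_tensor_op:
  assumes n0: "n0 \<in> frac_nats T" and n1: "n1 \<in> frac_nats T" and n2: "n2 \<in> frac_nats T" and Xa: "Xa \<in> carrier (MP n0)"
  shows "Op n1 n2 u (Op n0 n1 v Xa) = Op n0 n2 (bullet n0 n1 n2 u v) Xa"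
proof -
  obtain f where f: "Xa = f +o Rel n0" "Poly_Mapping.keys f \<subseteq> carrier (A_bimod n0 m) \<times> carrier U"
    using Xa by (rule MP_cases)
  have "bimod_op m n1 n2 u (bimod_op m n0 n1 v V) = bimod_op m n0 n2 (bullet n0 n1 n2 u v) V"
    if V: "V \<in> carrier (A_bimod n0 m)" for V
  proof -
    obtain c where c: "V = c +o O_tilde n0 m" using V by (auto simp: A_bimod_simps)
    have "bullet m n0 n2 (bullet n0 n1 n2 u v) c - bullet m n1 n2 u (bullet m n0 n1 v c) \<in> O_tilde n2 m"
      using associator_in_O2[OF m n0 n1 n2, of u v c] O2_subset by (auto simp: associator_def)
    then show ?thesis
      unfolding c bimod_op_coset[OF m n0 n1] bimod_op_coset[OF m n1 n2] bimod_op_coset[OF m n0 n2]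
      by (intro sym[OF coset_eqI[OF subspace_O_tilde]])
  qed
  then have "free_push (bimod_op m n1 n2 u) (free_push (bimod_op m n0 n1 v) f) = free_push (bimod_op m n0 n2 (bullet n0 n1 n2 u v)) f"
    unfolding free_push_free_push using f(2) by (intro free_push_cong) force
  then show ?thesis
    by (simp add: f(1) tensor_op_coset n0 n1 n2)
qed

lemma tensor_op_vac:
  assumes n: "n \<in> frac_nats T" and q: "q \<in> frac_nats T" and Xa: "Xa \<in> carrier (MP n)"
  shows "Op n q vac Xa = (if q = n then Xa else \<zero>\<^bsub>MP q\<^esub>)"
proof (cases "q = n")
  case True
  obtain f where f: "Xa = f +o Rel n" "Poly_Mapping.keys f \<subseteq> carrier (A_bimod n m) \<times> carrier U"
    using Xa by (rule MP_cases)
  have "bimod_op m n n vac V = V" if "V \<in> carrier (A_bimod n m)" for V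
    using that by (auto simp: A_bimod_simps bimod_op_coset[OF m n n] bullet_vac m n)
  then have "free_push (bimod_op m n n vac) f = f"
    using f(2) by (intro free_push_ident) force
  then show ?thesis by (simp add: True f(1) tensor_op_coset n)
next
  case False
  then show ?thesis
    using tensor_op_eq_zero[OF n q Xa, of vac] by (simp add: bullet_vac m n q subspace_0[OF subspace_O_tilde])
qed

section \<open>The mode operators on the direct sum and their elementary axioms\<close>

abbreviation (input) "W \<equiv> M_space m U act"
abbreviation (input) "modeM \<equiv> M_op m U act"
abbreviation (input) "in_degree \<equiv> direct_sum_inj (frac_nats T) (M_part m U act)"

interpretation MP: Module.module "ring_of_type_algebra :: complex ring" "M_part m U act n" for n
  by (rule module_M_part)

interpretation W: Module.module "ring_of_type_algebra :: complex ring" W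
  unfolding M_space_def by (rule module_direct_sum) (rule module_M_part)

lemma W_simps:
  "carrier W = {f \<in> \<Pi>\<^sub>E i\<in>frac_nats T. carrier (MP i). finite {i \<in> frac_nats T. f i \<noteq> \<zero>\<^bsub>MP i\<^esub>}}"
  "\<zero>\<^bsub>W\<^esub> = (\<lambda>i\<in>frac_nats T. \<zero>\<^bsub>MP i\<^esub>)"
  "f \<oplus>\<^bsub>W\<^esub> h = (\<lambda>i\<in>frac_nats T. f i \<oplus>\<^bsub>MP i\<^esub> h i)"
  "c \<odot>\<^bsub>W\<^esub> f = (\<lambda>i\<in>frac_nats T. c \<odot>\<^bsub>MP i\<^esub> f i)"
  by (simp_all add: M_space_def direct_sum_simps)

lemma W_val: "w \<in> carrier W \<Longrightarrow> q \<in> frac_nats T \<Longrightarrow> w q \<in> carrier (MP q)"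
  by (auto simp: W_simps)

lemma W_eqI:
  assumes "w \<in> carrier W" "w' \<in> carrier W" "\<And>q. q \<in> frac_nats T \<Longrightarrow> w q = w' q"
  shows "w = w'"
  using assms by (intro extensionalityI[of w "frac_nats T"]) (simp_all add: W_simps PiE_def)

lemma W_bound:
  assumes "w \<in> carrier W"
  obtains B where "\<And>n. n \<in> frac_nats T \<Longrightarrow> n > B \<Longrightarrow> w n = \<zero>\<^bsub>MP n\<^esub>"
proof
  let ?S = "{i \<in> frac_nats T. w i \<noteq> \<zero>\<^bsub>MP i\<^esub>}"
  have fin: "finite ?S" using assms by (simp add: W_simps)
  show "w n = \<zero>\<^bsub>MP n\<^esub>" if "n \<in> frac_nats T" "n > Max (insert 0 ?S)" for n
  proof (rule ccontr)
    assume "w n \<noteq> \<zero>\<^bsub>MP n\<^esub>"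
    with that(1) have "n \<le> Max (insert 0 ?S)" using fin by (intro Max_ge) auto
    with that(2) show False by simp
  qed
qed

lemma index_frac:
  assumes "q \<in> frac_nats T" "p \<in> frac_ints T" "q + p + 1 \<ge> 0"
  shows "q + p + 1 \<in> frac_nats T"
  using assms frac_ints_of_int[OF T_pos, of 1] by (auto simp: frac_nats_iff intro!: frac_ints_add)

lemma M_op_val:
  "q \<in> frac_nats T \<Longrightarrow> modeM u p f q =
     (if q + p + 1 \<ge> 0 then Op (q + p + 1) q u (f (q + p + 1)) else \<zero>\<^bsub>MP q\<^esub>)"
  by (simp add: M_op_def)

lemma M_op_closed:
  assumes p: "p \<in> frac_ints T" and w: "w \<in> carrier W"
  shows "modeM u p w \<in> carrier W"
proof -
  have val: "modeM u p w q \<in> carrier (MP q)" if q: "q \<in> frac_nats T" for q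
    using tensor_op_closed[OF index_frac[OF q p] q W_val[OF w index_frac[OF q p]]]
    by (simp add: M_op_val[OF q] MP.zero_closed)
  have "{q \<in> frac_nats T. modeM u p w q \<noteq> \<zero>\<^bsub>MP q\<^esub>} \<subseteq>
      (\<lambda>n. n - p - 1) ` {n \<in> frac_nats T. w n \<noteq> \<zero>\<^bsub>MP n\<^esub>}"
  proof
    fix q assume "q \<in> {q \<in> frac_nats T. modeM u p w q \<noteq> \<zero>\<^bsub>MP q\<^esub>}"
    then have q: "q \<in> frac_nats T" and nz: "modeM u p w q \<noteq> \<zero>\<^bsub>MP q\<^esub>" by auto
    from nz have ge: "q + p + 1 \<ge> 0" by (auto simp: M_op_val[OF q] split: if_splits)
    note n = index_frac[OF q p ge]
    have "w (q + p + 1) \<noteq> \<zero>\<^bsub>MP (q + p + 1)\<^esub>"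
      using nz ge tensor_op_zero_right[OF n q, of u] by (auto simp: M_op_val[OF q])
    then show "q \<in> (\<lambda>n. n - p - 1) ` {n \<in> frac_nats T. w n \<noteq> \<zero>\<^bsub>MP n\<^esub>}"
      using n by (intro image_eqI[of _ _ "q + p + 1"]) auto
  qed
  moreover have "finite {n \<in> frac_nats T. w n \<noteq> \<zero>\<^bsub>MP n\<^esub>}" using w by (simp add: W_simps)
  ultimately have "finite {q \<in> frac_nats T. modeM u p w q \<noteq> \<zero>\<^bsub>MP q\<^esub>}"
    by (rule finite_subset[OF _ finite_imageI])
  moreover have "modeM u p w \<in> extensional (frac_nats T)"
    by (simp add: M_op_def)
  ultimately show ?thesis
    unfolding W_simps(1) PiE_def using val by blast
qed

lemma M_op_combination_right:
  assumes p: "p \<in> frac_ints T" and w: "w \<in> carrier W" "w' \<in> carrier W"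
  shows "modeM u p (w \<oplus>\<^bsub>W\<^esub> w') = modeM u p w \<oplus>\<^bsub>W\<^esub> modeM u p w'"
    and "modeM u p (c \<odot>\<^bsub>W\<^esub> w) = c \<odot>\<^bsub>W\<^esub> modeM u p w"
proof -
  have sw: "c \<odot>\<^bsub>W\<^esub> w \<in> carrier W" if "w \<in> carrier W" for c w
    using W.smult_closed[of c w] that by simp
  show "modeM u p (w \<oplus>\<^bsub>W\<^esub> w') = modeM u p w \<oplus>\<^bsub>W\<^esub> modeM u p w'"
  proof (rule W_eqI)
    fix q assume q: "q \<in> frac_nats T"
    show "modeM u p (w \<oplus>\<^bsub>W\<^esub> w') q = (modeM u p w \<oplus>\<^bsub>W\<^esub> modeM u p w') q"
    proof (cases "q + p + 1 \<ge> 0")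
      case True
      note n = index_frac[OF q p True]
      show ?thesis
        using True q n tensor_op_add_right[OF n q W_val[OF w(1) n] W_val[OF w(2) n]]
        by (simp add: M_op_val[OF q] W_simps(3))
    qed (use q in \<open>simp add: M_op_val[OF q] W_simps(3)\<close>)
  qed (intro M_op_closed W.a_closed p w)+
  show "modeM u p (c \<odot>\<^bsub>W\<^esub> w) = c \<odot>\<^bsub>W\<^esub> modeM u p w"
  proof (rule W_eqI)
    fix q assume q: "q \<in> frac_nats T"
    show "modeM u p (c \<odot>\<^bsub>W\<^esub> w) q = (c \<odot>\<^bsub>W\<^esub> modeM u p w) q"
    proof (cases "q + p + 1 \<ge> 0")
      case True
      note n = index_frac[OF q p True]
      show ?thesis
        using True q n tensor_op_smult_right[OF n q W_val[OF w(1) n]]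
        by (simp add: M_op_val[OF q] W_simps(4))
    qed (use q MP.smult_r_null[of c q] in \<open>simp add: M_op_val[OF q] W_simps(4)\<close>)
  qed (intro M_op_closed sw p w)+
qed

lemma M_op_combination_left:
  assumes p: "p \<in> frac_ints T" and w: "w \<in> carrier W"
  shows "modeM (u + u') p w = modeM u p w \<oplus>\<^bsub>W\<^esub> modeM u' p w"
    and "modeM (c *s u) p w = c \<odot>\<^bsub>W\<^esub> modeM u p w"
proof -
  have sw: "c \<odot>\<^bsub>W\<^esub> w \<in> carrier W" if "w \<in> carrier W" for c w
    using W.smult_closed[of c w] that by simp
  show "modeM (u + u') p w = modeM u p w \<oplus>\<^bsub>W\<^esub> modeM u' p w"
  proof (rule W_eqI)
    fix q assume q: "q \<in> frac_nats T"
    show "modeM (u + u') p w q = (modeM u p w \<oplus>\<^bsub>W\<^esub> modeM u' p w) q"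
    proof (cases "q + p + 1 \<ge> 0")
      case True
      note n = index_frac[OF q p True]
      show ?thesis
        using True q tensor_op_add_left[OF n q W_val[OF w n]]
        by (simp add: M_op_val[OF q] W_simps(3))
    qed (use q in \<open>simp add: M_op_val[OF q] W_simps(3)\<close>)
  qed (intro M_op_closed W.a_closed p w)+
  show "modeM (c *s u) p w = c \<odot>\<^bsub>W\<^esub> modeM u p w"
  proof (rule W_eqI)
    fix q assume q: "q \<in> frac_nats T"
    show "modeM (c *s u) p w q = (c \<odot>\<^bsub>W\<^esub> modeM u p w) q"
    proof (cases "q + p + 1 \<ge> 0")
      case True
      note n = index_frac[OF q p True]
      show ?thesis
        using True q tensor_op_smult_left[OF n q W_val[OF w n]]
        by (simp add: M_op_val[OF q] W_simps(4))
    qed (use q MP.smult_r_null[of c q] in \<open>simp add: M_op_val[OF q] W_simps(4)\<close>)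
  qed (intro M_op_closed sw p w)+
qed

lemma M_op_truncation:
  assumes w: "w \<in> carrier W"
  shows "\<exists>N. \<forall>p\<in>frac_ints T. p \<ge> N \<longrightarrow> modeM u p w = \<zero>\<^bsub>W\<^esub>"
proof -
  obtain B where B: "\<And>n. n \<in> frac_nats T \<Longrightarrow> n > B \<Longrightarrow> w n = \<zero>\<^bsub>MP n\<^esub>"
    using W_bound[OF w] by blast
  have "modeM u p w = \<zero>\<^bsub>W\<^esub>" if p: "p \<in> frac_ints T" "p \<ge> B" for p
  proof (rule W_eqI[OF M_op_closed[OF p(1) w] W.zero_closed])
    fix q assume q: "q \<in> frac_nats T"
    show "modeM u p w q = \<zero>\<^bsub>W\<^esub> q"
    proof (cases "q + p + 1 \<ge> 0")
      case True
      note n = index_frac[OF q p(1) True]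
      \<comment> \<open>Every source degree q + p + 1 then exceeds the bound B on the support of
        w.\<close>
      have "q \<ge> 0" using q by (simp add: frac_nats_iff)
      then have "q + p + 1 > B" using p by linarith
      from B[OF n this] show ?thesis
        using True q tensor_op_zero_right[OF n q, of u] by (simp add: M_op_val[OF q] W_simps(2))
    qed (use q in \<open>simp add: M_op_val[OF q] W_simps(2)\<close>)
  qed
  then show ?thesis by blast
qed

lemma M_op_vacuum:
  assumes p: "p \<in> frac_ints T" and w: "w \<in> carrier W"
  shows "modeM vac p w = (if p = - 1 then w else \<zero>\<^bsub>W\<^esub>)"
proof (rule W_eqI[OF M_op_closed[OF p w]])
  fix q assume q: "q \<in> frac_nats T"
  show "modeM vac p w q = (if p = - 1 then w else \<zero>\<^bsub>W\<^esub>) q"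
  proof (cases "q + p + 1 \<ge> 0")
    case True
    note n = index_frac[OF q p True]
    have "q = q + p + 1 \<longleftrightarrow> p = - 1" by (auto simp: algebra_simps eq_neg_iff_add_eq_0)
    then show ?thesis
      using True q tensor_op_vac[OF n q W_val[OF w n]] by (auto simp: M_op_val[OF q] W_simps(2))
  next
    case False
    moreover have "q \<ge> 0" using q by (simp add: frac_nats_iff)
    ultimately have "p \<noteq> - 1" by auto
    with False q show ?thesis by (simp add: M_op_val[OF q] W_simps(2))
  qed
qed (use w in simp)

text \<open>Integrality of p - r/T amounts to the congruence of \<open>bullet_hom\<close> between
  the degrees q + p + 1 and q; without it all products are 0.\<close>

lemma M_op_twisted:
  assumes r: "r < T" and u: "u \<in> eigenspace r" and w: "w \<in> carrier W" and p: "p \<in> frac_ints T"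
    and ni: "p - of_nat r / of_nat T \<notin> \<int>"
  shows "modeM u p w = \<zero>\<^bsub>W\<^esub>"
proof (rule W_eqI[OF M_op_closed[OF p w] W.zero_closed])
  fix q assume q: "q \<in> frac_nats T"
  show "modeM u p w q = \<zero>\<^bsub>W\<^esub> q"
  proof (cases "q + p + 1 \<ge> 0")
    case True
    define n where "n = q + p + 1"
    have n: "n \<in> frac_nats T" using index_frac[OF q p True] by (simp add: n_def)
    have "(int (bar T n) - int (bar T q)) mod int T \<noteq> int r mod int T"
    proof
      assume "(int (bar T n) - int (bar T q)) mod int T = int r mod int T"
      then have "int T dvd int (bar T n) - int (bar T q) - int r" by (simp add: mod_eq_dvd_iff)
      then obtain z where "int (bar T n) - int (bar T q) - int r = int T * z" by (rule dvdE)
      then have "(of_int (int (bar T n)) :: rat) = of_int (int (bar T q) + int r + int T * z)"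
        by (simp only: of_int_eq_iff)
      then have z: "of_nat (bar T n) / of_nat T = (of_nat (bar T q) / of_nat T + of_nat r / of_nat T + of_int z :: rat)"
        using T_pos by (simp add: field_simps)
      have "n = of_int \<lfloor>n\<rfloor> + of_nat (bar T n) / of_nat T" "q = of_int \<lfloor>q\<rfloor> + of_nat (bar T q) / of_nat T"
        using frac_ints_decompose[of n T] frac_ints_decompose[of q T] n q T_pos by (auto simp: frac_nats_iff)
      then have "p - of_nat r / of_nat T = of_int (\<lfloor>n\<rfloor> - \<lfloor>q\<rfloor> + z - 1)"
        using z n_def by simp
      with ni show False by (metis Ints_of_int)
    qed
    then have "bullet m n q u v = 0" for v
      by (simp add: bullet_eigenspace[OF u r] bullet_hom_def)
    then have "Op n q u (w n) = \<zero>\<^bsub>MP q\<^esub>"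
      by (intro tensor_op_eq_zero n q W_val w) (simp add: subspace_0[OF subspace_O_tilde])
    then show ?thesis using True q by (simp add: M_op_val[OF q] W_simps(2) n_def)
  qed (use q in \<open>simp add: M_op_val[OF q] W_simps(2)\<close>)
qed

lemma in_degree_closed:
  assumes n: "n \<in> frac_nats T" and x: "x \<in> carrier (MP n)"
  shows "in_degree n x \<in> carrier W"
  using assms by (auto simp: W_simps direct_sum_inj_def MP.zero_closed intro: finite_subset[of _ "{n}"])

lemma in_degree_val: "q \<in> frac_nats T \<Longrightarrow> in_degree n x q = (if q = n then x else \<zero>\<^bsub>MP q\<^esub>)"
  by (simp add: direct_sum_inj_def)

lemma M_op_in_degree:
  assumes n: "n \<in> frac_nats T" and p: "p \<in> frac_ints T" and x: "x \<in> carrier (MP n)"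
  shows "modeM u p (in_degree n x) = (if n - p - 1 \<ge> 0 then in_degree (n - p - 1) (Op n (n - p - 1) u x) else \<zero>\<^bsub>W\<^esub>)"
    and "n - p - 1 \<ge> 0 \<Longrightarrow> n - p - 1 \<in> frac_nats T"
proof -
  show q': "n - p - 1 \<in> frac_nats T" if "n - p - 1 \<ge> 0"
    using that n p frac_ints_of_int[OF T_pos, of 1] by (auto simp: frac_nats_iff intro!: frac_ints_diff)
  show "modeM u p (in_degree n x) = (if n - p - 1 \<ge> 0 then in_degree (n - p - 1) (Op n (n - p - 1) u x) else \<zero>\<^bsub>W\<^esub>)"
  proof (rule W_eqI[OF M_op_closed[OF p in_degree_closed[OF n x]]])
    show "(if n - p - 1 \<ge> 0 then in_degree (n - p - 1) (Op n (n - p - 1) u x) else \<zero>\<^bsub>W\<^esub>) \<in> carrier W"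
      using q' in_degree_closed tensor_op_closed[OF n _ x] by auto
    fix q assume q: "q \<in> frac_nats T"
    show "modeM u p (in_degree n x) q = (if n - p - 1 \<ge> 0 then in_degree (n - p - 1) (Op n (n - p - 1) u x) else \<zero>\<^bsub>W\<^esub>) q"
    proof (cases "q + p + 1 = n")
      case True
      then have e: "n - p - 1 = q" "n \<ge> 0" "q \<ge> 0" using n q by (auto simp: frac_nats_iff)
      show ?thesis unfolding M_op_val[OF q] e True by (simp add: e in_degree_val q n)
    next
      case False
      then have ne: "q \<noteq> n - p - 1" by auto
      have "modeM u p (in_degree n x) q = \<zero>\<^bsub>MP q\<^esub>"
      proof (cases "q + p + 1 \<ge> 0")
        case True
        note n' = index_frac[OF q p True]
        show ?thesis using True False tensor_op_zero_right[OF n' q, of u] by (simp add: M_op_val[OF q] in_degree_val[OF n'])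
      qed (simp add: M_op_val[OF q])
      then show ?thesis using ne q by (simp add: in_degree_val W_simps(2))
    qed
  qed
qed

lemma M_mode_formula_M_op: "M_mode_formula m U act modeM"
  unfolding M_mode_formula_def
proof (intro allI ballI)
  fix u v w n p assume w: "w \<in> carrier U" and n: "n \<in> frac_nats T" and p: "p \<in> frac_ints T"
  let ?t = "\<lambda>n v. pure_tensor (A_alg m) (A_bimod n m) (A_right_act n m) U act (v +o O_tilde n m) w"
  have t: "?t n v \<in> carrier (MP n)" for n v
    unfolding pure_tensor_def using w by (intro MP_I) (auto simp: A_bimod_simps)
  have "Op n q u (?t n v) = ?t q (bullet m n q u v)" if q: "q \<in> frac_nats T" for q
    unfolding pure_tensor_def by (simp add: tensor_op_coset[OF n q] bimod_op_coset[OF m n q])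
  then show "modeM u p (M_elem m U act n v w) =
      (if n - p - 1 \<ge> 0 then M_elem m U act (n - p - 1) (bullet m n (n - p - 1) u v) w else \<zero>\<^bsub>W\<^esub>)"
    unfolding M_elem_def using M_op_in_degree[OF n p t] by auto
qed

section \<open>The Laurent condition and associativity for the operators\<close>

interpretation D: twisted_phi_module_data scale mode vac g T W modeM
  by (rule twisted_phi_module_data.intro[OF vertex_algebra_aut_axioms W.module_axioms])

text \<open>The value of the operator of x from degree n to q, as a function of x with w fixed. It
  is linear in x and kills \<open>O1 q n\<close>, so it carries relations in V to equations in
  degree q; the value 0 for n < 0 lets these laws hold on all of \<open>frac_ints T\<close>.\<close>

definition slot_op :: "rat \<Rightarrow> rat \<Rightarrow> (rat \<Rightarrow> (('v set \<times> 'u) \<Rightarrow>\<^sub>0 complex) set) \<Rightarrow> 'v \<Rightarrow> (('v set \<times> 'u) \<Rightarrow>\<^sub>0 complex) set" where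
  "slot_op n q w x = (if n \<ge> 0 then Op n q x (w n) else \<zero>\<^bsub>MP q\<^esub>)"

context
  fixes n q :: rat and w
  assumes n: "n \<in> frac_ints T" and q: "q \<in> frac_nats T" and w: "w \<in> carrier W"
begin

lemma slot_nat: "n \<ge> 0 \<Longrightarrow> n \<in> frac_nats T"
  using n by (simp add: frac_nats_iff)

lemma slot_op_closed: "slot_op n q w x \<in> carrier (MP q)"
  using tensor_op_closed[OF slot_nat q W_val[OF w slot_nat]] by (simp add: slot_op_def MP.zero_closed)

lemma slot_op_add: "slot_op n q w (x + y) = slot_op n q w x \<oplus>\<^bsub>MP q\<^esub> slot_op n q w y"
  using tensor_op_add_left[OF slot_nat q W_val[OF w slot_nat]] by (simp add: slot_op_def)

lemma slot_op_smult: "slot_op n q w (c *s x) = c \<odot>\<^bsub>MP q\<^esub> slot_op n q w x"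
  using tensor_op_smult_left[OF slot_nat q W_val[OF w slot_nat]] MP.smult_r_null[of c q] by (simp add: slot_op_def)

lemma slot_op_O1: "x \<in> O1 q n \<Longrightarrow> slot_op n q w x = \<zero>\<^bsub>MP q\<^esub>"
  using tensor_op_O1[OF slot_nat q W_val[OF w slot_nat]] by (simp add: slot_op_def)

lemma slot_op_zero: "slot_op n q w 0 = \<zero>\<^bsub>MP q\<^esub>"
  by (rule slot_op_O1[OF subspace_0[OF subspace_O1]])

lemma slot_op_cong: "x - y \<in> O1 q n \<Longrightarrow> slot_op n q w x = slot_op n q w y"
  using slot_op_add[of "x - y" y] slot_op_O1[of "x - y"] slot_op_closed[of y] by simp

lemma slot_op_sum_eq_zero:
  assumes "\<And>i. i \<in> A \<Longrightarrow> slot_op n q w (x i) = \<zero>\<^bsub>MP q\<^esub>"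
  shows "slot_op n q w (\<Sum>i\<in>A. c i *s x i) = \<zero>\<^bsub>MP q\<^esub>"
  using assms by (induction A rule: infinite_finite_induct)
    (simp_all add: slot_op_zero slot_op_add slot_op_smult MP.smult_r_null)

text \<open>Lets a sum in the module, read in degree q, be computed inside V.\<close>

lemma finsum_slot_op:
  assumes A: "finite A" and h: "\<And>i. i \<in> A \<Longrightarrow> h i \<in> carrier W" "\<And>i. i \<in> A \<Longrightarrow> h i q = slot_op n q w (x i)"
  shows "(\<Oplus>\<^bsub>W\<^esub>i\<in>A. h i) q = slot_op n q w (\<Sum>i\<in>A. x i)"
  using A h
proof (induction A)
  case empty
  show ?case using q by (simp add: W_simps(2) slot_op_zero)
next
  case (insert i A)
  have "(\<Oplus>\<^bsub>W\<^esub>i\<in>insert i A. h i) = h i \<oplus>\<^bsub>W\<^esub> (\<Oplus>\<^bsub>W\<^esub>i\<in>A. h i)"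
    using insert by (intro W.finsum_insert) auto
  then show ?case using insert q by (simp add: W_simps(3) slot_op_add)
qed

end

lemma W_smult_closed: "x \<in> carrier W \<Longrightarrow> c \<odot>\<^bsub>W\<^esub> x \<in> carrier W"
  using W.smult_closed[of c x] by simp

lemma frac_ints_of_nat: "of_nat j \<in> frac_ints T"
  using frac_ints_of_int[OF T_pos, of "int j"] by simp

lemma frac_ints_1: "1 \<in> frac_ints T"
  using frac_ints_of_nat[of 1] by simp

lemmas frac_ints_closed = frac_ints_add frac_ints_diff frac_ints_of_nat frac_ints_1

lemma prod_coeff_closed:
  assumes w: "w \<in> carrier W" and a: "a \<in> frac_ints T" and b: "b \<in> frac_ints T"
  shows "D.prod_coeff k u v w a b \<in> carrier W"
  unfolding D.prod_coeff_def
  by (intro W.finsum_closed Pi_I W_smult_closed M_op_closed frac_ints_closed w a b)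

text \<open>All summands have the same source degree n = q + k - a - b. The j-th one passes through
  the intermediate degree of \<open>bullet_prod\<close>, where \<open>tensor_op_tensor_op\<close>
  contracts the two operators.\<close>

lemma prod_coeff_val:
  assumes w: "w \<in> carrier W" and a: "a \<in> frac_ints T" and b: "b \<in> frac_ints T" and q: "q \<in> frac_nats T"
    and n: "n = q + of_nat k - a - b"
  shows "D.prod_coeff k u v w a b q = slot_op n q w (bullet_prod k n q u v a)"
proof -
  have q': "q \<in> frac_ints T" using q by (simp add: frac_nats_iff)
  have nf: "n \<in> frac_ints T" unfolding n by (intro frac_ints_closed q' a b)
  show ?thesis
    unfolding D.prod_coeff_def bullet_prod_def
  proof (rule finsum_slot_op[OF nf q w])
    fix j
    define n1 where "n1 = q + of_nat k - a - of_nat j"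
    have n1f: "n1 \<in> frac_ints T" unfolding n1_def by (intro frac_ints_closed q' a)
    have p: "of_nat k - of_nat j - a - 1 \<in> frac_ints T" "of_nat j - b - 1 \<in> frac_ints T"
      by (intro frac_ints_closed a b)+
    show cl: "((- 1) ^ j * of_nat (k choose j)) \<odot>\<^bsub>W\<^esub> modeM u (of_nat k - of_nat j - a - 1) (modeM v (of_nat j - b - 1) w) \<in> carrier W"
      by (intro W_smult_closed M_op_closed p w)
    have i1: "q + (of_nat k - of_nat j - a - 1) + 1 = n1" and i2: "n1 + (of_nat j - b - 1) + 1 = n"
      by (simp_all add: n1_def n)
    have "modeM u (of_nat k - of_nat j - a - 1) (modeM v (of_nat j - b - 1) w) q =
        slot_op n q w (if n1 \<ge> 0 then bullet n n1 q u v else 0)"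
    proof (cases "n1 \<ge> 0")
      case True
      then have n1: "n1 \<in> frac_nats T" using n1f by (simp add: frac_nats_iff)
      have "modeM v (of_nat j - b - 1) w n1 = (if n \<ge> 0 then Op n n1 v (w n) else \<zero>\<^bsub>MP n1\<^esub>)"
        unfolding M_op_val[OF n1] i2 ..
      moreover have "Op n1 q u (Op n n1 v (w n)) = Op n q (bullet n n1 q u v) (w n)" if "n \<ge> 0"
        using that nf by (intro tensor_op_tensor_op n1 q W_val w) (simp_all add: frac_nats_iff)
      ultimately show ?thesis
        unfolding M_op_val[OF q] i1 using True tensor_op_zero_right[OF n1 q, of u] by (simp add: slot_op_def)
    next
      case False
      then show ?thesis
        unfolding M_op_val[OF q] i1 using slot_op_zero[OF nf q w] by simp
    qed
    then show "(((- 1) ^ j * of_nat (k choose j)) \<odot>\<^bsub>W\<^esub> modeM u (of_nat k - of_nat j - a - 1) (modeM v (of_nat j - b - 1) w)) q =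
        slot_op n q w (((- 1) ^ j * of_nat (k choose j)) *s (if q + of_nat k - a - of_nat j \<ge> 0 then bullet n (q + of_nat k - a - of_nat j) q u v else 0))"
      unfolding slot_op_smult[OF nf q w] n1_def[symmetric] using q by (simp add: W_simps(4))
  qed simp
qed

text \<open>Let B bound the degrees of w, so that only sources n <= B matter. For small a the
  product lies in \<open>O1\<close> by \<open>bullet_prod_lower\<close>; for small b all
  intermediate degrees n + b - j are negative. The bound -B - 2 depends on w, the exponent k does
  not.\<close>

lemma prod_laurent_M_op:
  assumes w: "w \<in> carrier W" and k: "\<And>r n. r < T \<Longrightarrow> n \<ge> int k \<Longrightarrow> mode (component r u) n v = 0"
  shows "D.prod_laurent k u v w"
proof -
  obtain B where B: "\<And>n. n \<in> frac_nats T \<Longrightarrow> n > B \<Longrightarrow> w n = \<zero>\<^bsub>MP n\<^esub>"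
    using W_bound[OF w] by blast
  have "D.prod_coeff k u v w a b = \<zero>\<^bsub>W\<^esub>"
    if a: "a \<in> frac_ints T" and b: "b \<in> frac_ints T" and lt: "a < - B - 2 \<or> b < - B - 2" for a b
  proof (rule W_eqI[OF prod_coeff_closed[OF w a b] W.zero_closed])
    fix q assume q: "q \<in> frac_nats T"
    define n where "n = q + of_nat k - a - b"
    have q': "q \<in> frac_ints T" using q by (simp add: frac_nats_iff)
    have nf: "n \<in> frac_ints T" unfolding n_def by (intro frac_ints_closed q' a b)
    have "slot_op n q w (bullet_prod k n q u v a) = \<zero>\<^bsub>MP q\<^esub>"
    proof (cases "n \<ge> 0")
      case True
      then have n: "n \<in> frac_nats T" using nf by (simp add: frac_nats_iff)
      show ?thesis
      proof (cases "n > B")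
        case True
        then show ?thesis using B[OF n True] tensor_op_zero_right[OF n q] by (simp add: slot_op_def)
      next
        case False
        show ?thesis
        proof (cases "a < - B - 2")
          case True
          then have "a < - n - 2" using False by linarith
          then show ?thesis by (intro slot_op_O1[OF nf q w] bullet_prod_lower n q k a)
        next
          case not_a: False
          then have b2: "b < - B - 2" using lt by blast
          have "\<not> q + of_nat k - a - of_nat j \<ge> 0" for j
          proof -
            have "q + of_nat k - a - of_nat j = n + b - of_nat j" by (simp add: n_def)
            moreover have "(of_nat j :: rat) \<ge> 0" by simp
            ultimately show ?thesis using False b2 by linarith
          qed
          then have "bullet_prod k n q u v a = 0"
            unfolding bullet_prod_def by (simp only: if_False scale_zero_right sum.neutral_const)
          then show ?thesis by (simp add: slot_op_zero[OF nf q w])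
        qed
      qed
    qed (simp add: slot_op_def)
    then show "D.prod_coeff k u v w a b q = \<zero>\<^bsub>W\<^esub> q"
      using q by (simp add: prod_coeff_val[OF w a b q n_def] W_simps(2))
  qed
  then show ?thesis unfolding D.prod_laurent_def by blast
qed

text \<open>In degree q every term of the right-hand side starts from the same degree n = q + k - c,
  so the sum over exponents is the operator of one element of V, to which
  \<open>phi_relation\<close> applies.\<close>

lemma phi_relation_M_op:
  assumes w: "w \<in> carrier W" and k: "\<And>r n. r < T \<Longrightarrow> n \<ge> int k \<Longrightarrow> mode (component r u) n v = 0"
    and c: "c \<in> frac_ints T"
  shows "D.phi_lhs_coeff k u v w s c = D.phi_rhs_coeff k u v w s c"
proof -
  let ?A = "{a \<in> frac_ints T. D.prod_coeff k u v w a (c - a) \<noteq> \<zero>\<^bsub>W\<^esub>}"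
  let ?e = "\<lambda>a. fls_nth (fps_to_fls (fps_exp (of_rat a))) s"
  let ?Y = "Y_subst_coeff (fps_to_fls (fps_exp 1 - 1) ^ k) fls_X u v s"
  have ca: "c - a \<in> frac_ints T" if "a \<in> frac_ints T" for a
    using c that by (rule frac_ints_diff)
  have finA: "finite ?A"
  proof -
    obtain N where N: "\<And>a b. a \<in> frac_ints T \<Longrightarrow> b \<in> frac_ints T \<Longrightarrow> a < N \<or> b < N \<Longrightarrow> D.prod_coeff k u v w a b = \<zero>\<^bsub>W\<^esub>"
      using prod_laurent_M_op[OF w k] unfolding D.prod_laurent_def by blast
    have "?A \<subseteq> {a \<in> frac_ints T. N \<le> a \<and> a \<le> c - N}"
    proof
      fix a assume a: "a \<in> ?A"
      then have "\<not> (a < N \<or> c - a < N)" using N[of a "c - a"] ca by blast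
      then have "N \<le> a" "a \<le> c - N" by auto
      with a show "a \<in> {a \<in> frac_ints T. N \<le> a \<and> a \<le> c - N}" by blast
    qed
    then show ?thesis by (rule finite_subset) (rule finite_frac_ints_interval[OF T_pos])
  qed
  have p: "of_nat k - c - 1 \<in> frac_ints T" by (intro frac_ints_closed c)
  show ?thesis
  proof (rule W_eqI)
    show "D.phi_lhs_coeff k u v w s c \<in> carrier W"
      unfolding D.phi_lhs_coeff_def by (rule M_op_closed[OF p w])
    have cl: "?e a \<odot>\<^bsub>W\<^esub> D.prod_coeff k u v w a (c - a) \<in> carrier W" if "a \<in> ?A" for a
      using that by (intro W_smult_closed prod_coeff_closed w ca) auto
    then show "D.phi_rhs_coeff k u v w s c \<in> carrier W"
      unfolding D.phi_rhs_coeff_def by (intro W.finsum_closed Pi_I)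
    fix q assume q: "q \<in> frac_nats T"
    define n where "n = q + of_nat k - c"
    have q': "q \<in> frac_ints T" using q by (simp add: frac_nats_iff)
    have nf: "n \<in> frac_ints T" unfolding n_def by (intro frac_ints_closed q' c)
    note slot = slot_op_add[OF nf q w] slot_op_closed[OF nf q w]
    have val: "D.prod_coeff k u v w a (c - a) q = slot_op n q w (bullet_prod k n q u v a)" if "a \<in> frac_ints T" for a
      using that by (intro prod_coeff_val w ca q) (simp_all add: n_def)
    have "D.phi_lhs_coeff k u v w s c q = slot_op n q w ?Y"
    proof -
      have "q + (of_nat k - c - 1) + 1 = n" by (simp add: n_def)
      then show ?thesis unfolding D.phi_lhs_coeff_def M_op_val[OF q] slot_op_def by simp
    qed
    moreover have "D.phi_rhs_coeff k u v w s c q = slot_op n q w (\<Sum>a\<in>?A. ?e a *s bullet_prod k n q u v a)"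
      unfolding D.phi_rhs_coeff_def
    proof (rule finsum_slot_op[OF nf q w finA cl])
      fix a assume "a \<in> ?A"
      then have "a \<in> frac_ints T" by blast
      then show "(?e a \<odot>\<^bsub>W\<^esub> D.prod_coeff k u v w a (c - a)) q = slot_op n q w (?e a *s bullet_prod k n q u v a)"
        unfolding slot_op_smult[OF nf q w] using q val by (simp only: W_simps(4) restrict_apply if_True)
    qed
    moreover have "slot_op n q w (\<Sum>a\<in>?A. ?e a *s bullet_prod k n q u v a) = slot_op n q w ?Y"
    proof (cases "n \<ge> 0")
      case True
      then have n: "n \<in> frac_nats T" using nf by (simp add: frac_nats_iff)
      \<comment> \<open>The window demanded by \<open>phi_relation\<close>. Exponents in it but
        outside the support add products that act as zero on w in degree q, though they may be
        nonzero in V.\<close>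
      define I where "I = {a \<in> frac_ints T. - n - 2 \<le> a \<and> a \<le> q + of_nat k + 1}"
      have fin: "finite (?A \<union> I)" using finA finite_frac_ints_interval[OF T_pos] by (simp add: I_def)
      have "slot_op n q w (\<Sum>a\<in>(?A \<union> I) - ?A. ?e a *s bullet_prod k n q u v a) = \<zero>\<^bsub>MP q\<^esub>"
      proof (rule slot_op_sum_eq_zero[OF nf q w])
        fix a assume "a \<in> (?A \<union> I) - ?A"
        then have "a \<in> frac_ints T" "D.prod_coeff k u v w a (c - a) = \<zero>\<^bsub>W\<^esub>" by (auto simp: I_def)
        then show "slot_op n q w (bullet_prod k n q u v a) = \<zero>\<^bsub>MP q\<^esub>"
          using val[of a] q by (simp add: W_simps(2))
      qed
      moreover have "(\<Sum>a\<in>?A \<union> I. ?e a *s bullet_prod k n q u v a) =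
          (\<Sum>a\<in>(?A \<union> I) - ?A. ?e a *s bullet_prod k n q u v a) + (\<Sum>a\<in>?A. ?e a *s bullet_prod k n q u v a)"
        by (rule sum.subset_diff[OF _ fin]) blast
      ultimately have "slot_op n q w (\<Sum>a\<in>?A. ?e a *s bullet_prod k n q u v a) =
          slot_op n q w (\<Sum>a\<in>?A \<union> I. ?e a *s bullet_prod k n q u v a)"
        by (simp add: slot del: fps_to_fls_nth)
      also have "\<dots> = slot_op n q w ?Y"
        by (rule slot_op_cong[OF nf q w phi_relation[OF n q k fin]]) (auto simp: I_def)
      finally show ?thesis .
    qed (simp add: slot_op_def)
    ultimately show "D.phi_lhs_coeff k u v w s c q = D.phi_rhs_coeff k u v w s c q" by (simp only:)
  qed
qed

lemma twisted_phi_module_M_op: "twisted_phi_module scale mode vac g T W modeM"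
proof (intro twisted_phi_module.intro D.twisted_phi_module_data_axioms twisted_phi_module_axioms.intro)
  fix u v
  \<comment> \<open>Fixed from the finitely many components of u before any w is given, as the order
    of quantifiers in the axiom demands.\<close>
  obtain k :: nat where k: "\<And>u' v' n. (u', v') \<in> (\<lambda>r. (component r u, v)) ` {..<T} \<Longrightarrow> n \<ge> int k \<Longrightarrow> mode u' n v' = 0"
    by (rule mode_bound_finite[of "(\<lambda>r. (component r u, v)) ` {..<T}"]) auto
  then have k': "mode (component r u) n v = 0" if "r < T" "n \<ge> int k" for r n
    using that by blast
  show "\<exists>k. \<forall>w\<in>carrier W. D.prod_laurent k u v w \<and>
      (\<forall>s. \<forall>c\<in>frac_ints T. D.phi_lhs_coeff k u v w s c = D.phi_rhs_coeff k u v w s c)"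
  proof (intro exI[of _ k] ballI conjI allI)
    fix w s c assume w: "w \<in> carrier W"
    show "D.prod_laurent k u v w" by (rule prod_laurent_M_op[OF w k'])
    show "D.phi_lhs_coeff k u v w s c = D.phi_rhs_coeff k u v w s c" if "c \<in> frac_ints T"
      by (rule phi_relation_M_op[OF w k' that])
  qed
qed (rule M_op_closed M_op_combination_right M_op_combination_left M_op_truncation M_op_vacuum M_op_twisted; assumption)+

section \<open>The homogeneous subspaces and the grading\<close>

lemma M_homog_subset: "n \<in> frac_nats T \<Longrightarrow> M_homog m U act n \<subseteq> carrier W"
  using in_degree_closed[of n] by (auto simp: M_homog_def)

lemma M_homog_submodule:
  assumes n: "n \<in> frac_nats T"
  shows "submodule (M_homog m U act n) (ring_of_type_algebra :: complex ring) W"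
proof (rule W.submoduleI)
  show "M_homog m U act n \<subseteq> carrier W" by (rule M_homog_subset[OF n])
  have zero: "\<zero>\<^bsub>W\<^esub> = in_degree n \<zero>\<^bsub>MP n\<^esub>"
    by (rule W_eqI[OF W.zero_closed in_degree_closed[OF n MP.zero_closed]]) (simp add: in_degree_val W_simps(2))
  show "\<zero>\<^bsub>W\<^esub> \<in> M_homog m U act n"
    unfolding zero M_homog_def by (intro imageI MP.zero_closed)
  have add: "in_degree n x \<oplus>\<^bsub>W\<^esub> in_degree n y = in_degree n (x \<oplus>\<^bsub>MP n\<^esub> y)"
    if "x \<in> carrier (MP n)" "y \<in> carrier (MP n)" for x y
    by (rule W_eqI[OF W.a_closed[OF in_degree_closed in_degree_closed] in_degree_closed[OF n MP.a_closed]])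
      (use that n in \<open>simp_all add: in_degree_val W_simps(3)\<close>)
  show "a \<oplus>\<^bsub>W\<^esub> b \<in> M_homog m U act n" if "a \<in> M_homog m U act n" "b \<in> M_homog m U act n" for a b
    using that by (auto simp: M_homog_def add intro!: imageI MP.a_closed)
  show "\<ominus>\<^bsub>W\<^esub> a \<in> M_homog m U act n" if a: "a \<in> M_homog m U act n" for a
  proof -
    obtain x where x: "a = in_degree n x" "x \<in> carrier (MP n)" using a by (auto simp: M_homog_def)
    have "\<ominus>\<^bsub>W\<^esub> a = in_degree n (\<ominus>\<^bsub>MP n\<^esub> x)"
      unfolding x(1) by (rule W.minus_equality)
        (simp_all add: add x MP.l_neg zero in_degree_closed[OF n] MP.a_inv_closed)
    then show ?thesis using x by (auto simp: M_homog_def)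
  qed
  show "c \<odot>\<^bsub>W\<^esub> a \<in> M_homog m U act n" if a: "a \<in> M_homog m U act n" for c a
  proof -
    obtain x where x: "a = in_degree n x" "x \<in> carrier (MP n)" using a by (auto simp: M_homog_def)
    have cx: "c \<odot>\<^bsub>MP n\<^esub> x \<in> carrier (MP n)" using MP.smult_closed[of c x n] x by simp
    have "c \<odot>\<^bsub>W\<^esub> a = in_degree n (c \<odot>\<^bsub>MP n\<^esub> x)"
      unfolding x(1)
    proof (rule W_eqI[OF W_smult_closed[OF in_degree_closed[OF n x(2)]] in_degree_closed[OF n cx]])
      fix q assume "q \<in> frac_nats T"
      then show "(c \<odot>\<^bsub>W\<^esub> in_degree n x) q = in_degree n (c \<odot>\<^bsub>MP n\<^esub> x) q"
        using MP.smult_r_null[of c q] by (simp add: W_simps(4) in_degree_val)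
    qed
    then show ?thesis using cx by (auto simp: M_homog_def)
  qed
qed

text \<open>A sum of homogeneous vectors, evaluated in degree q, is f q q, because all other members
  vanish there. So the family of components of w sums to w, and any other such family has the same
  components.\<close>

lemma M_homog_decomposition:
  assumes w: "w \<in> carrier W"
  shows "\<exists>!f. f \<in> (\<Pi>\<^sub>E n\<in>frac_nats T. M_homog m U act n) \<and> finite {n \<in> frac_nats T. f n \<noteq> \<zero>\<^bsub>W\<^esub>} \<and>
     w = (\<Oplus>\<^bsub>W\<^esub>n\<in>{n \<in> frac_nats T. f n \<noteq> \<zero>\<^bsub>W\<^esub>}. f n)"
proof -
  have eval: "(\<Oplus>\<^bsub>W\<^esub>n\<in>{n \<in> frac_nats T. f n \<noteq> \<zero>\<^bsub>W\<^esub>}. f n) q = f q q"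
    if f: "\<And>n. n \<in> frac_nats T \<Longrightarrow> f n \<in> M_homog m U act n"
      and fin: "finite {n \<in> frac_nats T. f n \<noteq> \<zero>\<^bsub>W\<^esub>}" and q: "q \<in> frac_nats T" for f q
  proof -
    let ?S = "{n \<in> frac_nats T. f n \<noteq> \<zero>\<^bsub>W\<^esub>}"
    have fW: "f n \<in> carrier W" if "n \<in> frac_nats T" for n
      using f[OF that] M_homog_subset[OF that] by blast
    have other: "f n q = (if q = n then f q q else \<zero>\<^bsub>MP q\<^esub>)" if "n \<in> frac_nats T" for n
      using f[OF that] q by (auto simp: M_homog_def in_degree_val)
    have "(\<Oplus>\<^bsub>W\<^esub>n\<in>?S. f n) q = (\<Oplus>\<^bsub>MP q\<^esub>n\<in>?S. f n q)"
      unfolding M_space_def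
      by (rule direct_sum_finsum[OF module_M_part]) (use fin fW q in \<open>auto simp: M_space_def\<close>)
    \<comment> \<open>The index q is added to the support so that the sum collapses to its q-th term
      even when f q is zero.\<close>
    also have "\<dots> = (\<Oplus>\<^bsub>MP q\<^esub>n\<in>insert q ?S. f n q)"
    proof (cases "q \<in> ?S")
      case True
      then show ?thesis by (simp add: insert_absorb)
    next
      case False
      then have "f q q = \<zero>\<^bsub>MP q\<^esub>" using q by (simp add: W_simps(2))
      moreover have "(\<Oplus>\<^bsub>MP q\<^esub>n\<in>insert q ?S. f n q) = f q q \<oplus>\<^bsub>MP q\<^esub> (\<Oplus>\<^bsub>MP q\<^esub>n\<in>?S. f n q)"
        by (rule MP.finsum_insert[OF fin False]) (use q in \<open>auto intro!: W_val[OF fW]\<close>)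
      moreover have "(\<Oplus>\<^bsub>MP q\<^esub>n\<in>?S. f n q) \<in> carrier (MP q)"
        by (rule MP.finsum_closed) (use q in \<open>auto intro!: W_val[OF fW]\<close>)
      ultimately show ?thesis by simp
    qed
    also have "\<dots> = (\<Oplus>\<^bsub>MP q\<^esub>n\<in>insert q ?S. if q = n then f n q else \<zero>\<^bsub>MP q\<^esub>)"
    proof (rule MP.finsum_cong'[OF refl])
      show "(\<lambda>n. if q = n then f n q else \<zero>\<^bsub>MP q\<^esub>) \<in> insert q ?S \<rightarrow> carrier (MP q)"
        using W_val[OF fW[OF q] q] by (intro Pi_I) auto
      show "f n q = (if q = n then f n q else \<zero>\<^bsub>MP q\<^esub>)" if "n \<in> insert q ?S" for n
      proof (cases "q = n")
        case False
        then show ?thesis using other[of n] that by simp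
      qed simp
    qed
    also have "\<dots> = f q q"
    proof (rule MP.finsum_singleton)
      show "(\<lambda>n. f n q) \<in> insert q ?S \<rightarrow> carrier (MP q)"
        using q by (intro Pi_I W_val[OF fW]) auto
    qed (use fin in simp_all)
    finally show ?thesis .
  qed
  define f where "f = (\<lambda>n\<in>frac_nats T. in_degree n (w n))"
  have f_homog: "f n \<in> M_homog m U act n" if "n \<in> frac_nats T" for n
    using that W_val[OF w] by (simp add: f_def M_homog_def)
  have zero: "in_degree n x = \<zero>\<^bsub>W\<^esub> \<longleftrightarrow> x = \<zero>\<^bsub>MP n\<^esub>" if n: "n \<in> frac_nats T" "x \<in> carrier (MP n)" for n x
  proof
    assume "in_degree n x = \<zero>\<^bsub>W\<^esub>"
    then have "in_degree n x n = \<zero>\<^bsub>W\<^esub> n" by simp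
    then show "x = \<zero>\<^bsub>MP n\<^esub>" using n by (simp add: in_degree_val W_simps(2))
  next
    assume "x = \<zero>\<^bsub>MP n\<^esub>"
    then show "in_degree n x = \<zero>\<^bsub>W\<^esub>"
      by (intro W_eqI in_degree_closed W.zero_closed n) (simp add: in_degree_val W_simps(2))
  qed
  have supp: "{n \<in> frac_nats T. f n \<noteq> \<zero>\<^bsub>W\<^esub>} = {n \<in> frac_nats T. w n \<noteq> \<zero>\<^bsub>MP n\<^esub>}"
    using zero W_val[OF w] by (auto simp: f_def)
  have fin: "finite {n \<in> frac_nats T. f n \<noteq> \<zero>\<^bsub>W\<^esub>}"
    unfolding supp using w by (simp add: W_simps(1))
  have sum_closed: "(\<Oplus>\<^bsub>W\<^esub>n\<in>{n \<in> frac_nats T. h n \<noteq> \<zero>\<^bsub>W\<^esub>}. h n) \<in> carrier W"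
    if "\<And>n. n \<in> frac_nats T \<Longrightarrow> h n \<in> M_homog m U act n" for h
    using that M_homog_subset by (intro W.finsum_closed Pi_I) blast
  show ?thesis
  proof (rule ex1I[of _ f], intro conjI)
    show "f \<in> (\<Pi>\<^sub>E n\<in>frac_nats T. M_homog m U act n)"
      using f_homog by (auto simp: PiE_def f_def)
    show "w = (\<Oplus>\<^bsub>W\<^esub>n\<in>{n \<in> frac_nats T. f n \<noteq> \<zero>\<^bsub>W\<^esub>}. f n)"
    proof (rule W_eqI[OF w sum_closed[OF f_homog]])
      fix q assume q: "q \<in> frac_nats T"
      have "w q = f q q" using q by (simp add: f_def in_degree_val)
      then show "w q = (\<Oplus>\<^bsub>W\<^esub>n\<in>{n \<in> frac_nats T. f n \<noteq> \<zero>\<^bsub>W\<^esub>}. f n) q"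
        by (simp only: eval[OF f_homog fin q])
    qed
    fix f' assume f': "f' \<in> (\<Pi>\<^sub>E n\<in>frac_nats T. M_homog m U act n) \<and> finite {n \<in> frac_nats T. f' n \<noteq> \<zero>\<^bsub>W\<^esub>} \<and>
       w = (\<Oplus>\<^bsub>W\<^esub>n\<in>{n \<in> frac_nats T. f' n \<noteq> \<zero>\<^bsub>W\<^esub>}. f' n)"
    then have f'_homog: "f' n \<in> M_homog m U act n" if "n \<in> frac_nats T" for n
      using that by auto
    show "f' = f"
    proof (rule extensionalityI[of _ "frac_nats T"])
      show "f' \<in> extensional (frac_nats T)" "f \<in> extensional (frac_nats T)"
        using f' by (auto simp: PiE_def f_def)
      fix n assume n: "n \<in> frac_nats T"
      obtain x where x: "f' n = in_degree n x" using f'_homog[OF n] by (auto simp: M_homog_def)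
      have "w n = f' n n" using f' eval[OF f'_homog _ n] by metis
      then have "w n = x" using n by (simp add: x in_degree_val)
      then show "f' n = f n" using n by (simp add: x f_def)
    qed
  qed (rule fin)
qed

lemma graded_twisted_phi_module_M_op:
  "graded_twisted_phi_module scale mode vac g T W modeM (M_homog m U act)"
proof (intro graded_twisted_phi_module.intro twisted_phi_module_M_op graded_twisted_phi_module_axioms.intro)
  fix n p v w assume n: "n \<in> frac_nats T" and p: "p \<in> frac_ints T" and "w \<in> M_homog m U act n"
  then obtain x where x: "w = in_degree n x" "x \<in> carrier (MP n)" by (auto simp: M_homog_def)
  show "modeM v p w \<in> (if n - p - 1 \<ge> 0 then M_homog m U act (n - p - 1) else {\<zero>\<^bsub>W\<^esub>})"
    using M_op_in_degree(1)[OF n p x(2), of v] M_op_in_degree(2)[OF n p x(2)] tensor_op_closed[OF n _ x(2)] by (auto simp: x(1) M_homog_def)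
qed (rule M_homog_submodule M_homog_decomposition; assumption)+

end
end

theorem theorem3p5:
  fixes scale :: "complex \<Rightarrow> 'v::ab_group_add \<Rightarrow> 'v"
    and mode :: "'v \<Rightarrow> int \<Rightarrow> 'v \<Rightarrow> 'v"
    and vac :: 'v
    and g :: "'v \<Rightarrow> 'v"
    and T :: nat
    and m :: rat
    and U :: "(complex, 'u) module"
    and act :: "'v set \<Rightarrow> 'u \<Rightarrow> 'u"
  assumes "vertex_algebra_aut scale mode vac g T"
    and "m \<in> frac_nats T"
    and "algebra_left_module (vertex_algebra_aut.A_alg scale mode vac g T m) U act"
  shows "\<exists>modeM. vertex_algebra_aut.M_mode_formula scale mode vac g T m U act modeM \<and>
           graded_twisted_phi_module scale mode vac g T
             (vertex_algebra_aut.M_space scale mode vac g T m U act) modeM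
             (vertex_algebra_aut.M_homog scale mode vac g T m U act)"
  using vertex_algebra_aut.M_mode_formula_M_op[OF assms]
    vertex_algebra_aut.graded_twisted_phi_module_M_op[OF assms] by blast

end
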